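(* Let $Z$ be a twisted Hilbert space with centralizer $\Omega$. If every twisted spreading model of $Z$ is isomorphic to the Kalton-Peck space $Z_2$, then $\Omega$ is maximal. In particular, $Z$ satisfies the Principle of Small Perturbations.
   Context: $\omega$ is the space of all complex sequences with pointwise convergence; $c_{00}$ is the space of finitely supported sequences. Blocks are finitely supported vectors $u_1,u_2,\dots$ with $\max\operatorname{supp}u_j<\min\operatorname{supp}u_{j+1}$. Centralizer: a homogeneous map $\Omega:\ell_2\to\omega$ for which there is $C>0$ with $\|\Omega(ax)-a\Omega(x)\|_2\le C\|a\|_\infty\|x\|_2$ for all $a\in\ell_\infty$, $x\in\ell_2$. The twisted Hilbert space with centralizer $\Omega$ is $Z=\{(x,y)\in\omega\times\omega:\ y\in\ell_2,\ x-\Omega(y)\in\ell_2\}$ with the quasi-norm $\|(x,y)\|=\|x-\Omega(y)\|_2+\|y\|_2$, which is equivalent to a norm. Maximal centralizer: $\Omega$ is maximal if every sequence $(u_j)$ of semi-normalized (i.e. $0<\inf_j\|u_j\|\le\sup_j\|u_j\|<\infty$) disjoint blocks in $\ell_2$ has a subsequence $(u'_j)$ such that for each $n\in\mathbb N$ there is $\nu=\nu(n)$ for which $$\inf_{\nu(n)\le k_1<\dots<k_n}\frac{\big\|\Omega(\sum_{j=1}^n u'_{k_j})-\sum_{j=1}^n\Omega(u'_{k_j})\big\|_2}{\sqrt n}\longrightarrow\infty\quad(n\to\infty).$$ Kalton-Peck space: $Z_2$ is the twisted Hilbert space with centralizer $\mathcal K$, where $\mathcal K(y)=\sum_j y_j\log|y_j|\,e_j$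 for $\|y\|_2=1$ (with $0\log0=0$), extended homogeneously. Twisted spreading model of $Z$: let $(u_j)$ be a sequence of normalized consecutive blocks in $\ell_2$ such that (after passing to a subsequence; this is always possible) for every $n$ and all scalars $a_1,\dots,a_n,b_1,\dots,b_n$ the limit $$\lim_{\nu\to\infty,\ \nu<k_1<\dots<k_n}\Big(\Big\|\sum_{j=1}^n a_ju_{k_j}+\sum_{j=1}^n b_j\Omega(u_{k_j})-\Omega\Big(\sum_{j=1}^n b_ju_{k_j}\Big)\Big\|_2+\Big\|\sum_{j=1}^n b_ju_{k_j}\Big\|_2\Big)$$ exists. The completion of $c_{00}\times c_{00}$ under the quasi-norm $\|(a,b)\|$ given by this limit is a twisted spreading model of $Z$. Principle of Small Perturbations: $Z$ satisfies it if for every sequence $(w_j)$ in $Z$ equivalent to the unit vector basis of $\ell_2$ there are a subsequence $(w_{k_j})$, scalars $\lambda_j>0$ with $\inf_j\lambda_j>0$ and $\sup_j\lambda_j<\infty$, and blocks $(y_j,0)$ in $Z$ (i.e. $(y_j)$ a sequence of consecutive blocks) such that $\|(y_j,0)\|=1$ and $\|\lambda_jw_{k_j}-(y_j,0)\|\le2^{-j}$ for every $j\in\mathbb N$.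
   Formalization: The claim that passing to a subsequence with all spreading-model limits is "always possible" fails for some discontinuous centralizers (then there may be no twisted spreading model at all); the formal theorem assumes that every normalized block sequence has such a subsequence. *)

theory Defs
  imports "HOL-Analysis.Analysis" "HOL-Library.Function_Algebras"
begin

section \<open>Sequence spaces\<close>

text \<open>The space \<open>\<omega>\<close> is the whole type; sums and products of sequences are pointwise.\<close>

type_synonym cseq = "nat \<Rightarrow> complex"

definition cscale :: "complex \<Rightarrow> cseq \<Rightarrow> cseq" (infixr "*\<^sub>c" 75)
  where "c *\<^sub>c x = (\<lambda>i. c * x i)"

definition supp :: "cseq \<Rightarrow> nat set"
  where "supp x = {i. x i \<noteq> 0}"

definition c00 :: "cseq set"
  where "c00 = {x. finite (supp x)}"

definition l2 :: "cseq set"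
  where "l2 = {x. summable (\<lambda>i. (cmod (x i))\<^sup>2)}"

text \<open>Only meaningful on \<^term>\<open>l2\<close>.\<close>

definition l2norm :: "cseq \<Rightarrow> real"
  where "l2norm x = sqrt (\<Sum>i. (cmod (x i))\<^sup>2)"

definition linf :: "cseq set"
  where "linf = {a. bounded (range a)}"

definition linfnorm :: "cseq \<Rightarrow> real"
  where "linfnorm a = (SUP i. cmod (a i))"


section \<open>Quasi-normed complex vector spaces, isomorphism and completion\<close>

record 'v qn_space =
  pts :: "'v set"
  vadd :: "'v \<Rightarrow> 'v \<Rightarrow> 'v"
  smul :: "complex \<Rightarrow> 'v \<Rightarrow> 'v"
  qnorm :: "'v \<Rightarrow> real"

definition vdiff :: "'v qn_space \<Rightarrow> 'v \<Rightarrow> 'v \<Rightarrow> 'v"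
  where "vdiff X x y = vadd X x (smul X (-1) y)"

definition isomorphic :: "'v qn_space \<Rightarrow> 'w qn_space \<Rightarrow> bool"
  where "isomorphic X Y \<longleftrightarrow>
    (\<exists>T. bij_betw T (pts X) (pts Y)
       \<and> (\<forall>x\<in>pts X. \<forall>y\<in>pts X. T (vadd X x y) = vadd Y (T x) (T y))
       \<and> (\<forall>c. \<forall>x\<in>pts X. T (smul X c x) = smul Y c (T x))
       \<and> (\<exists>m>0. \<exists>M>0. \<forall>x\<in>pts X.
             m * qnorm X x \<le> qnorm Y (T x) \<and> qnorm Y (T x) \<le> M * qnorm X x))"

definition cauchy_seqs :: "'v qn_space \<Rightarrow> (nat \<Rightarrow> 'v) set"
  where "cauchy_seqs X = {x. (\<forall>n. x n \<in> pts X) \<and>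
    (\<forall>e>0. \<exists>N. \<forall>m\<ge>N. \<forall>n\<ge>N. qnorm X (vdiff X (x m) (x n)) < e)}"

definition null_rel :: "'v qn_space \<Rightarrow> (nat \<Rightarrow> 'v) rel"
  where "null_rel X = {(x, y). x \<in> cauchy_seqs X \<and> y \<in> cauchy_seqs X \<and>
    (\<lambda>n. qnorm X (vdiff X (x n) (y n))) \<longlonglongrightarrow> 0}"

text \<open>A quasi-norm need not be continuous, so the quasi-norms along a Cauchy sequence need not
  converge. The infimum over representatives below is a quasi-norm that induces the topology of
  the completion; on the original space it is equivalent to the given quasi-norm (and for a
  norm it is the limit along any representative).\<close>

definition completion :: "'v qn_space \<Rightarrow> (nat \<Rightarrow> 'v) set qn_space"
  where "completion X =
    \<lparr> pts = cauchy_seqs X // null_rel X,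
      vadd = (\<lambda>\<xi> \<eta>. \<Union>x\<in>\<xi>. \<Union>y\<in>\<eta>. null_rel X `` {\<lambda>n. vadd X (x n) (y n)}),
      smul = (\<lambda>c \<xi>. \<Union>x\<in>\<xi>. null_rel X `` {\<lambda>n. smul X c (x n)}),
      qnorm = (\<lambda>\<xi>. INF x\<in>\<xi>. SUP n. qnorm X (x n)) \<rparr>"


section \<open>Centralizers and twisted Hilbert spaces\<close>

text \<open>A map from \<open>\<ell>\<^sub>2\<close> to \<open>\<omega>\<close> is a total function of which only the values on
  \<^term>\<open>l2\<close> matter.\<close>

definition homogeneous :: "(cseq \<Rightarrow> cseq) \<Rightarrow> bool"
  where "homogeneous \<Omega> \<longleftrightarrow> (\<forall>c. \<forall>x\<in>l2. \<Omega> (c *\<^sub>c x) = c *\<^sub>c \<Omega> x)"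

definition centralizer :: "(cseq \<Rightarrow> cseq) \<Rightarrow> bool"
  where "centralizer \<Omega> \<longleftrightarrow> homogeneous \<Omega> \<and>
    (\<exists>C>0. \<forall>a\<in>linf. \<forall>x\<in>l2. \<Omega> (a * x) - a * \<Omega> x \<in> l2 \<and>
       l2norm (\<Omega> (a * x) - a * \<Omega> x) \<le> C * linfnorm a * l2norm x)"

definition pscale :: "complex \<Rightarrow> cseq \<times> cseq \<Rightarrow> cseq \<times> cseq"
  where "pscale c = (\<lambda>(x, y). (c *\<^sub>c x, c *\<^sub>c y))"

definition twisted_space :: "(cseq \<Rightarrow> cseq) \<Rightarrow> (cseq \<times> cseq) qn_space"
  where "twisted_space \<Omega> =
    \<lparr> pts = {(x, y). y \<in> l2 \<and> x - \<Omega> y \<in> l2},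
      vadd = (+),
      smul = pscale,
      qnorm = (\<lambda>(x, y). l2norm (x - \<Omega> y) + l2norm y) \<rparr>"

text \<open>On the unit sphere the value is \<open>\<Sum>\<^sub>j y\<^sub>j log \<bar>y\<^sub>j\<bar> e\<^sub>j\<close>; the general
  formula is its homogeneous extension \<open>\<parallel>y\<parallel> K(y / \<parallel>y\<parallel>)\<close>, which is \<open>0\<close> at \<open>0\<close>.\<close>

definition kalton_peck :: "cseq \<Rightarrow> cseq"
  where "kalton_peck y = (\<lambda>j. y j * complex_of_real (ln (cmod (y j) / l2norm y)))"

definition Z2 :: "(cseq \<times> cseq) qn_space"
  where "Z2 = twisted_space kalton_peck"


section \<open>Blocks and maximal centralizers\<close>

definition blocks :: "(nat \<Rightarrow> cseq) \<Rightarrow> bool"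
  where "blocks u \<longleftrightarrow> (\<forall>j. u j \<in> c00 \<and> supp (u j) \<noteq> {} \<and>
    Max (supp (u j)) < Min (supp (u (Suc j))))"

definition normalized_blocks :: "(nat \<Rightarrow> cseq) \<Rightarrow> bool"
  where "normalized_blocks u \<longleftrightarrow> blocks u \<and> (\<forall>j. l2norm (u j) = 1)"

definition seminormalized_blocks :: "(nat \<Rightarrow> cseq) \<Rightarrow> bool"
  where "seminormalized_blocks u \<longleftrightarrow> blocks u \<and>
    0 < (INF j. l2norm (u j)) \<and> bdd_above (range (\<lambda>j. l2norm (u j)))"

text \<open>Tuples \<open>k 0 < \<dots> < k (n - 1)\<close> of elements of \<open>N\<close>; the values of \<open>k\<close> from \<open>n\<close>
  on are arbitrary.\<close>

definition incr_tuples :: "nat \<Rightarrow> nat set \<Rightarrow> (nat \<Rightarrow> nat) set"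
  where "incr_tuples n N = {k. strict_mono_on {..<n} k \<and> k ` {..<n} \<subseteq> N}"

definition maximal :: "(cseq \<Rightarrow> cseq) \<Rightarrow> bool"
  where "maximal \<Omega> \<longleftrightarrow>
    (\<forall>u. seminormalized_blocks u \<longrightarrow>
      (\<exists>r. strict_mono r \<and>
        (let u' = u \<circ> r in
          \<exists>\<nu> :: nat \<Rightarrow> nat.
            filterlim
              (\<lambda>n. INF k\<in>incr_tuples n {\<nu> n..}.
                 l2norm (\<Omega> (\<Sum>j<n. u' (k j)) - (\<Sum>j<n. \<Omega> (u' (k j)))) / sqrt (real n))
              at_top sequentially)))"


section \<open>Twisted spreading models\<close>

text \<open>The filter of the limit over \<open>\<nu> < k 0 < \<dots> < k (n - 1)\<close> as \<open>\<nu>\<close> tends to infinity.\<close>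

definition spread :: "nat \<Rightarrow> (nat \<Rightarrow> nat) filter"
  where "spread n = (INF \<nu>. principal (incr_tuples n {\<nu><..}))"

definition tsm_expr ::
    "(cseq \<Rightarrow> cseq) \<Rightarrow> (nat \<Rightarrow> cseq) \<Rightarrow> nat \<Rightarrow> cseq \<Rightarrow> cseq \<Rightarrow> (nat \<Rightarrow> nat) \<Rightarrow> real"
  where "tsm_expr \<Omega> u n a b k =
    l2norm ((\<Sum>j<n. a j *\<^sub>c u (k j)) + (\<Sum>j<n. b j *\<^sub>c \<Omega> (u (k j)))
              - \<Omega> (\<Sum>j<n. b j *\<^sub>c u (k j)))
    + l2norm (\<Sum>j<n. b j *\<^sub>c u (k j))"

text \<open>A centralizer need not be continuous. For some discontinuous bounded ones these limits fail
  to exist along every block sequence, so the passage to a subsequence for which they exist is not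
  automatic and has to be assumed.\<close>

definition tsm_limits_exist :: "(cseq \<Rightarrow> cseq) \<Rightarrow> (nat \<Rightarrow> cseq) \<Rightarrow> bool"
  where "tsm_limits_exist \<Omega> u \<longleftrightarrow>
    (\<forall>n a b. \<exists>L. (tsm_expr \<Omega> u n a b \<longlongrightarrow> L) (spread n))"

text \<open>The length of the shortest initial segment carrying \<open>a\<close> and \<open>b\<close>; padding with zero
  coefficients does not change the limit.\<close>

definition joint_length :: "cseq \<Rightarrow> cseq \<Rightarrow> nat"
  where "joint_length a b = (LEAST n. \<forall>j\<ge>n. a j = 0 \<and> b j = 0)"

definition twisted_spreading_model ::
    "(cseq \<Rightarrow> cseq) \<Rightarrow> (nat \<Rightarrow> cseq) \<Rightarrow> (nat \<Rightarrow> cseq \<times> cseq) set qn_space"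
  where "twisted_spreading_model \<Omega> u = completion
    \<lparr> pts = c00 \<times> c00,
      vadd = (+),
      smul = pscale,
      qnorm = (\<lambda>(a, b). Lim (spread (joint_length a b)) (tsm_expr \<Omega> u (joint_length a b) a b)) \<rparr>"


section \<open>The Principle of Small Perturbations\<close>

definition equiv_l2_basis :: "(cseq \<Rightarrow> cseq) \<Rightarrow> (nat \<Rightarrow> cseq \<times> cseq) \<Rightarrow> bool"
  where "equiv_l2_basis \<Omega> w \<longleftrightarrow>
    (\<exists>m>0. \<exists>M>0. \<forall>n. \<forall>a :: nat \<Rightarrow> complex.
      m * sqrt (\<Sum>j<n. (cmod (a j))\<^sup>2) \<le> qnorm (twisted_space \<Omega>) (\<Sum>j<n. pscale (a j) (w j)) \<and>
      qnorm (twisted_space \<Omega>) (\<Sum>j<n. pscale (a j) (w j)) \<le> M * sqrt (\<Sum>j<n. (cmod (a j))\<^sup>2))"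

text \<open>Sequences are indexed from \<open>0\<close> here, whence the exponent \<open>Suc j\<close>.\<close>

definition small_perturbations :: "(cseq \<Rightarrow> cseq) \<Rightarrow> bool"
  where "small_perturbations \<Omega> \<longleftrightarrow>
    (\<forall>w. (\<forall>j. w j \<in> pts (twisted_space \<Omega>)) \<and> equiv_l2_basis \<Omega> w \<longrightarrow>
      (\<exists>(r :: nat \<Rightarrow> nat) (t :: nat \<Rightarrow> real) y.
        strict_mono r \<and>
        (\<forall>j. 0 < t j) \<and> 0 < (INF j. t j) \<and> bdd_above (range t) \<and>
        blocks y \<and>
        (\<forall>j. qnorm (twisted_space \<Omega>) (y j, 0) = 1 \<and>
             qnorm (twisted_space \<Omega>) (pscale (complex_of_real (t j)) (w (r j)) - (y j, 0))
               \<le> 1 / 2 ^ Suc j)))"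

end

theory Submission
  imports Defs "HOL-Library.Ramsey" "HOL-Library.Diagonal_Subsequence"
begin

text \<open>Write \<open>\<Omega> = pr + rem\<close>, where \<open>pr x\<close> is the restriction of \<open>\<Omega> x\<close> to the support of \<open>x\<close>: then
  \<open>pr\<close> is a centralizer that respects supports, and \<open>rem\<close> is bounded. Let \<open>u\<close> be normalized blocks and
  suppose that for infinitely many \<open>n\<close> there are far tuples along which
  \<open>\<parallel>pr (\<Sum>\<^sub>j u\<^sub>j) - \<Sum>\<^sub>j pr u\<^sub>j\<parallel> \<le> B \<surd>n\<close>; up to \<open>\<surd>n\<close> this bound is insensitive to changes
  of signs. An isomorphism of the spreading model with \<open>Z\<^sub>2\<close> maps the basis \<open>(0, e\<^sub>j)\<close> to a sequence
  in \<open>Z\<^sub>2\<close>. If its second components are separated, differences of pairs are nearly disjoint blocks in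
  \<open>Z\<^sub>2\<close>, and the sums of \<open>n\<close> of these have norm at least of order \<open>\<surd>n ln n\<close> for all signs, but for
  suitable signs at most of order \<open>\<surd>n\<close> in the spreading model. If they are not separated, suitable
  pairs behave for suitable signs as the basis of \<open>\<ell>\<^sub>2\<close>, which gives the spreading model type 2
  behaviour; this is contradicted by the vectors \<open>(0, e\<^sub>j)\<close> of \<open>Z\<^sub>2\<close>. Hence the deviation divided by
  \<open>\<surd>n\<close> tends to infinity, which yields maximality.

  As \<open>\<Omega>\<close> need not respect supports, maximality alone does not imply the Principle of Small
  Perturbations: \<open>\<Omega> x = \<phi>(x) e\<^sub>0\<close>, with \<open>\<phi>(x)\<close> the norm of \<open>x\<close> times the phase of its first nonzero
  entry, is maximal. The divergence for \<open>pr\<close> is what forces the second components of a sequence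
  equivalent to the basis of \<open>\<ell>\<^sub>2\<close> to have small terms; the rest is a gliding hump.\<close>

section \<open>Square-summable sequences\<close>

text \<open>The spreading model sees \<open>\<Omega>\<close>, but coefficients can be changed only
  in \<open>pr\<close>: a multiplier that is constant on each block acts on \<open>pr\<close> of the
  block as a scalar, but not on what \<open>\<Omega>\<close> puts outside it. The obstacle is that
  the remainders \<open>rem (u (k j))\<close>, though bounded, may add up to order n instead of sqrt
  n. Two devices deal with this. On the way from \<open>pdev\<close> to \<open>dev\<close>, signs
  are chosen for which the remainders and the vectors under study stay of order sqrt n together. On
  the way back, tuples are used on whose blocks the remainders nearly vanish (\<open>good\<close>).
  Where the signs depend on the tuple, the estimates along far tuples are first secured for all of
  the finitely many sign choices, then the tuple is fixed, and only then the signs. Differences of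
  pairs enter because the second components in \<open>Z2\<close> need not tend to 0 coordinatewise,
  whereas differences along a coordinatewise convergent subsequence do. A centralizer is additive
  only up to an error, so errors of long sums carry weights \<open>j + 1\<close>; perturbations are
  therefore made to decay faster than these weights grow.\<close>

lemma sum_fun_apply: "(\<Sum>j\<in>A. f j) i = (\<Sum>j\<in>A. f j i)" for f :: "'a \<Rightarrow> 'b \<Rightarrow> 'c::comm_monoid_add"
  by (induction A rule: infinite_finite_induct) auto

lemma cscale_apply [simp]: "(c *\<^sub>c x) i = c * x i"
  by (simp add: cscale_def)

lemma cscale_one [simp]: "1 *\<^sub>c x = x" and cscale_zero [simp]: "0 *\<^sub>c x = 0"
  and cscale_zero_right [simp]: "c *\<^sub>c 0 = 0"
  and cscale_minus_one [simp]: "(-1) *\<^sub>c x = - x"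
  by (simp_all add: fun_eq_iff)

lemma cscale_cscale [simp]: "a *\<^sub>c b *\<^sub>c x = (a * b) *\<^sub>c x"
  by (simp add: fun_eq_iff)

lemma cscale_add: "c *\<^sub>c (x + y) = c *\<^sub>c x + c *\<^sub>c y" and cscale_diff: "c *\<^sub>c (x - y) = c *\<^sub>c x - c *\<^sub>c y"
  and cscale_add_left: "(a + b) *\<^sub>c x = a *\<^sub>c x + b *\<^sub>c x"
  and minus_cscale: "(- c) *\<^sub>c x = - (c *\<^sub>c x)"
  by (simp_all add: fun_eq_iff algebra_simps)

lemma cscale_sum: "c *\<^sub>c (\<Sum>j\<in>A. f j) = (\<Sum>j\<in>A. c *\<^sub>c f j)"
  by (simp add: fun_eq_iff sum_fun_apply sum_distrib_left)

lemma cscale_sum_left: "(\<Sum>j\<in>A. f j) *\<^sub>c x = (\<Sum>j\<in>A. f j *\<^sub>c x)"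
  by (simp add: fun_eq_iff sum_fun_apply sum_distrib_right)

lemma l2_L2_set_le:
  assumes "x \<in> l2" shows "L2_set (\<lambda>i. cmod (x i)) {..<n} \<le> l2norm x"
  using assms unfolding L2_set_def l2norm_def l2_def
  by (auto intro!: real_sqrt_le_mono sum_le_suminf)

lemma l2I_L2_set:
  assumes "\<And>n. L2_set (\<lambda>i. cmod (x i)) {..<n} \<le> B"
  shows "x \<in> l2" and "l2norm x \<le> B"
proof -
  have B: "B \<ge> 0" using assms[of 0] by simp
  have *: "(\<Sum>i<n. (cmod (x i))\<^sup>2) \<le> B\<^sup>2" for n
    using assms[of n] unfolding L2_set_def by (simp add: real_sqrt_le_iff real_le_lsqrt B sqrt_le_D)
  have s: "summable (\<lambda>i. (cmod (x i))\<^sup>2)"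
    by (rule bounded_imp_summable[of _ "B\<^sup>2"]) (use *[of "Suc n" for n] in \<open>auto simp: lessThan_Suc_atMost\<close>)
  then show "x \<in> l2" by (simp add: l2_def)
  have "(\<Sum>i. (cmod (x i))\<^sup>2) \<le> B\<^sup>2" using * s by (intro suminf_le_const) auto
  then show "l2norm x \<le> B" unfolding l2norm_def using B by (simp add: real_le_lsqrt)
qed

lemma l2norm_nonneg [simp]: "0 \<le> l2norm x" if "x \<in> l2"
  using that unfolding l2norm_def l2_def by (auto intro!: suminf_nonneg)

lemma l2norm_sq: "x \<in> l2 \<Longrightarrow> (l2norm x)\<^sup>2 = (\<Sum>i. (cmod (x i))\<^sup>2)"
  unfolding l2norm_def l2_def by (auto intro!: suminf_nonneg)

lemma l2_mono:
  assumes "y \<in> l2" "B \<ge> 0" "\<And>i. cmod (x i) \<le> B * cmod (y i)"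
  shows "x \<in> l2" and "l2norm x \<le> B * l2norm y"
proof -
  have "L2_set (\<lambda>i. cmod (x i)) {..<n} \<le> B * l2norm y" for n
  proof -
    have "L2_set (\<lambda>i. cmod (x i)) {..<n} \<le> L2_set (\<lambda>i. B * cmod (y i)) {..<n}"
      by (intro L2_set_mono) (use assms in auto)
    also have "\<dots> = B * L2_set (\<lambda>i. cmod (y i)) {..<n}"
      using assms(2) by (simp add: L2_set_right_distrib)
    also have "\<dots> \<le> B * l2norm y" using assms l2_L2_set_le by (intro mult_left_mono) auto
    finally show ?thesis .
  qed
  then show "x \<in> l2" "l2norm x \<le> B * l2norm y" by (rule l2I_L2_set)+
qed

lemma l2_zero [simp]: "0 \<in> l2" and l2norm_zero [simp]: "l2norm 0 = 0"
  by (simp_all add: l2_def l2norm_def)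

lemma
  assumes "x \<in> l2" "y \<in> l2"
  shows l2_add_mem [simp]: "x + y \<in> l2" and l2norm_triangle: "l2norm (x + y) \<le> l2norm x + l2norm y"
proof -
  have "L2_set (\<lambda>i. cmod ((x + y) i)) {..<n} \<le> l2norm x + l2norm y" for n
  proof -
    have "L2_set (\<lambda>i. cmod ((x + y) i)) {..<n} \<le> L2_set (\<lambda>i. cmod (x i) + cmod (y i)) {..<n}"
      by (intro L2_set_mono) (auto intro: norm_triangle_ineq)
    also have "\<dots> \<le> L2_set (\<lambda>i. cmod (x i)) {..<n} + L2_set (\<lambda>i. cmod (y i)) {..<n}"
      by (rule L2_set_triangle_ineq)
    also have "\<dots> \<le> l2norm x + l2norm y" using assms l2_L2_set_le by (intro add_mono) auto
    finally show ?thesis .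
  qed
  then show "x + y \<in> l2" "l2norm (x + y) \<le> l2norm x + l2norm y" by (rule l2I_L2_set)+
qed

lemma l2_cscale [simp]: "x \<in> l2 \<Longrightarrow> c *\<^sub>c x \<in> l2"
  by (rule l2_mono(1)[of x "cmod c"]) (auto simp: norm_mult)

lemma l2norm_cscale: "l2norm (c *\<^sub>c x) = cmod c * l2norm x" if "x \<in> l2"
  using that by (simp add: l2norm_def norm_mult power_mult_distrib l2_def suminf_mult real_sqrt_mult)

lemma l2_minus [simp]: "x \<in> l2 \<Longrightarrow> - x \<in> l2" and l2norm_minus [simp]: "l2norm (- x) = l2norm x"
  by (auto simp: l2_def l2norm_def)

lemma l2_diff [simp]: "x \<in> l2 \<Longrightarrow> y \<in> l2 \<Longrightarrow> x - y \<in> l2"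
  using l2_add_mem[of x "- y"] by simp

lemma l2norm_triangle_diff: "x \<in> l2 \<Longrightarrow> y \<in> l2 \<Longrightarrow> l2norm (x - y) \<le> l2norm x + l2norm y"
  using l2norm_triangle[of x "- y"] by simp

lemma l2norm_add_le: "x \<in> l2 \<Longrightarrow> y \<in> l2 \<Longrightarrow> l2norm x \<le> a \<Longrightarrow> l2norm y \<le> b \<Longrightarrow> l2norm (x + y) \<le> a + b"
  and l2norm_diff_le: "x \<in> l2 \<Longrightarrow> y \<in> l2 \<Longrightarrow> l2norm x \<le> a \<Longrightarrow> l2norm y \<le> b \<Longrightarrow> l2norm (x - y) \<le> a + b"
  using l2norm_triangle[of x y] l2norm_triangle_diff[of x y] by linarith+

lemma l2_sum [simp, intro!]: "(\<And>j. j \<in> A \<Longrightarrow> f j \<in> l2) \<Longrightarrow> (\<Sum>j\<in>A. f j) \<in> l2"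
  by (induction A rule: infinite_finite_induct) auto

lemma l2norm_sum: "(\<And>j. j \<in> A \<Longrightarrow> f j \<in> l2) \<Longrightarrow> l2norm (\<Sum>j\<in>A. f j) \<le> (\<Sum>j\<in>A. l2norm (f j))"
proof (induction A rule: infinite_finite_induct)
  case (insert x F)
  have "l2norm (f x + (\<Sum>j\<in>F. f j)) \<le> l2norm (f x) + l2norm (\<Sum>j\<in>F. f j)"
    using insert.prems by (intro l2norm_triangle) auto
  moreover have "l2norm (\<Sum>j\<in>F. f j) \<le> (\<Sum>j\<in>F. l2norm (f j))" using insert by blast
  ultimately show "l2norm (\<Sum>j\<in>insert x F. f j) \<le> (\<Sum>j\<in>insert x F. l2norm (f j))"
    using insert.hyps by simp
qed (simp_all add: l2norm_zero[unfolded zero_fun_def])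

lemma l2_coord: "x \<in> l2 \<Longrightarrow> cmod (x i) \<le> l2norm x"
  using l2_L2_set_le[of x "Suc i"] member_le_L2_set[of "{..<Suc i}" i "\<lambda>i. cmod (x i)"] by simp

lemma l2_mult:
  assumes "y \<in> l2" "\<And>i. cmod (a i) \<le> B"
  shows "a * y \<in> l2" and "l2norm (a * y) \<le> B * l2norm y"
proof -
  have B: "B \<ge> 0" using assms(2)[of 0] norm_ge_zero order_trans by blast
  have *: "cmod ((a * y) i) \<le> B * cmod (y i)" for i
    using assms(2)[of i] by (simp add: norm_mult mult_right_mono)
  show "a * y \<in> l2" "l2norm (a * y) \<le> B * l2norm y"
    using l2_mono[of y B "a * y", OF assms(1) B *] by auto
qed

lemma l2norm_parallelogram:
  assumes "x \<in> l2" "y \<in> l2"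
  shows "(l2norm (x + y))\<^sup>2 + (l2norm (x - y))\<^sup>2 = 2 * (l2norm x)\<^sup>2 + 2 * (l2norm y)\<^sup>2"
proof -
  have p: "(cmod ((x + y) i))\<^sup>2 + (cmod ((x - y) i))\<^sup>2 = 2 * (cmod (x i))\<^sup>2 + 2 * (cmod (y i))\<^sup>2" for i
    unfolding cmod_power2 by (simp add: power2_eq_square algebra_simps)
  have s: "summable (\<lambda>i. (cmod (x i))\<^sup>2)" "summable (\<lambda>i. (cmod (y i))\<^sup>2)"
    "summable (\<lambda>i. (cmod ((x + y) i))\<^sup>2)" "summable (\<lambda>i. (cmod ((x - y) i))\<^sup>2)"
    using assms l2_add_mem[OF assms] l2_diff[OF assms] unfolding l2_def by blast+
  have "(\<Sum>i. (cmod ((x + y) i))\<^sup>2) + (\<Sum>i. (cmod ((x - y) i))\<^sup>2)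
      = (\<Sum>i. 2 * (cmod (x i))\<^sup>2 + 2 * (cmod (y i))\<^sup>2)"
    unfolding p[symmetric] using s by (intro suminf_add) auto
  also have "\<dots> = 2 * (\<Sum>i. (cmod (x i))\<^sup>2) + 2 * (\<Sum>i. (cmod (y i))\<^sup>2)"
    using s by (simp add: suminf_add[symmetric] suminf_mult summable_mult)
  finally show ?thesis using assms by (simp add: l2norm_sq)
qed

lemma l2norm_pythagoras:
  assumes "x \<in> l2" "y \<in> l2" "\<And>i. x i = 0 \<or> y i = 0"
  shows "(l2norm (x + y))\<^sup>2 = (l2norm x)\<^sup>2 + (l2norm y)\<^sup>2"
proof -
  have "cmod ((x + y) i) = cmod ((x - y) i)" for i using assms(3)[of i] by auto
  then have "l2norm (x + y) = l2norm (x - y)" unfolding l2norm_def by presburger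
  then show ?thesis using l2norm_parallelogram[OF assms(1,2)] by simp
qed

section \<open>Disjointly supported sums, choice of signs, restriction to coordinate sets\<close>

definition disj_supp :: "nat \<Rightarrow> (nat \<Rightarrow> cseq) \<Rightarrow> bool"
  where "disj_supp n x \<longleftrightarrow> (\<forall>j<n. \<forall>l<n. j \<noteq> l \<longrightarrow> supp (x j) \<inter> supp (x l) = {})"

lemma supp_sum: "supp (\<Sum>j\<in>A. f j) \<subseteq> (\<Union>j\<in>A. supp (f j))"
  unfolding supp_def by (auto simp: sum_fun_apply elim!: sum.not_neutral_contains_not_neutral)

lemma supp_cscale: "supp (c *\<^sub>c x) \<subseteq> supp x" and supp_mult: "supp (a * x) \<subseteq> supp x"
  by (auto simp: supp_def)

lemma disj_cscale: "disj_supp n x \<Longrightarrow> disj_supp n (\<lambda>j. c j *\<^sub>c x j)"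
  using supp_cscale unfolding disj_supp_def by blast

lemma l2norm_disj_sum:
  fixes n :: nat
  assumes "disj_supp n x" "\<And>j. j < n \<Longrightarrow> x j \<in> l2"
  shows "(l2norm (\<Sum>j<n. x j))\<^sup>2 = (\<Sum>j<n. (l2norm (x j))\<^sup>2)"
  using assms
proof (induction n)
  case (Suc n)
  have "supp (x j) \<inter> supp (x n) = {}" if "j < n" for j
    using Suc.prems(1) that unfolding disj_supp_def by (metis less_Suc_eq nat_neq_iff)
  then have "supp (\<Sum>j<n. x j) \<inter> supp (x n) = {}"
    using supp_sum[of x "{..<n}"] by blast
  then have "(\<Sum>j<n. x j) i = 0 \<or> x n i = 0" for i
    unfolding supp_def by auto
  then have "(l2norm ((\<Sum>j<n. x j) + x n))\<^sup>2 = (l2norm (\<Sum>j<n. x j))\<^sup>2 + (l2norm (x n))\<^sup>2"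
    using Suc.prems(2) by (intro l2norm_pythagoras l2_sum) auto
  moreover have "disj_supp n x" using Suc.prems(1) by (auto simp: disj_supp_def)
  ultimately have "(l2norm ((\<Sum>j<n. x j) + x n))\<^sup>2 = (\<Sum>j<Suc n. (l2norm (x j))\<^sup>2)"
    using Suc.IH Suc.prems by auto
  then show "(l2norm (\<Sum>j<Suc n. x j))\<^sup>2 = (\<Sum>j<Suc n. (l2norm (x j))\<^sup>2)"
    by simp
qed (simp add: l2norm_zero[unfolded zero_fun_def])

text \<open>Fixing the value 1 from \<open>n\<close> on makes the set finite. This allows an
  eventual statement along \<open>spread\<close> to hold for all signs simultaneously, before signs
  adapted to a tuple are chosen.\<close>

definition signs :: "nat \<Rightarrow> cseq set"
  where "signs n = {\<theta>. \<forall>j. (j \<in> {..<n} \<longrightarrow> \<theta> j \<in> {1, -1}) \<and> (j \<notin> {..<n} \<longrightarrow> \<theta> j = 1)}"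

lemma finite_signs: "finite (signs n)"
  unfolding signs_def by (rule finite_set_of_finite_funs) auto

lemma signs_cases: "\<theta> \<in> signs n \<Longrightarrow> \<theta> j = 1 \<or> \<theta> j = -1"
  by (cases "j < n") (auto simp: signs_def)

lemma signs_norm: "\<theta> \<in> signs n \<Longrightarrow> cmod (\<theta> j) = 1"
  and signs_sq: "\<theta> \<in> signs n \<Longrightarrow> \<theta> j * \<theta> j = 1"
  using signs_cases[of \<theta> n j] by auto

text \<open>The greedy choice of signs replaces an average over random signs: by the parallelogram law, one
  of the two signs does not increase the sum of squares by more than the average.\<close>

lemma signs_exist:
  fixes n :: nat
  assumes "\<And>j. j < n \<Longrightarrow> s j \<in> l2" "\<And>j. j < n \<Longrightarrow> t j \<in> l2"
  shows "\<exists>\<theta>\<in>signs n. (l2norm (\<Sum>j<n. \<theta> j *\<^sub>c s j))\<^sup>2 + (l2norm (\<Sum>j<n. \<theta> j *\<^sub>c t j))\<^sup>2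
    \<le> (\<Sum>j<n. (l2norm (s j))\<^sup>2 + (l2norm (t j))\<^sup>2)"
  using assms
proof (induction n)
  case 0
  show ?case by (rule bexI[of _ "\<lambda>_. 1"]) (auto simp: l2norm_zero[unfolded zero_fun_def] signs_def)
next
  case (Suc n)
  have "\<exists>\<theta>\<in>signs n. (l2norm (\<Sum>j<n. \<theta> j *\<^sub>c s j))\<^sup>2 + (l2norm (\<Sum>j<n. \<theta> j *\<^sub>c t j))\<^sup>2
    \<le> (\<Sum>j<n. (l2norm (s j))\<^sup>2 + (l2norm (t j))\<^sup>2)"
    by (rule Suc.IH) (use Suc.prems in simp_all)
  then obtain \<theta> where \<theta>: "\<theta> \<in> signs n" and le: "(l2norm (\<Sum>j<n. \<theta> j *\<^sub>c s j))\<^sup>2 + (l2norm (\<Sum>j<n. \<theta> j *\<^sub>c t j))\<^sup>2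
    \<le> (\<Sum>j<n. (l2norm (s j))\<^sup>2 + (l2norm (t j))\<^sup>2)" by blast
  define A where "A = (\<Sum>j<n. \<theta> j *\<^sub>c s j)"
  define B where "B = (\<Sum>j<n. \<theta> j *\<^sub>c t j)"
  have l: "A \<in> l2" "B \<in> l2" "s n \<in> l2" "t n \<in> l2" using Suc.prems by (auto simp: A_def B_def)
  have "(l2norm (A + s n))\<^sup>2 + (l2norm (B + t n))\<^sup>2 \<le> (l2norm A)\<^sup>2 + (l2norm B)\<^sup>2 + (l2norm (s n))\<^sup>2 + (l2norm (t n))\<^sup>2
    \<or> (l2norm (A - s n))\<^sup>2 + (l2norm (B - t n))\<^sup>2 \<le> (l2norm A)\<^sup>2 + (l2norm B)\<^sup>2 + (l2norm (s n))\<^sup>2 + (l2norm (t n))\<^sup>2"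
    using l2norm_parallelogram[of A "s n"] l2norm_parallelogram[of B "t n"] l by linarith
  then obtain e :: complex where e: "e \<in> {1, -1}" "(l2norm (A + e *\<^sub>c s n))\<^sup>2 + (l2norm (B + e *\<^sub>c t n))\<^sup>2
     \<le> (l2norm A)\<^sup>2 + (l2norm B)\<^sup>2 + (l2norm (s n))\<^sup>2 + (l2norm (t n))\<^sup>2"
    by (metis cscale_minus_one cscale_one diff_conv_add_uminus insert_iff)
  have "(\<Sum>j<n. (\<theta>(n := e)) j *\<^sub>c s j) = A" "(\<Sum>j<n. (\<theta>(n := e)) j *\<^sub>c t j) = B"
    unfolding A_def B_def by (auto intro: sum.cong)
  then have "(l2norm (\<Sum>j<Suc n. (\<theta>(n := e)) j *\<^sub>c s j))\<^sup>2 + (l2norm (\<Sum>j<Suc n. (\<theta>(n := e)) j *\<^sub>c t j))\<^sup>2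
      \<le> (\<Sum>j<Suc n. (l2norm (s j))\<^sup>2 + (l2norm (t j))\<^sup>2)"
    using e(2) le unfolding A_def[symmetric] B_def[symmetric] by simp
  moreover have "\<theta>(n := e) \<in> signs (Suc n)" using \<theta> e(1) by (auto simp: signs_def less_Suc_eq)
  ultimately show ?case by (intro bexI[of _ "\<theta>(n := e)"])
qed

text \<open>The same signs serve two families, because \<open>signs_exist\<close> bounds the sum of
  both squares; the constant comes from
  \<open>K\<^sup>2 + L\<^sup>2 \<le> (K + L)\<^sup>2\<close>.\<close>

lemma signs_exist_bounded:
  fixes n :: nat
  assumes "\<And>j. j < n \<Longrightarrow> s j \<in> l2 \<and> l2norm (s j) \<le> K" "\<And>j. j < n \<Longrightarrow> t j \<in> l2 \<and> l2norm (t j) \<le> L"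
    and "0 \<le> K" "0 \<le> L"
  obtains \<theta> where "\<theta> \<in> signs n" "l2norm (\<Sum>j<n. \<theta> j *\<^sub>c s j) \<le> sqrt n * (K + L)" "l2norm (\<Sum>j<n. \<theta> j *\<^sub>c t j) \<le> sqrt n * (K + L)"
proof -
  obtain \<theta> where \<theta>: "\<theta> \<in> signs n" and le: "(l2norm (\<Sum>j<n. \<theta> j *\<^sub>c s j))\<^sup>2 + (l2norm (\<Sum>j<n. \<theta> j *\<^sub>c t j))\<^sup>2
    \<le> (\<Sum>j<n. (l2norm (s j))\<^sup>2 + (l2norm (t j))\<^sup>2)"
    using signs_exist[of n s t] assms by blast
  have "(\<Sum>j<n. (l2norm (s j))\<^sup>2 + (l2norm (t j))\<^sup>2) \<le> (\<Sum>j<n. K\<^sup>2 + L\<^sup>2)"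
    using assms by (intro sum_mono add_mono power_mono) (auto intro!: l2norm_nonneg)
  also have "\<dots> \<le> (sqrt n * (K + L))\<^sup>2"
    using assms(3,4) by (simp add: power_mult_distrib power2_sum mult_left_mono)
  finally have *: "(l2norm (\<Sum>j<n. \<theta> j *\<^sub>c s j))\<^sup>2 \<le> (sqrt n * (K + L))\<^sup>2" "(l2norm (\<Sum>j<n. \<theta> j *\<^sub>c t j))\<^sup>2 \<le> (sqrt n * (K + L))\<^sup>2"
    using le zero_le_power2[of "l2norm (\<Sum>j<n. \<theta> j *\<^sub>c s j)"] zero_le_power2[of "l2norm (\<Sum>j<n. \<theta> j *\<^sub>c t j)"]
    by linarith+
  have "0 \<le> sqrt n * (K + L)" using assms(3,4) by simp
  then show ?thesis using that[OF \<theta> power2_le_imp_le[OF *(1)] power2_le_imp_le[OF *(2)]] by blast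
qed

definition ind :: "nat set \<Rightarrow> cseq"
  where "ind A = (\<lambda>i. of_bool (i \<in> A))"

lemma ind_apply: "(ind A * x) i = (if i \<in> A then x i else 0)"
  by (simp add: ind_def)

lemma cmod_ind_le [simp]: "cmod (ind A i) \<le> 1"
  by (simp add: ind_def)

lemma l2_ind [simp]: "x \<in> l2 \<Longrightarrow> ind A * x \<in> l2"
  and l2norm_ind: "x \<in> l2 \<Longrightarrow> l2norm (ind A * x) \<le> l2norm x"
  using l2_mult[of x "ind A" 1] by auto

lemma ind_supp_mult [simp]: "ind (supp x) * x = x"
  by (rule ext) (simp add: ind_apply supp_def del: times_fun_apply)

lemma l2norm_tail:
  assumes x: "x \<in> l2" and e: "e > 0"
  shows "\<exists>N. \<forall>A. A \<subseteq> {N..} \<longrightarrow> l2norm (ind A * x) \<le> e"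
proof -
  define f where "f = (\<lambda>i. (cmod (x i))\<^sup>2)"
  have s: "summable f" using x by (simp add: l2_def f_def)
  from suminf_exist_split[of "e\<^sup>2" f] obtain N where N: "\<And>n. n \<ge> N \<Longrightarrow> norm (\<Sum>i. f (i + n)) < e\<^sup>2"
    using e s by auto
  have "l2norm (ind A * x) \<le> e" if A: "A \<subseteq> {N..}" for A
  proof (rule l2I_L2_set(2))
    fix n
    have "(\<Sum>i<n. (cmod ((ind A * x) i))\<^sup>2) \<le> (\<Sum>i<n + N. if i < N then 0 else f i)"
      by (intro sum_le_included[where i = id]) (use A in \<open>auto simp: ind_def f_def\<close>)
    also have "\<dots> = (\<Sum>i<n. f (i + N))"
      by (induction n) auto
    also have "\<dots> \<le> (\<Sum>i. f (i + N))"
      by (intro sum_le_suminf summable_ignore_initial_segment s) (auto simp: f_def)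
    also have "\<dots> \<le> e\<^sup>2" using N[of N] by simp
    finally show "L2_set (\<lambda>i. cmod ((ind A * x) i)) {..<n} \<le> e"
      unfolding L2_set_def using e by (intro real_le_lsqrt) (auto intro: sum_nonneg)
  qed
  then show ?thesis by blast
qed

lemma c00_l2 [simp]: "x \<in> c00 \<Longrightarrow> x \<in> l2"
  unfolding c00_def l2_def supp_def
  by (auto intro!: summable_finite[where N = "{i. x i \<noteq> 0}"])

section \<open>Centralizers and twisted Hilbert spaces\<close>

definition ztnorm :: "(cseq \<Rightarrow> cseq) \<Rightarrow> cseq \<times> cseq \<Rightarrow> real"
  where "ztnorm \<Omega> w = l2norm (fst w - \<Omega> (snd w)) + l2norm (snd w)"

definition zspace :: "(cseq \<Rightarrow> cseq) \<Rightarrow> (cseq \<times> cseq) set"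
  where "zspace \<Omega> = {w. snd w \<in> l2 \<and> fst w - \<Omega> (snd w) \<in> l2}"

lemma qnorm_twisted_space [simp]: "qnorm (twisted_space \<Omega>) = ztnorm \<Omega>"
  and pts_twisted_space [simp]: "pts (twisted_space \<Omega>) = zspace \<Omega>"
  and vadd_twisted_space [simp]: "vadd (twisted_space \<Omega>) = (+)"
  and smul_twisted_space [simp]: "smul (twisted_space \<Omega>) = pscale"
  by (auto simp: twisted_space_def ztnorm_def zspace_def fun_eq_iff)

lemma fst_pscale [simp]: "fst (pscale c w) = c *\<^sub>c fst w"
  and snd_pscale [simp]: "snd (pscale c w) = c *\<^sub>c snd w"
  by (simp_all add: pscale_def split: prod.split)

text \<open>An arbitrary pointwise bound \<open>B\<close> replaces the supremum norm, so that
  applications need no supremum; the constant \<open>C\<close> becomes a parameter in which later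
  bounds are explicit.\<close>

locale centr =
  fixes \<Omega> :: "cseq \<Rightarrow> cseq" and C :: real
  assumes C_nonneg: "0 \<le> C"
    and hom: "x \<in> l2 \<Longrightarrow> \<Omega> (c *\<^sub>c x) = c *\<^sub>c \<Omega> x"
    and mult_mem: "x \<in> l2 \<Longrightarrow> \<forall>i. cmod (a i) \<le> B \<Longrightarrow> \<Omega> (a * x) - a * \<Omega> x \<in> l2"
    and mult_le: "x \<in> l2 \<Longrightarrow> \<forall>i. cmod (a i) \<le> B \<Longrightarrow>
      l2norm (\<Omega> (a * x) - a * \<Omega> x) \<le> C * B * l2norm x"

lemma centralizer_imp_centr:
  assumes "centralizer \<Omega>" shows "\<exists>C. centr \<Omega> C"
proof -
  from assms obtain C where C: "C > 0" and le: "\<And>a x. a \<in> linf \<Longrightarrow> x \<in> l2 \<Longrightarrow> \<Omega> (a * x) - a * \<Omega> x \<in> l2 \<and>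
       l2norm (\<Omega> (a * x) - a * \<Omega> x) \<le> C * linfnorm a * l2norm x"
    and h: "homogeneous \<Omega>" unfolding centralizer_def by blast
  have *: "\<Omega> (a * x) - a * \<Omega> x \<in> l2 \<and> l2norm (\<Omega> (a * x) - a * \<Omega> x) \<le> C * B * l2norm x"
    if x: "x \<in> l2" and B: "\<forall>i. cmod (a i) \<le> B" for a x B
  proof -
    have a: "a \<in> linf" unfolding linf_def using B by (auto simp: bounded_iff)
    have "linfnorm a \<le> B" unfolding linfnorm_def using B by (intro cSUP_least) auto
    then have "C * linfnorm a * l2norm x \<le> C * B * l2norm x"
      using C x by (intro mult_right_mono mult_left_mono) auto
    then show ?thesis using le[OF a x] by linarith
  qed
  have "centr \<Omega> C"
    by unfold_locales (use C h * in \<open>auto simp: homogeneous_def\<close>)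
  then show ?thesis ..
qed

context centr
begin

lemma Om_zero [simp]: "\<Omega> 0 = 0"
  using hom[of 0 0] by simp

definition pr :: "cseq \<Rightarrow> cseq" where "pr x = ind (supp x) * \<Omega> x"

definition rem :: "cseq \<Rightarrow> cseq" where "rem x = \<Omega> x - pr x"

lemma Om_split: "\<Omega> x = pr x + rem x" by (simp add: rem_def)

lemma rem_mem [simp]: "x \<in> l2 \<Longrightarrow> rem x \<in> l2"
  using mult_mem[of x "ind (supp x)" 1] unfolding rem_def pr_def by simp

lemma rem_le: "x \<in> l2 \<Longrightarrow> l2norm (rem x) \<le> C * l2norm x"
  using mult_le[of x "ind (supp x)" 1] unfolding rem_def pr_def by simp

lemma supp_pr: "supp (pr x) \<subseteq> supp x"
  by (auto simp: pr_def supp_def ind_def)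

lemma ind_supp_rem: "ind (supp x) * rem x = 0"
  by (rule ext) (auto simp: rem_def pr_def ind_def)

lemma pr_hom: "x \<in> l2 \<Longrightarrow> pr (c *\<^sub>c x) = c *\<^sub>c pr x"
  by (rule ext) (auto simp: pr_def hom ind_def supp_def)

text \<open>The error of \<open>pr\<close> is the error of \<open>\<Omega>\<close> restricted to the
  support of \<open>a * x\<close>, hence the constant stays \<open>C\<close>.\<close>

lemma pr_mult:
  assumes "x \<in> l2" "\<forall>i. cmod (a i) \<le> B"
  shows "pr (a * x) - a * pr x \<in> l2" and "l2norm (pr (a * x) - a * pr x) \<le> C * B * l2norm x"
proof -
  have *: "pr (a * x) - a * pr x = ind (supp (a * x)) * (\<Omega> (a * x) - a * \<Omega> x)"
    by (rule ext) (auto simp: pr_def ind_def supp_def)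
  show "pr (a * x) - a * pr x \<in> l2" unfolding * by (rule l2_ind[OF mult_mem[OF assms]])
  have "l2norm (pr (a * x) - a * pr x) \<le> l2norm (\<Omega> (a * x) - a * \<Omega> x)"
    unfolding * by (rule l2norm_ind[OF mult_mem[OF assms]])
  with mult_le[OF assms] show "l2norm (pr (a * x) - a * pr x) \<le> C * B * l2norm x" by linarith
qed

text \<open>Both vectors are multiples of \<open>\<bar>x\<bar> + \<bar>y\<bar>\<close> by elements of the unit ball of \<open>\<ell>\<^sub>\<infinity>\<close>.\<close>

lemma quasi_add:
  assumes x: "x \<in> l2" and y: "y \<in> l2"
  shows "\<Omega> (x + y) - \<Omega> x - \<Omega> y \<in> l2"
    and "l2norm (\<Omega> (x + y) - \<Omega> x - \<Omega> y) \<le> 4 * C * (l2norm x + l2norm y)"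
proof -
  define z :: cseq where "z = (\<lambda>i. complex_of_real (cmod (x i) + cmod (y i)))"
  define a :: cseq where "a = (\<lambda>i. x i / z i)"
  define b :: cseq where "b = (\<lambda>i. y i / z i)"
  define x' y' :: cseq where "x' = (\<lambda>i. complex_of_real (cmod (x i)))"
    and "y' = (\<lambda>i. complex_of_real (cmod (y i)))"
  have z': "z = x' + y'" by (auto simp: z_def x'_def y'_def)
  have x': "x' \<in> l2" "l2norm x' = l2norm x" using x by (auto simp: x'_def l2_def l2norm_def)
  have y': "y' \<in> l2" "l2norm y' = l2norm y" using y by (auto simp: y'_def l2_def l2norm_def)
  have z: "z \<in> l2" unfolding z' using x' y' by simp
  have zn: "l2norm z \<le> l2norm x + l2norm y" unfolding z' using l2norm_triangle[of x' y'] x' y' by simp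
  have z0: "z i = 0 \<Longrightarrow> x i = 0 \<and> y i = 0" for i
    unfolding z_def of_real_eq_0_iff by (simp add: add_nonneg_eq_0_iff)
  have cz: "cmod (z i) = cmod (x i) + cmod (y i)" for i
    unfolding z_def by (simp only: norm_of_real) simp
  have a1: "\<forall>i. cmod (a i) \<le> 1" and b1: "\<forall>i. cmod (b i) \<le> 1"
    unfolding a_def b_def norm_divide cz
    by (auto intro!: divide_le_eq_1[THEN iffD2] simp: add_nonneg_eq_0_iff less_le)
  have ab: "\<forall>i. cmod ((a + b) i) \<le> 2"
    using norm_triangle_ineq[of "a i" "b i" for i] a1 b1 by (metis add_mono one_add_one order_trans plus_fun_apply)
  have ax: "a * z = x" and bx: "b * z = y" using z0 by (auto simp: fun_eq_iff a_def b_def)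
  have abx: "(a + b) * z = x + y" unfolding ax[symmetric] bx[symmetric] by (simp add: fun_eq_iff algebra_simps)
  define P where "P = \<Omega> ((a + b) * z) - (a + b) * \<Omega> z"
  define Q where "Q = \<Omega> (a * z) - a * \<Omega> z"
  define R where "R = \<Omega> (b * z) - b * \<Omega> z"
  have m: "P \<in> l2" "Q \<in> l2" "R \<in> l2"
    unfolding P_def Q_def R_def by (rule mult_mem[OF z ab] mult_mem[OF z a1] mult_mem[OF z b1])+
  have n: "l2norm P \<le> C * 2 * l2norm z" "l2norm Q \<le> C * 1 * l2norm z" "l2norm R \<le> C * 1 * l2norm z"
    unfolding P_def Q_def R_def by (rule mult_le[OF z ab] mult_le[OF z a1] mult_le[OF z b1])+
  \<comment> \<open>The multipliers are bounded by 2, 1 and 1, so the three errors contribute 2 + 1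
    + 1 = 4 times \<open>C * l2norm z\<close>.\<close>
  have e: "\<Omega> (x + y) - \<Omega> x - \<Omega> y = P - Q - R"
    unfolding P_def Q_def R_def abx ax bx by (simp add: fun_eq_iff algebra_simps)
  show "\<Omega> (x + y) - \<Omega> x - \<Omega> y \<in> l2" unfolding e using m by simp
  have "l2norm (P - Q - R) \<le> l2norm P + l2norm Q + l2norm R"
    using l2norm_triangle_diff[of "P - Q" R] l2norm_triangle_diff[of P Q] m by simp
  also have "\<dots> \<le> 4 * C * l2norm z" using n by simp
  also have "\<dots> \<le> 4 * C * (l2norm x + l2norm y)" using zn C_nonneg by (intro mult_left_mono) auto
  finally show "l2norm (\<Omega> (x + y) - \<Omega> x - \<Omega> y) \<le> 4 * C * (l2norm x + l2norm y)" unfolding e .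
qed

text \<open>Peeling off the first vector each time, \<open>x j\<close> enters the error of its own
  split and of the \<open>j\<close> earlier ones, whence the weight \<open>j + 1\<close>. Wherever
  the bound is used, the norms are small enough to absorb the weights.\<close>

lemma quasi_sum:
  fixes n :: nat
  assumes "\<And>j. j < n \<Longrightarrow> x j \<in> l2"
  shows "\<Omega> (\<Sum>j<n. x j) - (\<Sum>j<n. \<Omega> (x j)) \<in> l2
    \<and> l2norm (\<Omega> (\<Sum>j<n. x j) - (\<Sum>j<n. \<Omega> (x j))) \<le> 4 * C * (\<Sum>j<n. (real j + 1) * l2norm (x j))"
  using assms
proof (induction n arbitrary: x)
  case 0
  show ?case using l2_zero by (simp add: l2norm_zero[unfolded zero_fun_def] Om_zero[unfolded zero_fun_def] zero_fun_def fun_diff_def)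
next
  case (Suc n)
  define X where "X = (\<Sum>j<n. x (Suc j))"
  define D where "D = \<Omega> X - (\<Sum>j<n. \<Omega> (x (Suc j)))"
  define E where "E = \<Omega> (x 0 + X) - \<Omega> (x 0) - \<Omega> X"
  have D: "D \<in> l2" "l2norm D \<le> 4 * C * (\<Sum>j<n. (real j + 1) * l2norm (x (Suc j)))"
    unfolding D_def X_def using Suc.IH[of "\<lambda>j. x (Suc j)", THEN conjunct1] Suc.IH[of "\<lambda>j. x (Suc j)", THEN conjunct2] Suc.prems
    by blast+
  have X: "X \<in> l2" "x 0 \<in> l2" unfolding X_def using Suc.prems by auto
  have Xn: "l2norm X \<le> (\<Sum>j<n. l2norm (x (Suc j)))"
    unfolding X_def using Suc.prems by (intro l2norm_sum) auto
  have E: "E \<in> l2" "l2norm E \<le> 4 * C * (l2norm (x 0) + l2norm X)"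
    unfolding E_def using quasi_add[OF X(2,1)] by auto
  have e: "\<Omega> (\<Sum>j<Suc n. x j) - (\<Sum>j<Suc n. \<Omega> (x j)) = E + D"
    unfolding E_def D_def sum.lessThan_Suc_shift X_def by simp
  have "l2norm (E + D) \<le> l2norm E + l2norm D" using E D by (intro l2norm_triangle)
  also have "\<dots> \<le> 4 * C * (l2norm (x 0) + l2norm X + (\<Sum>j<n. (real j + 1) * l2norm (x (Suc j))))"
    using E D by (simp add: algebra_simps)
  also have "\<dots> \<le> 4 * C * (l2norm (x 0) + (\<Sum>j<n. l2norm (x (Suc j))) + (\<Sum>j<n. (real j + 1) * l2norm (x (Suc j))))"
    using Xn C_nonneg by (intro mult_left_mono) auto
  also have "\<dots> = 4 * C * (\<Sum>j<Suc n. (real j + 1) * l2norm (x j))"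
    unfolding sum.lessThan_Suc_shift by (simp add: sum.distrib algebra_simps sum_distrib_left)
  finally have "l2norm (E + D) \<le> 4 * C * (\<Sum>j<Suc n. (real j + 1) * l2norm (x j))" .
  moreover have "E + D \<in> l2" using E D by simp
  ultimately show "\<Omega> (\<Sum>j<Suc n. x j) - (\<Sum>j<Suc n. \<Omega> (x j)) \<in> l2
    \<and> l2norm (\<Omega> (\<Sum>j<Suc n. x j) - (\<Sum>j<Suc n. \<Omega> (x j))) \<le> 4 * C * (\<Sum>j<Suc n. (real j + 1) * l2norm (x j))"
    unfolding e by blast
qed

lemmas quasi_sum_mem = quasi_sum[THEN conjunct1]
  and quasi_sum_le = quasi_sum[THEN conjunct2]

lemma ztnorm_nonneg [simp]: "w \<in> zspace \<Omega> \<Longrightarrow> 0 \<le> ztnorm \<Omega> w"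
  by (auto simp: ztnorm_def zspace_def)

lemma ztnorm_add:
  assumes "v \<in> zspace \<Omega>" "w \<in> zspace \<Omega>"
  shows "v + w \<in> zspace \<Omega>" and "ztnorm \<Omega> (v + w) \<le> (1 + 4 * C) * (ztnorm \<Omega> v + ztnorm \<Omega> w)"
proof -
  define E where "E = \<Omega> (snd v + snd w) - \<Omega> (snd v) - \<Omega> (snd w)"
  have m: "snd v \<in> l2" "snd w \<in> l2" "fst v - \<Omega> (snd v) \<in> l2" "fst w - \<Omega> (snd w) \<in> l2"
    using assms by (auto simp: zspace_def)
  have E: "E \<in> l2" "l2norm E \<le> 4 * C * (l2norm (snd v) + l2norm (snd w))"
    unfolding E_def using quasi_add[OF m(1,2)] by auto
  have e: "fst (v + w) - \<Omega> (snd (v + w)) = (fst v - \<Omega> (snd v)) + (fst w - \<Omega> (snd w)) - E"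
    by (simp add: E_def)
  show "v + w \<in> zspace \<Omega>" using m E(1) unfolding zspace_def mem_Collect_eq e by simp
  have "l2norm (fst (v + w) - \<Omega> (snd (v + w))) \<le> l2norm (fst v - \<Omega> (snd v)) + l2norm (fst w - \<Omega> (snd w)) + l2norm E"
    unfolding e using m E(1) by (intro l2norm_diff_le l2norm_add_le l2_add_mem order_refl)
  moreover have "l2norm (snd (v + w)) \<le> l2norm (snd v) + l2norm (snd w)"
    using l2norm_triangle m by simp
  ultimately have "ztnorm \<Omega> (v + w) \<le> ztnorm \<Omega> v + ztnorm \<Omega> w + 4 * C * (l2norm (snd v) + l2norm (snd w))"
    using E(2) unfolding ztnorm_def by linarith
  also have "\<dots> \<le> ztnorm \<Omega> v + ztnorm \<Omega> w + 4 * C * (ztnorm \<Omega> v + ztnorm \<Omega> w)"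
    using m C_nonneg by (intro add_left_mono mult_left_mono) (auto simp: ztnorm_def)
  finally show "ztnorm \<Omega> (v + w) \<le> (1 + 4 * C) * (ztnorm \<Omega> v + ztnorm \<Omega> w)"
    by (simp add: algebra_simps)
qed

lemma ztnorm_pscale:
  assumes "w \<in> zspace \<Omega>"
  shows "pscale c w \<in> zspace \<Omega>" and "ztnorm \<Omega> (pscale c w) = cmod c * ztnorm \<Omega> w"
  using assms by (auto simp: zspace_def ztnorm_def hom cscale_diff[symmetric] l2norm_cscale algebra_simps)

lemma zspace_sum:
  assumes "\<And>j. j \<in> A \<Longrightarrow> w j \<in> zspace \<Omega>"
  shows "(\<Sum>j\<in>A. w j) \<in> zspace \<Omega>"
  using assms
proof (induction A rule: infinite_finite_induct)
  case (insert x F)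
  then have "w x + (\<Sum>j\<in>F. w j) \<in> zspace \<Omega>" by (intro ztnorm_add) auto
  then show ?case using insert.hyps by simp
qed (auto simp: zspace_def)

text \<open>If the second components decay fast, combinations of the \<open>w j\<close> are governed
  by the vectors \<open>s j\<close> in the Hilbert space \<open>l2\<close>, where the parallelogram
  law is available.\<close>

lemma ztnorm_sum_small:
  fixes n :: nat
  assumes "\<And>j. j < n \<Longrightarrow> w j \<in> zspace \<Omega>"
  defines "s \<equiv> \<lambda>j. fst (w j) - \<Omega> (snd (w j))"
  shows "\<bar>l2norm (fst (\<Sum>j<n. pscale (c j) (w j)) - \<Omega> (snd (\<Sum>j<n. pscale (c j) (w j)))) - l2norm (\<Sum>j<n. c j *\<^sub>c s j)\<bar>
      \<le> 4 * C * (\<Sum>j<n. (real j + 1) * (cmod (c j) * l2norm (snd (w j))))" (is "\<bar>?L - _\<bar> \<le> ?R")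
    and "l2norm (snd (\<Sum>j<n. pscale (c j) (w j))) \<le> (\<Sum>j<n. cmod (c j) * l2norm (snd (w j)))"
proof -
  have m: "snd (w j) \<in> l2" "s j \<in> l2" if "j < n" for j
    using assms(1)[OF that] by (auto simp: zspace_def s_def)
  have f: "fst (\<Sum>j<n. pscale (c j) (w j)) = (\<Sum>j<n. c j *\<^sub>c fst (w j))"
    and g: "snd (\<Sum>j<n. pscale (c j) (w j)) = (\<Sum>j<n. c j *\<^sub>c snd (w j))"
    by (simp_all add: fst_sum snd_sum)
  define E where "E = \<Omega> (\<Sum>j<n. c j *\<^sub>c snd (w j)) - (\<Sum>j<n. \<Omega> (c j *\<^sub>c snd (w j)))"
  have E: "E \<in> l2" and "l2norm E \<le> 4 * C * (\<Sum>j<n. (real j + 1) * l2norm (c j *\<^sub>c snd (w j)))"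
    unfolding E_def using quasi_sum[of n "\<lambda>j. c j *\<^sub>c snd (w j)"] m by auto
  moreover have "(\<Sum>j<n. (real j + 1) * l2norm (c j *\<^sub>c snd (w j))) = (\<Sum>j<n. (real j + 1) * (cmod (c j) * l2norm (snd (w j))))"
    using m by (intro sum.cong) (auto simp: l2norm_cscale)
  ultimately have En: "l2norm E \<le> ?R" by simp
  have S: "(\<Sum>j<n. c j *\<^sub>c s j) \<in> l2" using m by auto
  have "(\<Sum>j<n. \<Omega> (c j *\<^sub>c snd (w j))) = (\<Sum>j<n. c j *\<^sub>c \<Omega> (snd (w j)))"
    using m by (intro sum.cong) (auto simp: hom)
  then have e: "fst (\<Sum>j<n. pscale (c j) (w j)) - \<Omega> (snd (\<Sum>j<n. pscale (c j) (w j))) = (\<Sum>j<n. c j *\<^sub>c s j) - E"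
    unfolding f g E_def s_def by (simp add: cscale_diff sum_subtractf)
  have "l2norm ((\<Sum>j<n. c j *\<^sub>c s j) - E) \<le> l2norm (\<Sum>j<n. c j *\<^sub>c s j) + l2norm E"
    using S E by (rule l2norm_triangle_diff)
  moreover have "l2norm (\<Sum>j<n. c j *\<^sub>c s j) \<le> l2norm ((\<Sum>j<n. c j *\<^sub>c s j) - E) + l2norm E"
    using l2norm_triangle[of "(\<Sum>j<n. c j *\<^sub>c s j) - E" E] S E by simp
  ultimately show "\<bar>?L - l2norm (\<Sum>j<n. c j *\<^sub>c s j)\<bar> \<le> ?R" unfolding e using En by linarith
  have "l2norm (\<Sum>j<n. c j *\<^sub>c snd (w j)) \<le> (\<Sum>j<n. l2norm (c j *\<^sub>c snd (w j)))"
    using m by (intro l2norm_sum) auto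
  also have "\<dots> = (\<Sum>j<n. cmod (c j) * l2norm (snd (w j)))"
    using m by (intro sum.cong) (auto simp: l2norm_cscale)
  finally show "l2norm (snd (\<Sum>j<n. pscale (c j) (w j))) \<le> (\<Sum>j<n. cmod (c j) * l2norm (snd (w j)))"
    unfolding g .
qed

text \<open>The part of \<open>w\<^sub>j\<close> besides \<open>(pr q\<^sub>j, q\<^sub>j)\<close> consists of the bounded vectors \<open>t\<^sub>j\<close>, and of a perturbation
  that is negligible when the \<open>\<rho>\<^sub>j\<close> decrease fast.\<close>

lemma pr_sum_le:
  fixes n :: nat
  assumes w: "\<And>j. j < n \<Longrightarrow> w j \<in> zspace \<Omega>"
    and q: "\<And>j. j < n \<Longrightarrow> q j \<in> l2" and \<rho>: "\<And>j. j < n \<Longrightarrow> \<rho> j \<in> l2"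
    and s: "\<And>j. j < n \<Longrightarrow> snd (w j) = q j + \<rho> j"
  defines "t \<equiv> \<lambda>j. fst (w j) - pr (q j) - \<Omega> (\<rho> j)"
  shows "\<And>j. j < n \<Longrightarrow> t j \<in> l2 \<and> l2norm (t j) \<le> ztnorm \<Omega> (w j) + 5 * C * (l2norm (q j) + l2norm (\<rho> j))"
    and "l2norm (pr (\<Sum>j<n. c j *\<^sub>c q j) - (\<Sum>j<n. c j *\<^sub>c pr (q j)))
      \<le> ztnorm \<Omega> (\<Sum>j<n. pscale (c j) (w j)) + l2norm (\<Sum>j<n. c j *\<^sub>c t j)
        + 5 * C * l2norm (\<Sum>j<n. c j *\<^sub>c q j) + 8 * C * (\<Sum>j<n. (real j + 1) * (cmod (c j) * l2norm (\<rho> j)))"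
proof -
  have t: "t j \<in> l2 \<and> l2norm (t j) \<le> ztnorm \<Omega> (w j) + 5 * C * (l2norm (q j) + l2norm (\<rho> j))" if j: "j < n" for j
  proof -
    define E where "E = \<Omega> (q j + \<rho> j) - \<Omega> (q j) - \<Omega> (\<rho> j)"
    have E: "E \<in> l2" "l2norm E \<le> 4 * C * (l2norm (q j) + l2norm (\<rho> j))"
      unfolding E_def using quasi_add[OF q[OF j] \<rho>[OF j]] by auto
    have R: "rem (q j) \<in> l2" "l2norm (rem (q j)) \<le> C * l2norm (q j)" using rem_le q[OF j] by auto
    have W: "fst (w j) - \<Omega> (snd (w j)) \<in> l2" using w[OF j] by (auto simp: zspace_def)
    have e: "t j = (fst (w j) - \<Omega> (snd (w j))) + E + rem (q j)"
      unfolding t_def E_def rem_def s[OF j] by simp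
    have "l2norm (t j) \<le> l2norm (fst (w j) - \<Omega> (snd (w j))) + l2norm E + l2norm (rem (q j))"
      unfolding e using E R W by (intro l2norm_add_le l2_add_mem order_refl)
    also have "\<dots> \<le> ztnorm \<Omega> (w j) + 4 * C * (l2norm (q j) + l2norm (\<rho> j)) + C * l2norm (q j)"
      using E R w[OF j] by (intro add_mono) (auto simp: ztnorm_def zspace_def)
    also have "\<dots> \<le> ztnorm \<Omega> (w j) + 5 * C * (l2norm (q j) + l2norm (\<rho> j))"
      using C_nonneg \<rho>[OF j] by (simp add: algebra_simps)
    finally show ?thesis using E R W unfolding e by simp
  qed
  then show "\<And>j. j < n \<Longrightarrow> t j \<in> l2 \<and> l2norm (t j) \<le> ztnorm \<Omega> (w j) + 5 * C * (l2norm (q j) + l2norm (\<rho> j))" .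
  define Q where "Q = (\<Sum>j<n. c j *\<^sub>c q j)"
  define P where "P = (\<Sum>j<n. c j *\<^sub>c \<rho> j)"
  define W where "W = (\<Sum>j<n. pscale (c j) (w j))"
  define T where "T = (\<Sum>j<n. c j *\<^sub>c t j)"
  define G where "G = (\<Sum>j<n. (real j + 1) * (cmod (c j) * l2norm (\<rho> j)))"
  have Q: "Q \<in> l2" and P: "P \<in> l2" and T: "T \<in> l2" unfolding Q_def P_def T_def using q \<rho> t by auto
  have W: "W \<in> zspace \<Omega>" unfolding W_def using w by (intro zspace_sum ztnorm_pscale) auto
  have Pn: "l2norm P \<le> G"
  proof -
    have "l2norm P \<le> (\<Sum>j<n. l2norm (c j *\<^sub>c \<rho> j))" unfolding P_def using \<rho> by (intro l2norm_sum) auto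
    also have "\<dots> \<le> G" unfolding G_def using \<rho>
      by (intro sum_mono) (auto simp: l2norm_cscale algebra_simps)
    finally show ?thesis .
  qed
  have sW: "snd W = Q + P" and fW: "fst W = (\<Sum>j<n. c j *\<^sub>c fst (w j))"
    unfolding W_def Q_def P_def using s by (simp_all add: fst_sum snd_sum cscale_add sum.distrib)
  define E where "E = \<Omega> (Q + P) - \<Omega> Q - \<Omega> P"
  have E: "E \<in> l2" "l2norm E \<le> 4 * C * (l2norm Q + l2norm P)" unfolding E_def using quasi_add[OF Q P] by auto
  define F where "F = \<Omega> P - (\<Sum>j<n. \<Omega> (c j *\<^sub>c \<rho> j))"
  have F: "F \<in> l2" and "l2norm F \<le> 4 * C * (\<Sum>j<n. (real j + 1) * l2norm (c j *\<^sub>c \<rho> j))"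
    unfolding F_def P_def using quasi_sum[of n "\<lambda>j. c j *\<^sub>c \<rho> j"] \<rho> by auto
  moreover have "(\<Sum>j<n. (real j + 1) * l2norm (c j *\<^sub>c \<rho> j)) = G"
    unfolding G_def using \<rho> by (intro sum.cong) (auto simp: l2norm_cscale)
  ultimately have Fn: "l2norm F \<le> 4 * C * G" by simp
  have Fe: "(\<Sum>j<n. \<Omega> (c j *\<^sub>c \<rho> j)) = (\<Sum>j<n. c j *\<^sub>c \<Omega> (\<rho> j))"
    using \<rho> by (intro sum.cong) (auto simp: hom)
  have Te: "T = fst W - (\<Sum>j<n. c j *\<^sub>c pr (q j)) - (\<Sum>j<n. c j *\<^sub>c \<Omega> (\<rho> j))"
    unfolding T_def t_def fW by (simp add: cscale_diff sum_subtractf)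
  have R: "rem Q \<in> l2" "l2norm (rem Q) \<le> C * l2norm Q" using rem_le Q by auto
  define V where "V = fst W - \<Omega> (snd W)"
  have V: "V \<in> l2" "l2norm V \<le> ztnorm \<Omega> W" using W by (auto simp: V_def zspace_def ztnorm_def)
  \<comment> \<open>All terms linear in \<open>c\<close> cancel; what is left are the vectors
    \<open>t j\<close>, the quasi-norm of the whole sum and the additivity errors.\<close>
  have e: "pr Q - (\<Sum>j<n. c j *\<^sub>c pr (q j)) = T - V - F - E - rem Q"
    unfolding V_def Te F_def E_def rem_def sW Fe by simp
  have "l2norm (T - V - F - E - rem Q) \<le> l2norm T + l2norm V + l2norm F + l2norm E + l2norm (rem Q)"
    using T V F E R by (intro l2norm_diff_le l2_diff order_refl)
  also have "\<dots> \<le> l2norm T + ztnorm \<Omega> W + 4 * C * G + 4 * C * (l2norm Q + l2norm P) + C * l2norm Q"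
    using V Fn E R by (intro add_mono) auto
  \<comment> \<open>With \<open>l2norm P \<le> G\<close>: 5 = 4 + 1 from splitting
    \<open>Q + P\<close> and from \<open>rem Q\<close>, and 8 = 4 + 4 from \<open>F\<close> and from
    the share of \<open>P\<close> in \<open>E\<close>.\<close>
  also have "\<dots> \<le> l2norm T + ztnorm \<Omega> W + 4 * C * G + 4 * C * (l2norm Q + G) + C * l2norm Q"
    using Pn C_nonneg by (intro add_mono mult_left_mono) auto
  finally show "l2norm (pr (\<Sum>j<n. c j *\<^sub>c q j) - (\<Sum>j<n. c j *\<^sub>c pr (q j)))
      \<le> ztnorm \<Omega> (\<Sum>j<n. pscale (c j) (w j)) + l2norm (\<Sum>j<n. c j *\<^sub>c t j)
        + 5 * C * l2norm (\<Sum>j<n. c j *\<^sub>c q j) + 8 * C * (\<Sum>j<n. (real j + 1) * (cmod (c j) * l2norm (\<rho> j)))"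
    unfolding Q_def[symmetric] W_def[symmetric] T_def[symmetric] G_def[symmetric] e
    by (simp add: algebra_simps)
qed

end

section \<open>The Kalton-Peck map\<close>

lemma mult_abs_ln_le_one:
  fixes s :: real
  assumes "0 \<le> s" "s \<le> 1" shows "s * \<bar>ln s\<bar> \<le> 1"
proof (cases "s = 0")
  case False
  then have s: "s > 0" using assms by simp
  have "ln (1 / s) \<le> 1 / s - 1" using s by (intro ln_le_minus_one) simp
  then have "\<bar>ln s\<bar> \<le> 1 / s" using s assms by (simp add: ln_div)
  then have "s * \<bar>ln s\<bar> \<le> s * (1 / s)" using s by (intro mult_left_mono) auto
  then show ?thesis using s by simp
qed simp

text \<open>The logarithm of a product splits the error into \<open>F\<close>, with the pointwise
  ratio \<open>cmod (a j) / B\<close>, and a multiple \<open>G\<close> of \<open>a * x\<close> by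
  the logarithm of the ratio \<open>t\<close> of norms. Dividing by \<open>B\<close> makes both
  ratios at most 1, so each part has the form s times ln s with s in [0,1] and costs
  \<open>B * l2norm x\<close>.\<close>

lemma kalton_peck_mult:
  assumes x: "x \<in> l2" and B: "\<forall>i. cmod (a i) \<le> B"
  shows "kalton_peck (a * x) - a * kalton_peck x \<in> l2"
    and "l2norm (kalton_peck (a * x) - a * kalton_peck x) \<le> 2 * B * l2norm x"
proof -
  define t where "t = l2norm (a * x) / (B * l2norm x)"
  define F :: cseq where "F = (\<lambda>j. a j * x j * complex_of_real (ln (cmod (a j) / B)))"
  define G where "G = complex_of_real (ln t) *\<^sub>c (a * x)"
  have B0: "B \<ge> 0" using B[rule_format, of 0] norm_ge_zero order_trans by blast
  have ax: "a * x \<in> l2" "l2norm (a * x) \<le> B * l2norm x" using l2_mult[of x a B] x B by auto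
  have t: "0 \<le> t" "t \<le> 1" using ax x B0 unfolding t_def by (auto intro!: divide_le_eq_1[THEN iffD2] simp: less_le)
  have e: "kalton_peck (a * x) - a * kalton_peck x = F - G"
  proof
    fix j
    show "(kalton_peck (a * x) - a * kalton_peck x) j = (F - G) j"
    proof (cases "a j * x j = 0")
      case True then show ?thesis by (auto simp: kalton_peck_def F_def G_def)
    next
      case False
      then have p: "cmod (a j) > 0" "cmod (x j) > 0" by auto
      have q: "B > 0" using B[rule_format, of j] p by linarith
      have r: "l2norm x > 0" using l2_coord[OF x, of j] p by linarith
      have "0 < cmod (a j) * cmod (x j)" using p by simp
      also have "\<dots> \<le> l2norm (a * x)" using l2_coord[OF ax(1), of j] by (simp add: norm_mult)
      finally have r': "l2norm (a * x) > 0" .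
      have l1: "ln (cmod (a j * x j) / l2norm (a * x)) = ln (cmod (a j)) + ln (cmod (x j)) - ln (l2norm (a * x))"
        using p r' by (simp add: norm_mult ln_mult ln_div)
      have l2: "ln (cmod (x j) / l2norm x) = ln (cmod (x j)) - ln (l2norm x)"
        using p r by (simp add: ln_div)
      have l3: "ln (cmod (a j) / B) = ln (cmod (a j)) - ln B"
        using p q by (simp add: ln_div)
      have l4: "ln t = ln (l2norm (a * x)) - (ln B + ln (l2norm x))"
        unfolding t_def using r' q r by (simp add: ln_div ln_mult)
      have "(kalton_peck (a * x) - a * kalton_peck x) j
        = a j * x j * complex_of_real (ln (cmod (a j * x j) / l2norm (a * x))) - a j * (x j * complex_of_real (ln (cmod (x j) / l2norm x)))"
        by (simp add: kalton_peck_def)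
      also have "\<dots> = a j * x j * complex_of_real (ln (cmod (a j) / B)) - complex_of_real (ln t) * (a j * x j)"
        unfolding l1 l2 l3 l4 by (simp add: ring_distribs)
      finally show ?thesis by (simp add: F_def G_def)
    qed
  qed
  have Fj: "cmod (F j) \<le> B * cmod (x j)" for j
  proof (cases "B = 0")
    case True then show ?thesis using B[rule_format, of j] by (simp add: F_def)
  next
    case False
    then have B1: "B > 0" using B0 by simp
    have "cmod (F j) = B * cmod (x j) * (cmod (a j) / B * \<bar>ln (cmod (a j) / B)\<bar>)"
      using B1 by (simp add: F_def norm_mult)
    also have "\<dots> \<le> B * cmod (x j) * 1"
      using B1 B[rule_format, of j] by (intro mult_left_mono mult_abs_ln_le_one) (auto simp: divide_le_eq_1)
    finally show ?thesis by simp
  qed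
  have F: "F \<in> l2" "l2norm F \<le> B * l2norm x" using l2_mono[OF x B0 Fj] by auto
  have G: "G \<in> l2" unfolding G_def using ax by simp
  have "l2norm G = \<bar>ln t\<bar> * l2norm (a * x)" unfolding G_def by (simp add: l2norm_cscale ax)
  also have "\<dots> \<le> B * l2norm x"
  proof (cases "B * l2norm x = 0")
    case True
    then have "l2norm (a * x) = 0" using ax l2norm_nonneg[OF ax(1)] by linarith
    then show ?thesis by (simp only: True mult_zero_right order_refl)
  next
    case False
    then have p: "B * l2norm x > 0" using mult_nonneg_nonneg[OF B0 l2norm_nonneg[OF x]] by linarith
    then have "\<bar>ln t\<bar> * l2norm (a * x) = B * l2norm x * (t * \<bar>ln t\<bar>)" by (simp add: t_def)
    also have "\<dots> \<le> B * l2norm x * 1" using p t by (intro mult_left_mono mult_abs_ln_le_one) auto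
    finally show ?thesis by simp
  qed
  finally have Gn: "l2norm G \<le> B * l2norm x" .
  show "kalton_peck (a * x) - a * kalton_peck x \<in> l2" unfolding e using F G by simp
  show "l2norm (kalton_peck (a * x) - a * kalton_peck x) \<le> 2 * B * l2norm x"
    unfolding e using l2norm_diff_le[OF F(1) G F(2) Gn] by simp
qed

lemma kalton_peck_hom: "x \<in> l2 \<Longrightarrow> kalton_peck (c *\<^sub>c x) = c *\<^sub>c kalton_peck x"
  by (cases "c = 0") (auto simp: kalton_peck_def fun_eq_iff norm_mult l2norm_cscale)

interpretation kp: centr kalton_peck 2
  by unfold_locales (simp_all add: kalton_peck_hom kalton_peck_mult)

lemma kp_pr [simp]: "kp.pr x = kalton_peck x"
  by (rule ext) (auto simp: kp.pr_def ind_def kalton_peck_def supp_def)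

lemma sum_disj_apply:
  assumes "disj_supp n x" "l < n" "i \<in> supp (x l)"
  shows "(\<Sum>j<n. x j) i = x l i"
proof -
  have "x j i = 0" if "j < n" "j \<noteq> l" for j
    using assms that unfolding disj_supp_def supp_def by blast
  then have "(\<Sum>j<n. x j i) = (\<Sum>j\<in>{l}. x j i)"
    using assms by (intro sum.mono_neutral_right) auto
  then show ?thesis by (simp add: sum_fun_apply)
qed

text \<open>On the support of \<open>q l\<close> the two logarithms differ by the constant
  \<open>ln (l2norm (q l) / l2norm Q)\<close>. The deviation is thus again a disjoint sum, and
  orthogonality gives \<open>l2norm Q \<ge> sqrt n * \<delta>\<close>, so all these constants are
  large. Nothing depends on the phases of \<open>c\<close>: no choice of signs can avoid the
  logarithmic growth.\<close>

lemma kalton_peck_disj_sum: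
  assumes d: "disj_supp n q" and q: "\<And>j. j < n \<Longrightarrow> q j \<in> l2"
    and c: "\<And>j. cmod (c j) = 1" and \<delta>: "\<And>j. j < n \<Longrightarrow> \<delta> \<le> l2norm (q j)" "\<delta> > 0"
    and M: "\<And>j. j < n \<Longrightarrow> l2norm (q j) \<le> M" and n: "n > 0"
  shows "sqrt n * \<delta> * ln (sqrt n * \<delta> / M)
    \<le> l2norm (kalton_peck (\<Sum>j<n. c j *\<^sub>c q j) - (\<Sum>j<n. c j *\<^sub>c kalton_peck (q j)))"
proof -
  define Q where "Q = (\<Sum>j<n. c j *\<^sub>c q j)"
  define m where "m j = complex_of_real (ln (l2norm (q j) / l2norm Q))" for j
  have Q: "Q \<in> l2" unfolding Q_def using q by auto
  have dc: "disj_supp n (\<lambda>j. c j *\<^sub>c q j)" by (rule disj_cscale[OF d])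
  have "(l2norm Q)\<^sup>2 = (\<Sum>j<n. (l2norm (q j))\<^sup>2)"
    unfolding Q_def using l2norm_disj_sum[OF dc] q by (simp add: l2norm_cscale c)
  also have "\<dots> \<ge> (\<Sum>j<n. \<delta>\<^sup>2)" using \<delta> by (intro sum_mono power_mono) auto
  finally have "(l2norm Q)\<^sup>2 \<ge> (sqrt n * \<delta>)\<^sup>2" by (simp add: power_mult_distrib)
  then have Qn: "l2norm Q \<ge> sqrt n * \<delta>" by (rule power2_le_imp_le) (simp add: Q)
  have "0 < sqrt n * \<delta>" using \<delta>(2) n by simp
  then have Q0: "l2norm Q > 0" using Qn by linarith
  have e: "kalton_peck Q - (\<Sum>j<n. c j *\<^sub>c kalton_peck (q j)) = (\<Sum>j<n. m j *\<^sub>c c j *\<^sub>c q j)"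
  proof
    fix i
    show "(kalton_peck Q - (\<Sum>j<n. c j *\<^sub>c kalton_peck (q j))) i = (\<Sum>j<n. m j *\<^sub>c c j *\<^sub>c q j) i"
    proof (cases "\<exists>l<n. i \<in> supp (q l)")
      case False
      then have z: "q j i = 0" if "j < n" for j using that by (auto simp: supp_def)
      then show ?thesis by (simp add: Q_def sum_fun_apply kalton_peck_def)
    next
      case True
      then obtain l where l: "l < n" "i \<in> supp (q l)" by blast
      then have nz: "q l i \<noteq> 0" "c l \<noteq> 0" using c[of l] by (auto simp: supp_def)
      have 1: "Q i = c l * q l i" unfolding Q_def
        using sum_disj_apply[OF dc l(1), of i] nz by (simp add: supp_def)
      have z: "q j i = 0" if "j < n" "j \<noteq> l" for j
        using d l that unfolding disj_supp_def supp_def by blast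
      have 2: "(\<Sum>j<n. c j * kalton_peck (q j) i) = (\<Sum>j\<in>{l}. c j * kalton_peck (q j) i)"
        using z l by (intro sum.mono_neutral_right) (auto simp: kalton_peck_def)
      have 3: "(\<Sum>j<n. m j * (c j * q j i)) = (\<Sum>j\<in>{l}. m j * (c j * q j i))"
        using z l by (intro sum.mono_neutral_right) auto
      have "l2norm (q l) > 0" using \<delta> l(1) by (auto intro: less_le_trans)
      then have "ln (cmod (Q i) / l2norm Q) = ln (cmod (q l i) / l2norm (q l)) + ln (l2norm (q l) / l2norm Q)"
        unfolding 1 using nz c[of l] Q0 by (simp add: norm_mult ln_div)
      then have "kalton_peck Q i = c l * kalton_peck (q l) i + m l * (c l * q l i)"
        unfolding kalton_peck_def 1 m_def by (simp add: ring_distribs)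
      then show ?thesis using 2 3 by (simp add: sum_fun_apply mult.assoc)
    qed
  qed
  show ?thesis
  \<comment> \<open>A nonpositive logarithm makes the left side nonpositive; a positive one permits
    squaring the termwise bounds.\<close>
  proof (cases "ln (sqrt n * \<delta> / M) \<le> 0")
    case True
    have "(\<Sum>j<n. m j *\<^sub>c c j *\<^sub>c q j) \<in> l2" using q by (intro l2_sum l2_cscale) auto
    then have "0 \<le> l2norm (\<Sum>j<n. m j *\<^sub>c c j *\<^sub>c q j)" by (rule l2norm_nonneg)
    moreover have "sqrt n * \<delta> * ln (sqrt n * \<delta> / M) \<le> 0"
      using True \<delta>(2) by (intro mult_nonneg_nonpos) auto
    ultimately show ?thesis unfolding Q_def[symmetric] e by linarith
  next
    case False
    define L where "L = ln (sqrt n * \<delta> / M)"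
    have L: "L > 0" using False by (simp add: L_def)
    have mj: "L * \<delta> \<le> l2norm (m j *\<^sub>c c j *\<^sub>c q j)" if j: "j < n" for j
    proof -
      have p: "l2norm (q j) > 0" using \<delta> j by (auto intro: less_le_trans)
      have M0: "M > 0" using p M[OF j] by linarith
      have "sqrt n * \<delta> / M \<le> l2norm Q / l2norm (q j)"
        using Qn M[OF j] p \<delta>(2) Q by (intro frac_le) auto
      then have "L \<le> ln (l2norm Q / l2norm (q j))" unfolding L_def
        using n \<delta>(2) M0 by (subst ln_le_cancel_iff) (auto intro!: divide_pos_pos mult_pos_pos Q0 p)
      also have "\<dots> = - ln (l2norm (q j) / l2norm Q)" using p Q0 by (simp add: ln_div)
      finally have "L \<le> \<bar>ln (l2norm (q j) / l2norm Q)\<bar>" by linarith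
      then have "L * \<delta> \<le> \<bar>ln (l2norm (q j) / l2norm Q)\<bar> * l2norm (q j)"
        using \<delta>(1)[OF j] L \<delta>(2) by (intro mult_mono) auto
      then show ?thesis using q[OF j] by (simp add: l2norm_cscale m_def norm_mult c)
    qed
    have "(sqrt n * \<delta> * L)\<^sup>2 = (\<Sum>j<n. (L * \<delta>)\<^sup>2)" by (simp add: power_mult_distrib)
    also have "\<dots> \<le> (\<Sum>j<n. (l2norm (m j *\<^sub>c c j *\<^sub>c q j))\<^sup>2)"
      using mj L \<delta>(2) by (intro sum_mono power_mono) auto
    also have "\<dots> = (l2norm (\<Sum>j<n. m j *\<^sub>c c j *\<^sub>c q j))\<^sup>2"
      using l2norm_disj_sum[OF disj_cscale[OF dc, of m]] q by auto
    finally show ?thesis unfolding Q_def[symmetric] e L_def[symmetric]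
      by (rule power2_le_imp_le) (use q in \<open>auto intro!: l2norm_nonneg\<close>)
  qed
qed

section \<open>Limits along far tuples, and subsequences of blocks\<close>

lemma eventually_spread: "eventually P (spread n) \<longleftrightarrow> (\<exists>\<nu>. \<forall>k\<in>incr_tuples n {\<nu><..}. P k)"
proof -
  have "eventually P (spread n) \<longleftrightarrow> (\<exists>\<nu>\<in>UNIV. eventually P (principal (incr_tuples n {\<nu><..})))"
    unfolding spread_def
  proof (rule eventually_INF_base)
    fix a b :: nat
    show "\<exists>x\<in>UNIV. principal (incr_tuples n {x<..}) \<le> inf (principal (incr_tuples n {a<..})) (principal (incr_tuples n {b<..}))"
      by (rule bexI[of _ "max a b"]) (auto simp: incr_tuples_def)
  qed auto
  then show ?thesis by (simp add: eventually_principal)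
qed

lemma frequently_spread: "(\<exists>\<^sub>F k in spread n. P k) \<longleftrightarrow> (\<forall>\<nu>. \<exists>k\<in>incr_tuples n {\<nu><..}. P k)"
  unfolding frequently_def eventually_spread by auto

lemma incr_tuples_shift: "(\<lambda>j. \<nu> + j) \<in> incr_tuples n {\<nu>..}" "(\<lambda>j. Suc \<nu> + j) \<in> incr_tuples n {\<nu><..}"
  by (auto simp: incr_tuples_def strict_mono_on_def)

lemma spread_nontrivial [simp]: "spread n \<noteq> bot"
  unfolding trivial_limit_def eventually_spread using incr_tuples_shift(2) by blast

lemma spread_antimono:
  assumes mn: "m \<le> n" shows "spread n \<le> spread m"
proof (rule filter_leI)
  fix P assume "eventually P (spread m)"
  then obtain \<nu> where \<nu>: "\<And>k. k \<in> incr_tuples m {\<nu><..} \<Longrightarrow> P k" unfolding eventually_spread by blast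
  have "incr_tuples n {\<nu><..} \<subseteq> incr_tuples m {\<nu><..}"
    using mn unfolding incr_tuples_def
    by (auto intro: monotone_on_subset[of "{..<n}" "(<)" "(<)"] simp: image_subset_iff)
  then show "eventually P (spread n)" unfolding eventually_spread using \<nu> by blast
qed

lemma incr_tuples_inj: "k \<in> incr_tuples n N \<Longrightarrow> inj_on k {..<n}"
  by (auto simp: incr_tuples_def intro: strict_mono_on_imp_inj_on)

lemma incr_tuples_comp:
  assumes "k \<in> incr_tuples N {\<nu><..}" "strict_mono_on {..<n} r" "\<And>j. j < n \<Longrightarrow> r j < N"
  shows "k \<circ> r \<in> incr_tuples n {\<nu><..}"
  using assms by (auto simp: incr_tuples_def strict_mono_on_def image_subset_iff)

text \<open>Selecting entries of a far tuple gives a far tuple; this is the source of the invariance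
  of the model under spreading.\<close>

lemma filterlim_spread_comp:
  assumes "strict_mono_on {..<n} r" "\<And>j. j < n \<Longrightarrow> r j < N"
  shows "filterlim (\<lambda>k. k \<circ> r) (spread n) (spread N)"
  unfolding filterlim_iff eventually_spread using incr_tuples_comp assms by meson

lemma filterlim_spread_subseq:
  fixes r :: "nat \<Rightarrow> nat"
  assumes "strict_mono r"
  shows "filterlim (\<lambda>k. r \<circ> k) (spread n) (spread n)"
proof -
  have "r \<circ> k \<in> incr_tuples n {\<nu><..}" if "k \<in> incr_tuples n {\<nu><..}" for k \<nu>
  proof -
    have "strict_mono_on {..<n} (r \<circ> k)"
      using that strict_monoD[OF assms] by (simp add: incr_tuples_def strict_mono_on_def)
    moreover have "\<nu> < r (k j)" if "j < n" for j
      using \<open>k \<in> incr_tuples n {\<nu><..}\<close> that seq_suble[OF assms, of "k j"]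
      by (auto simp: incr_tuples_def image_subset_iff intro: less_le_trans)
    ultimately show ?thesis by (auto simp: incr_tuples_def)
  qed
  then show ?thesis unfolding filterlim_iff eventually_spread by meson
qed

lemma tsm_expr_subseq: "tsm_expr \<Omega> (u \<circ> r) n a b k = tsm_expr \<Omega> u n a b (r \<circ> k)"
  by (simp add: tsm_expr_def)

lemma tsm_limits_exist_subseq:
  assumes "tsm_limits_exist \<Omega> u" "strict_mono r"
  shows "tsm_limits_exist \<Omega> (u \<circ> r)"
  unfolding tsm_limits_exist_def
proof (intro allI)
  fix n a b
  obtain L where "(tsm_expr \<Omega> u n a b \<longlongrightarrow> L) (spread n)" using assms(1) unfolding tsm_limits_exist_def by blast
  from filterlim_compose[OF this filterlim_spread_subseq[OF assms(2)]]
  show "\<exists>L. (tsm_expr \<Omega> (u \<circ> r) n a b \<longlongrightarrow> L) (spread n)" unfolding tsm_expr_subseq by blast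
qed

lemma blocks_separated:
  assumes "blocks u" "i < j" "x \<in> supp (u i)" "y \<in> supp (u j)"
  shows "x < y"
  using assms(2,4)
proof (induction j arbitrary: y)
  case (Suc j)
  have f: "finite (supp (u l))" "supp (u l) \<noteq> {}" "Max (supp (u l)) < Min (supp (u (Suc l)))" for l
    using assms(1) by (auto simp: blocks_def c00_def)
  have *: "Max (supp (u j)) < y" using f(3)[of j] f(1)[of "Suc j"] Suc.prems(2) by (meson Min_le less_le_trans)
  show ?case
  proof (cases "i = j")
    case True
    then show ?thesis using * assms(3) f(1)[of j] by (meson Max_ge le_less_trans)
  next
    case False
    then have "x < Max (supp (u j))" using Suc f by (intro Suc.IH) auto
    then show ?thesis using * by linarith
  qed
qed simp

lemma blocksI:
  assumes "\<And>j. u j \<in> c00" "\<And>j. supp (u j) \<noteq> {}" "\<And>j x y. x \<in> supp (u j) \<Longrightarrow> y \<in> supp (u (Suc j)) \<Longrightarrow> x < y"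
  shows "blocks u"
  using assms unfolding blocks_def c00_def by auto

lemma blocks_subseq:
  assumes "blocks u" "strict_mono r" shows "blocks (u \<circ> r)"
proof (rule blocksI)
  fix j x y assume "x \<in> supp ((u \<circ> r) j)" "y \<in> supp ((u \<circ> r) (Suc j))"
  then show "x < y" using blocks_separated[OF assms(1), of "r j" "r (Suc j)" x y] assms(2)
    by (auto simp: strict_mono_def)
next
  fix j
  show "(u \<circ> r) j \<in> c00" "supp ((u \<circ> r) j) \<noteq> {}"
    using assms(1) unfolding blocks_def comp_def by blast+
qed

lemma normalized_blocks_subseq: "normalized_blocks u \<Longrightarrow> strict_mono r \<Longrightarrow> normalized_blocks (u \<circ> r)"
  unfolding normalized_blocks_def using blocks_subseq by simp

section \<open>Completions of quasi-normed spaces\<close>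

text \<open>Isolates what the completion requires of \<open>c00 \<times> c00\<close> with the limit
  quasi-norm; \<open>s_minus\<close> turns \<open>vdiff\<close> into ordinary subtraction.\<close>

locale qn_vector_space =
  fixes V :: "'v::ab_group_add set" and s :: "complex \<Rightarrow> 'v \<Rightarrow> 'v" and p :: "'v \<Rightarrow> real" and \<kappa> :: real
  assumes \<kappa>: "0 < \<kappa>"
    and V_add: "v \<in> V \<Longrightarrow> w \<in> V \<Longrightarrow> v + w \<in> V"
    and V_scale: "v \<in> V \<Longrightarrow> s c v \<in> V"
    and s_add: "s c (v + w) = s c v + s c w"
    and s_minus: "s (-1) v = - v"
    and p_nonneg: "v \<in> V \<Longrightarrow> 0 \<le> p v"
    and p_add: "v \<in> V \<Longrightarrow> w \<in> V \<Longrightarrow> p (v + w) \<le> \<kappa> * (p v + p w)"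
    and p_scale: "v \<in> V \<Longrightarrow> p (s c v) = cmod c * p v"
    and p_zero: "p 0 = 0"
begin

abbreviation X :: "'v qn_space" where "X \<equiv> \<lparr>pts = V, vadd = (+), smul = s, qnorm = p\<rparr>"

definition cl :: "(nat \<Rightarrow> 'v) \<Rightarrow> (nat \<Rightarrow> 'v) set" where "cl x = null_rel X `` {x}"

lemma vdiff_eq: "vdiff X v w = v - w"
  by (simp add: vdiff_def s_minus)

lemma V_diff: "v \<in> V \<Longrightarrow> w \<in> V \<Longrightarrow> v - w \<in> V"
  using V_add[of v "s (-1) w"] V_scale[of w "-1"] by (simp add: s_minus)

lemma s_diff: "s c (v - w) = s c v - s c w"
  using s_add[of c "v - w" w] by simp

lemma p_minus_commute: "v \<in> V \<Longrightarrow> w \<in> V \<Longrightarrow> p (v - w) = p (w - v)"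
  using p_scale[of "w - v" "-1"] V_diff[of w v] by (simp add: s_minus)

lemma p_triangle3: "u \<in> V \<Longrightarrow> v \<in> V \<Longrightarrow> w \<in> V \<Longrightarrow> p (u - w) \<le> \<kappa> * (p (u - v) + p (v - w))"
  using p_add[of "u - v" "v - w"] V_diff by simp

lemma cauchy_iff: "x \<in> cauchy_seqs X \<longleftrightarrow>
    (\<forall>n. x n \<in> V) \<and> (\<forall>e>0. \<exists>N. \<forall>m\<ge>N. \<forall>n\<ge>N. p (x m - x n) < e)"
  by (simp add: cauchy_seqs_def vdiff_eq)

lemma null_iff: "(x, y) \<in> null_rel X \<longleftrightarrow>
    x \<in> cauchy_seqs X \<and> y \<in> cauchy_seqs X \<and> (\<lambda>n. p (x n - y n)) \<longlonglongrightarrow> 0"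
  by (simp add: null_rel_def vdiff_eq)

lemma cauchy_V: "x \<in> cauchy_seqs X \<Longrightarrow> x n \<in> V"
  by (simp add: cauchy_iff)

lemma null_trans:
  assumes "x \<in> cauchy_seqs X" "y \<in> cauchy_seqs X" "z \<in> cauchy_seqs X"
    "(\<lambda>n. p (x n - y n)) \<longlonglongrightarrow> 0" "(\<lambda>n. p (y n - z n)) \<longlonglongrightarrow> 0"
  shows "(\<lambda>n. p (x n - z n)) \<longlonglongrightarrow> 0"
proof (rule tendsto_sandwich[of "\<lambda>_. 0"])
  show "(\<lambda>n. \<kappa> * (p (x n - y n) + p (y n - z n))) \<longlonglongrightarrow> 0"
    using tendsto_mult[OF tendsto_const[of \<kappa>] tendsto_add[OF assms(4,5)]] by simp
qed (use assms(1-3)[THEN cauchy_V] in \<open>auto intro!: always_eventually p_triangle3 p_nonneg V_diff\<close>)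

lemma equiv_null: "equiv (cauchy_seqs X) (null_rel X)"
proof (rule equivI)
  show "null_rel X \<subseteq> cauchy_seqs X \<times> cauchy_seqs X" by (auto simp: null_rel_def)
  show "refl_on (cauchy_seqs X) (null_rel X)" by (auto simp: refl_on_def null_iff p_zero)
  show "sym (null_rel X)"
    by (rule symI) (use p_minus_commute cauchy_V in \<open>auto simp: null_iff\<close>)
  show "trans (null_rel X)"
    by (rule transI) (use null_trans in \<open>auto simp: null_iff\<close>)
qed

lemma cl_eqI: "(x, y) \<in> null_rel X \<Longrightarrow> cl x = cl y"
  unfolding cl_def by (rule equiv_class_eq[OF equiv_null])

lemma cauchy_add:
  assumes "x \<in> cauchy_seqs X" "y \<in> cauchy_seqs X"
  shows "(\<lambda>n. x n + y n) \<in> cauchy_seqs X"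
  unfolding cauchy_iff
proof (intro conjI allI impI)
  fix e :: real assume e: "e > 0"
  then have e': "e / (2 * \<kappa>) > 0" using \<kappa> by simp
  obtain M N where M: "\<And>m n. m \<ge> M \<Longrightarrow> n \<ge> M \<Longrightarrow> p (x m - x n) < e / (2 * \<kappa>)"
    and N: "\<And>m n. m \<ge> N \<Longrightarrow> n \<ge> N \<Longrightarrow> p (y m - y n) < e / (2 * \<kappa>)"
    using assms e' unfolding cauchy_iff by meson
  have "p (x m + y m - (x n + y n)) < e" if "m \<ge> max M N" "n \<ge> max M N" for m n
  proof -
    have "p ((x m - x n) + (y m - y n)) \<le> \<kappa> * (p (x m - x n) + p (y m - y n))"
      using assms[THEN cauchy_V] by (intro p_add V_diff)
    also have "\<dots> < \<kappa> * (e / (2 * \<kappa>) + e / (2 * \<kappa>))"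
      using that \<kappa> by (intro mult_strict_left_mono add_strict_mono M N) auto
    also have "\<dots> = e" using \<kappa> by (simp add: field_simps)
    finally show ?thesis by (simp add: algebra_simps)
  qed
  then show "\<exists>N. \<forall>m\<ge>N. \<forall>n\<ge>N. p (x m + y m - (x n + y n)) < e" by blast
qed (use assms[THEN cauchy_V] V_add in auto)

lemma cauchy_scale:
  assumes "x \<in> cauchy_seqs X"
  shows "(\<lambda>n. s c (x n)) \<in> cauchy_seqs X"
  unfolding cauchy_iff
proof (intro conjI allI impI)
  fix e :: real assume e: "e > 0"
  then have "e / (cmod c + 1) > 0" by (simp add: add_nonneg_pos)
  then obtain M where M: "\<And>m n. m \<ge> M \<Longrightarrow> n \<ge> M \<Longrightarrow> p (x m - x n) < e / (cmod c + 1)"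
    using assms unfolding cauchy_iff by meson
  have "p (s c (x m) - s c (x n)) < e" if "m \<ge> M" "n \<ge> M" for m n
  proof -
    have v: "x m - x n \<in> V" using assms[THEN cauchy_V] by (intro V_diff)
    have "p (s c (x m) - s c (x n)) = cmod c * p (x m - x n)"
      unfolding s_diff[symmetric] using v by (rule p_scale)
    also have "\<dots> \<le> (cmod c + 1) * p (x m - x n)" using p_nonneg[OF v] by (simp add: algebra_simps)
    also have "\<dots> < e" using M[OF that] by (simp add: pos_less_divide_eq add_nonneg_pos mult.commute)
    finally show ?thesis .
  qed
  then show "\<exists>N. \<forall>m\<ge>N. \<forall>n\<ge>N. p (s c (x m) - s c (x n)) < e" by blast
qed (use assms[THEN cauchy_V] V_scale in auto)

lemma cauchy_const: "v \<in> V \<Longrightarrow> (\<lambda>_. v) \<in> cauchy_seqs X"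
  by (simp add: cauchy_iff p_zero)

lemma vadd_cl:
  assumes "x \<in> cauchy_seqs X" "y \<in> cauchy_seqs X"
  shows "vadd (completion X) (cl x) (cl y) = cl (\<lambda>n. x n + y n)"
proof -
  have "cl (\<lambda>n. x n + y n) = cl (\<lambda>n. x' n + y' n)" if "(x, x') \<in> null_rel X" "(y, y') \<in> null_rel X" for x x' y y'
  proof (rule cl_eqI)
    have c: "x \<in> cauchy_seqs X" "x' \<in> cauchy_seqs X" "y \<in> cauchy_seqs X" "y' \<in> cauchy_seqs X"
      and l: "(\<lambda>n. p (x n - x' n)) \<longlonglongrightarrow> 0" "(\<lambda>n. p (y n - y' n)) \<longlonglongrightarrow> 0"
      using that by (auto simp: null_iff)
    have "(\<lambda>n. p ((x n - x' n) + (y n - y' n))) \<longlonglongrightarrow> 0"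
    proof (rule tendsto_sandwich[of "\<lambda>_. 0"])
      show "(\<lambda>n. \<kappa> * (p (x n - x' n) + p (y n - y' n))) \<longlonglongrightarrow> 0"
        using tendsto_mult[OF tendsto_const[of \<kappa>] tendsto_add[OF l]] by simp
    qed (use c[THEN cauchy_V] in \<open>auto intro!: always_eventually p_add p_nonneg V_diff V_add\<close>)
    then have "(\<lambda>n. p (x n + y n - (x' n + y' n))) \<longlonglongrightarrow> 0"
      by (simp only: add_diff_add)
    then show "(\<lambda>n. x n + y n, \<lambda>n. x' n + y' n) \<in> null_rel X"
      using c cauchy_add by (simp add: null_iff)
  qed
  then have "congruent2 (null_rel X) (null_rel X) (\<lambda>x y. cl (\<lambda>n. x n + y n))"
    unfolding congruent2_def by blast
  from UN_equiv_class2[OF equiv_null equiv_null this assms] show ?thesis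
    unfolding completion_def cl_def by simp
qed

lemma smul_cl:
  assumes "x \<in> cauchy_seqs X"
  shows "smul (completion X) c (cl x) = cl (\<lambda>n. s c (x n))"
proof -
  have "cl (\<lambda>n. s c (x n)) = cl (\<lambda>n. s c (x' n))" if "(x, x') \<in> null_rel X" for x x'
  proof (rule cl_eqI)
    have a: "x \<in> cauchy_seqs X" "x' \<in> cauchy_seqs X"
      and l: "(\<lambda>n. p (x n - x' n)) \<longlonglongrightarrow> 0"
      using that by (auto simp: null_iff)
    have "p (s c (x n) - s c (x' n)) = cmod c * p (x n - x' n)" for n
      unfolding s_diff[symmetric] using a[THEN cauchy_V] by (intro p_scale V_diff)
    then have "(\<lambda>n. p (s c (x n) - s c (x' n))) \<longlonglongrightarrow> 0"
      using tendsto_mult[OF tendsto_const[of "cmod c"] l] by simp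
    then show "(\<lambda>n. s c (x n), \<lambda>n. s c (x' n)) \<in> null_rel X"
      using a cauchy_scale by (simp add: null_iff)
  qed
  then have "congruent (null_rel X) (\<lambda>x. cl (\<lambda>n. s c (x n)))"
    unfolding congruent_def by auto
  from UN_equiv_class[OF equiv_null this assms] show ?thesis
    unfolding completion_def cl_def by simp
qed

lemma cauchy_bounded:
  assumes "x \<in> cauchy_seqs X"
  shows "bdd_above (range (\<lambda>n. p (x n)))"
proof -
  obtain N where N: "\<And>m n. m \<ge> N \<Longrightarrow> n \<ge> N \<Longrightarrow> p (x m - x n) < 1"
    using assms unfolding cauchy_iff by (meson zero_less_one)
  have "p (x n) \<le> Max ((\<lambda>n. p (x n)) ` {..N}) + \<kappa> * (1 + p (x N))" for n
  proof (cases "n \<le> N")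
    case True
    then have "p (x n) \<le> Max ((\<lambda>n. p (x n)) ` {..N})" by (intro Max_ge) auto
    moreover have "0 \<le> \<kappa> * (1 + p (x N))" using \<kappa> p_nonneg[OF cauchy_V[OF assms]] by (intro mult_nonneg_nonneg add_nonneg_nonneg) auto
    ultimately show ?thesis by linarith
  next
    case False
    have "p ((x n - x N) + x N) \<le> \<kappa> * (p (x n - x N) + p (x N))"
      using assms[THEN cauchy_V] by (intro p_add V_diff)
    also have "\<dots> \<le> \<kappa> * (1 + p (x N))"
      using False \<kappa> N[of n N] by (intro mult_left_mono) auto
    finally have "p (x n) \<le> \<kappa> * (1 + p (x N))" by simp
    moreover have "0 \<le> p (x N)" using p_nonneg cauchy_V[OF assms] by blast
    moreover have "p (x N) \<le> Max ((\<lambda>n. p (x n)) ` {..N})" by (intro Max_ge) auto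
    ultimately show ?thesis by linarith
  qed
  then show ?thesis by (intro bdd_aboveI2)
qed

lemma mem_cl: "y \<in> cl x \<longleftrightarrow> (x, y) \<in> null_rel X"
  by (simp add: cl_def)

lemma qnorm_cl_le:
  assumes "y \<in> cl x" "\<And>n. p (y n) \<le> B"
  shows "qnorm (completion X) (cl x) \<le> B"
proof -
  have "0 \<le> (SUP n. p (z n))" if "z \<in> cl x" for z
  proof -
    have z: "z \<in> cauchy_seqs X" using that by (simp add: mem_cl null_iff)
    have "0 \<le> p (z 0)" using p_nonneg cauchy_V[OF z] by blast
    also have "\<dots> \<le> (SUP n. p (z n))" using cauchy_bounded[OF z] by (intro cSUP_upper) auto
    finally show ?thesis .
  qed
  then have "bdd_below ((\<lambda>z. SUP n. p (z n)) ` cl x)" by (intro bdd_belowI2[of _ 0])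
  then have "(INF z\<in>cl x. SUP n. p (z n)) \<le> (SUP n. p (y n))" using assms(1) by (intro cINF_lower)
  also have "\<dots> \<le> B" using assms(2) by (intro cSUP_least) auto
  finally show ?thesis by (simp add: completion_def)
qed

lemma cl_self: "x \<in> cauchy_seqs X \<Longrightarrow> x \<in> cl x"
  by (simp add: mem_cl null_iff p_zero)

text \<open>As \<open>p\<close> need not be continuous, \<open>p v\<close> is compared with an
  arbitrary representative \<open>y\<close> through the quasi-triangle inequality with
  \<open>p (v - y n)\<close> tending to 0; this costs one factor \<open>\<kappa>\<close>.\<close>

lemma le_qnorm_cl_const:
  assumes v: "v \<in> V"
  shows "p v \<le> \<kappa> * qnorm (completion X) (cl (\<lambda>_. v))"
proof -
  have "p v / \<kappa> \<le> (SUP n. p (y n))" if y: "y \<in> cl (\<lambda>_. v)" for y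
  proof -
    have c: "y \<in> cauchy_seqs X" and l: "(\<lambda>n. p (v - y n)) \<longlonglongrightarrow> 0" using y by (auto simp: mem_cl null_iff)
    have "p v \<le> \<kappa> * (p (v - y n) + (SUP n. p (y n)))" for n
    proof -
      have "p ((v - y n) + y n) \<le> \<kappa> * (p (v - y n) + p (y n))"
        using v c[THEN cauchy_V] by (intro p_add V_diff)
      also have "\<dots> \<le> \<kappa> * (p (v - y n) + (SUP n. p (y n)))"
        using \<kappa> cauchy_bounded[OF c] by (intro mult_left_mono add_left_mono cSUP_upper) auto
      finally show ?thesis by simp
    qed
    moreover have "(\<lambda>n. \<kappa> * (p (v - y n) + (SUP n. p (y n)))) \<longlonglongrightarrow> \<kappa> * (0 + (SUP n. p (y n)))"
      by (intro tendsto_intros l)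
    ultimately have "p v \<le> \<kappa> * (SUP n. p (y n))" by (intro LIMSEQ_le_const[where X = "\<lambda>n. \<kappa> * (p (v - y n) + (SUP n. p (y n)))"]) auto
    then show ?thesis using \<kappa> by (simp add: pos_divide_le_eq mult.commute)
  qed
  moreover have "cl (\<lambda>_. v) \<noteq> {}" using cl_self[OF cauchy_const[OF v]] by blast
  ultimately have "p v / \<kappa> \<le> (INF y\<in>cl (\<lambda>_. v). SUP n. p (y n))" by (intro cINF_greatest)
  then show ?thesis using \<kappa> by (simp add: completion_def pos_divide_le_eq mult.commute)
qed

text \<open>Extracts from the isomorphism a linear embedding of the original space with dense range
  in \<open>Z2\<close>, so that later arguments work with vectors instead of classes of Cauchy
  sequences.\<close>

theorem dense_embedding:
  assumes "isomorphic (completion X) Z2"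
  obtains S :: "'v \<Rightarrow> cseq \<times> cseq" and m M :: real where "0 < m" "0 < M"
    "\<And>v. v \<in> V \<Longrightarrow> S v \<in> zspace kalton_peck"
    "\<And>v w. v \<in> V \<Longrightarrow> w \<in> V \<Longrightarrow> S (v + w) = S v + S w"
    "\<And>c v. v \<in> V \<Longrightarrow> S (s c v) = pscale c (S v)"
    "\<And>v. v \<in> V \<Longrightarrow> m * p v \<le> ztnorm kalton_peck (S v)"
    "\<And>v. v \<in> V \<Longrightarrow> ztnorm kalton_peck (S v) \<le> M * p v"
    "\<And>z e. z \<in> zspace kalton_peck \<Longrightarrow> e > 0 \<Longrightarrow> \<exists>v\<in>V. ztnorm kalton_peck (z - S v) \<le> e"
proof -
  have pts: "pts (completion X) = cauchy_seqs X // null_rel X" by (simp add: completion_def)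
  have cl_pts: "cl x \<in> pts (completion X)" if "x \<in> cauchy_seqs X" for x
    unfolding pts cl_def using that by (rule quotientI)
  from assms obtain T m M where T: "bij_betw T (pts (completion X)) (zspace kalton_peck)"
    and add: "\<And>x y. x \<in> pts (completion X) \<Longrightarrow> y \<in> pts (completion X) \<Longrightarrow> T (vadd (completion X) x y) = T x + T y"
    and sc: "\<And>c x. x \<in> pts (completion X) \<Longrightarrow> T (smul (completion X) c x) = pscale c (T x)"
    and mM: "m > 0" "M > 0"
    and lo: "\<And>x. x \<in> pts (completion X) \<Longrightarrow> m * qnorm (completion X) x \<le> ztnorm kalton_peck (T x)"
    and up: "\<And>x. x \<in> pts (completion X) \<Longrightarrow> ztnorm kalton_peck (T x) \<le> M * qnorm (completion X) x"
    unfolding isomorphic_def Z2_def by auto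
  define S where "S v = T (cl (\<lambda>_. v))" for v
  show ?thesis
  proof (rule that[of "m / \<kappa>" M S])
    show "0 < m / \<kappa>" using mM \<kappa> by simp
    show "0 < M" by fact
    fix v assume v: "v \<in> V"
    note cv = cauchy_const[OF v]
    show "S v \<in> zspace kalton_peck" unfolding S_def using bij_betwE[OF T] cl_pts[OF cv] by blast
    show "S (v + w) = S v + S w" if w: "w \<in> V" for w
      unfolding S_def using add[OF cl_pts[OF cv] cl_pts[OF cauchy_const[OF w]]]
        vadd_cl[OF cv cauchy_const[OF w]] by simp
    show "S (s c v) = pscale c (S v)" for c
      unfolding S_def using sc[OF cl_pts[OF cv], of c] smul_cl[OF cv, of c] by simp
    have "m / \<kappa> * p v \<le> m / \<kappa> * (\<kappa> * qnorm (completion X) (cl (\<lambda>_. v)))"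
      using le_qnorm_cl_const[OF v] mM \<kappa> by (intro mult_left_mono) auto
    also have "\<dots> = m * qnorm (completion X) (cl (\<lambda>_. v))" using \<kappa> by simp
    finally show "m / \<kappa> * p v \<le> ztnorm kalton_peck (S v)"
      unfolding S_def using lo[OF cl_pts[OF cv]] by linarith
    have "qnorm (completion X) (cl (\<lambda>_. v)) \<le> p v" using qnorm_cl_le[OF cl_self[OF cv]] by simp
    then have "M * qnorm (completion X) (cl (\<lambda>_. v)) \<le> M * p v" using mM by (intro mult_left_mono) auto
    then show "ztnorm kalton_peck (S v) \<le> M * p v"
      unfolding S_def using up[OF cl_pts[OF cv]] by linarith
  next
    fix z and e :: real assume z: "z \<in> zspace kalton_peck" and e: "e > 0"
    then obtain \<xi> where \<xi>: "\<xi> \<in> pts (completion X)" "z = T \<xi>" using T by (auto simp: bij_betw_def)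
    then obtain x where x: "x \<in> cauchy_seqs X" "\<xi> = cl x" unfolding pts cl_def by (auto elim: quotientE)
    have "e / M > 0" using e mM by simp
    then obtain N where N: "\<And>m n. m \<ge> N \<Longrightarrow> n \<ge> N \<Longrightarrow> p (x m - x n) < e / M"
      using x(1) unfolding cauchy_iff by meson
    have xN: "x N \<in> V" using x(1) by (rule cauchy_V)
    define y where "y = (\<lambda>n. x n + s (-1) (x N))"
    have cs: "(\<lambda>_. s (-1) (x N)) \<in> cauchy_seqs X" using xN V_scale by (intro cauchy_const)
    have y: "y \<in> cauchy_seqs X" unfolding y_def by (rule cauchy_add[OF x(1) cs])
    have Ty: "T (cl y) = z - S (x N)"
    proof -
      have "T (cl y) = T (cl x) + T (cl (\<lambda>_. s (-1) (x N)))"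
        unfolding y_def vadd_cl[OF x(1) cs, symmetric] by (rule add[OF cl_pts cl_pts]) (use x(1) cs in auto)
      also have "T (cl (\<lambda>_. s (-1) (x N))) = pscale (-1) (S (x N))"
        unfolding S_def using sc[OF cl_pts[OF cauchy_const[OF xN]], of "-1"] smul_cl[OF cauchy_const[OF xN], of "-1"] by simp
      also have "\<dots> = - S (x N)" by (simp add: prod_eq_iff)
      finally show ?thesis using \<xi> x by simp
    qed
    \<comment> \<open>\<open>cl y\<close> is the class of \<open>x\<close> minus the constant
      \<open>x N\<close>. Early terms of \<open>y\<close> may be large, but the shift by
      \<open>N\<close> is an equivalent representative that is bounded by \<open>e / M\<close>
      throughout.\<close>
    define y' where "y' = (\<lambda>n. y (n + N))"
    have y': "y' \<in> cauchy_seqs X"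
      using y unfolding cauchy_iff y'_def by (meson trans_le_add1)
    have "y' \<in> cl y" unfolding mem_cl null_iff
    proof (intro conjI y y' LIMSEQ_I)
      fix r :: real assume "r > 0"
      then obtain K where K: "\<And>m n. m \<ge> K \<Longrightarrow> n \<ge> K \<Longrightarrow> p (y m - y n) < r" using y unfolding cauchy_iff by meson
      have "norm (p (y n - y' n) - 0) < r" if "n \<ge> K" for n
      proof -
        have "0 \<le> p (y n - y' n)" using y[THEN cauchy_V] y'[THEN cauchy_V] by (intro p_nonneg V_diff)
        then show ?thesis using K[of n "n + N"] that by (simp add: y'_def)
      qed
      then show "\<exists>no. \<forall>n\<ge>no. norm (p (y n - y' n) - 0) < r" by blast
    qed
    moreover have "p (y' n) \<le> e / M" for n
      using N[of "n + N" N] by (simp add: y'_def y_def s_minus)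
    ultimately have "qnorm (completion X) (cl y) \<le> e / M" by (rule qnorm_cl_le)
    then have "M * qnorm (completion X) (cl y) \<le> e" using mM by (simp add: field_simps)
    then have "ztnorm kalton_peck (z - S (x N)) \<le> e" using up[OF cl_pts[OF y]] unfolding Ty by linarith
    then show "\<exists>v\<in>V. ztnorm kalton_peck (z - S v) \<le> e" using xN by blast
  qed
qed

end

section \<open>Deviation from linearity along block sequences\<close>

lemma sum_ind_disj:
  fixes n :: nat
  assumes "\<And>i j. i < n \<Longrightarrow> j < n \<Longrightarrow> i \<noteq> j \<Longrightarrow> A i \<inter> A j = {}"
  shows "(\<Sum>i<n. ind (A i) * h) = ind (\<Union>i<n. A i) * h"
proof
  fix x
  show "(\<Sum>i<n. ind (A i) * h) x = (ind (\<Union>i<n. A i) * h) x"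
  proof (cases "\<exists>l<n. x \<in> A l")
    case False
    then show ?thesis by (auto simp: sum_fun_apply ind_def)
  next
    case True
    then obtain l where l: "l < n" "x \<in> A l" by blast
    then have "x \<notin> A i" if "i < n" "i \<noteq> l" for i using assms[of i l] that by blast
    then have "(\<Sum>i<n. ind (A i) x * h x) = (\<Sum>i\<in>{l}. ind (A i) x * h x)"
      using l by (intro sum.mono_neutral_right) (auto simp: ind_def)
    then show ?thesis using l by (auto simp: sum_fun_apply ind_def)
  qed
qed

lemma supp_diff: "supp (x - y) \<subseteq> supp x \<union> supp y"
  by (auto simp: supp_def)

lemma bessel_ind:
  fixes n :: nat
  assumes A: "\<And>i j. i < n \<Longrightarrow> j < n \<Longrightarrow> i \<noteq> j \<Longrightarrow> A i \<inter> A j = {}" and h: "h \<in> l2"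
  shows "(\<Sum>i<n. (l2norm (ind (A i) * h))\<^sup>2) \<le> (l2norm h)\<^sup>2"
proof -
  have "disj_supp n (\<lambda>i. ind (A i) * h)"
    unfolding disj_supp_def supp_def using A by (auto simp: ind_def)
  then have "(\<Sum>i<n. (l2norm (ind (A i) * h))\<^sup>2) = (l2norm (\<Sum>i<n. ind (A i) * h))\<^sup>2"
    using h by (intro l2norm_disj_sum[symmetric]) auto
  also have "\<dots> \<le> (l2norm h)\<^sup>2"
    by (subst sum_ind_disj) (use A h in \<open>auto intro!: power_mono l2norm_ind l2norm_nonneg l2_ind\<close>)
  finally show ?thesis .
qed

lemma block_index_le:
  assumes "blocks u" "i \<in> supp (u j)"
  shows "j \<le> i"
  using assms(2)
proof (induction j arbitrary: i)
  case (Suc j)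
  obtain x where x: "x \<in> supp (u j)" using assms(1) unfolding blocks_def by blast
  then show ?case using Suc.IH[OF x] blocks_separated[OF assms(1) lessI x Suc.prems] by linarith
qed simp

definition nrm :: "nat \<Rightarrow> cseq \<Rightarrow> real" where "nrm n b = L2_set (\<lambda>j. cmod (b j)) {..<n}"

lemma nrm_nonneg [simp]: "0 \<le> nrm n b" by (simp add: nrm_def)

lemma nrm_sq: "(nrm n b)\<^sup>2 = (\<Sum>j<n. (cmod (b j))\<^sup>2)"
  by (simp add: nrm_def L2_set_def sum_nonneg)

lemma nrm_coord: "j < n \<Longrightarrow> cmod (b j) \<le> nrm n b"
  unfolding nrm_def using member_le_L2_set[of "{..<n}" j "\<lambda>j. cmod (b j)"] by simp

lemma nrm_unimodular: "(\<And>j. j < n \<Longrightarrow> cmod (b j) = 1) \<Longrightarrow> nrm n b = sqrt n"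
  unfolding nrm_def L2_set_def by simp

lemma nrm_mult_le: "(\<And>j. j < n \<Longrightarrow> cmod (c j) \<le> B) \<Longrightarrow> B \<ge> 0 \<Longrightarrow> nrm n (\<lambda>j. c j * b j) \<le> B * nrm n b"
  unfolding nrm_def by (subst L2_set_right_distrib) (auto intro!: L2_set_mono simp: norm_mult mult_right_mono)

definition unit_vec :: "nat \<Rightarrow> cseq" where "unit_vec i = (\<lambda>j. of_bool (j = i))"

text \<open>Passes from scattered indices \<open>r j\<close> to an initial segment with padded
  coefficients. Coefficients at a repeated index add up on both sides.\<close>

lemma sum_unit_vec:
  fixes f :: "nat \<Rightarrow> cseq"
  assumes "\<And>j. j < n \<Longrightarrow> r j < N"
  shows "(\<Sum>i<N. (\<Sum>j<n. c j *\<^sub>c unit_vec (r j)) i *\<^sub>c f i) = (\<Sum>j<n. c j *\<^sub>c f (r j))"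
proof
  fix x
  have "(\<Sum>i<N. (\<Sum>j<n. c j *\<^sub>c unit_vec (r j)) i *\<^sub>c f i) x = (\<Sum>i<N. \<Sum>j<n. c j * of_bool (i = r j) * f i x)"
    by (simp add: sum_fun_apply unit_vec_def sum_distrib_right)
  also have "\<dots> = (\<Sum>j<n. \<Sum>i<N. c j * of_bool (i = r j) * f i x)" by (rule sum.swap)
  also have "\<dots> = (\<Sum>j<n. c j * f (r j) x)"
  proof (intro sum.cong refl)
    fix j assume "j \<in> {..<n}"
    then have "r j < N" using assms by simp
    then show "(\<Sum>i<N. c j * of_bool (i = r j) * f i x) = c j * f (r j) x"
      by (simp add: of_bool_def if_distrib if_distribR sum.delta cong: if_cong)
  qed
  finally show "(\<Sum>i<N. (\<Sum>j<n. c j *\<^sub>c unit_vec (r j)) i *\<^sub>c f i) x = (\<Sum>j<n. c j *\<^sub>c f (r j)) x"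
    by (simp add: sum_fun_apply)
qed

locale centr_blocks = centr \<Omega> C for \<Omega> C +
  fixes u :: "nat \<Rightarrow> cseq"
  assumes nb: "normalized_blocks u"
begin

lemma u_l2 [simp]: "u i \<in> l2" and u_norm [simp]: "l2norm (u i) = 1" and u_blocks: "blocks u"
  using nb by (auto simp: normalized_blocks_def blocks_def)

lemma u_disj: "i \<noteq> j \<Longrightarrow> supp (u i) \<inter> supp (u j) = {}"
  using blocks_separated[OF u_blocks, of i j] blocks_separated[OF u_blocks, of j i]
  by (metis disjoint_iff linorder_neqE_nat order_less_irrefl)

lemma tuple_disj:
  assumes "k \<in> incr_tuples n N" shows "i < n \<Longrightarrow> j < n \<Longrightarrow> i \<noteq> j \<Longrightarrow> supp (u (k i)) \<inter> supp (u (k j)) = {}"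
  and "disj_supp n (\<lambda>j. u (k j))"
proof -
  show *: "supp (u (k i)) \<inter> supp (u (k j)) = {}" if "i < n" "j < n" "i \<noteq> j" for i j
    using u_disj[of "k i" "k j"] incr_tuples_inj[OF assms] that by (auto dest: inj_onD)
  then show "disj_supp n (\<lambda>j. u (k j))" by (simp add: disj_supp_def)
qed

definition comb :: "nat \<Rightarrow> cseq \<Rightarrow> (nat \<Rightarrow> nat) \<Rightarrow> cseq"
  where "comb n b k = (\<Sum>j<n. b j *\<^sub>c u (k j))"

definition dev :: "nat \<Rightarrow> cseq \<Rightarrow> (nat \<Rightarrow> nat) \<Rightarrow> cseq"
  where "dev n b k = \<Omega> (comb n b k) - (\<Sum>j<n. b j *\<^sub>c \<Omega> (u (k j)))"

definition pdev :: "nat \<Rightarrow> cseq \<Rightarrow> (nat \<Rightarrow> nat) \<Rightarrow> cseq"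
  where "pdev n b k = pr (comb n b k) - (\<Sum>j<n. b j *\<^sub>c pr (u (k j)))"

lemma comb_mem [simp]: "comb n b k \<in> l2"
  unfolding comb_def by (intro l2_sum l2_cscale u_l2)

lemma comb_norm:
  assumes "k \<in> incr_tuples n N" shows "l2norm (comb n b k) = nrm n b"
proof -
  have "(l2norm (comb n b k))\<^sup>2 = (\<Sum>j<n. (l2norm (b j *\<^sub>c u (k j)))\<^sup>2)"
    unfolding comb_def by (intro l2norm_disj_sum disj_cscale tuple_disj(2)[OF assms]) auto
  also have "\<dots> = (nrm n b)\<^sup>2" unfolding nrm_sq by (simp add: l2norm_cscale)
  finally show ?thesis by (simp add: power2_eq_iff_nonneg)
qed

lemma dev_mem [simp]: "dev n b k \<in> l2"
  using quasi_sum_mem[of n "\<lambda>j. b j *\<^sub>c u (k j)"] by (simp add: dev_def comb_def hom)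

lemma dev_eq: "dev n b k = pdev n b k + rem (comb n b k) - (\<Sum>j<n. b j *\<^sub>c rem (u (k j)))"
  by (simp add: dev_def pdev_def rem_def cscale_diff sum_subtractf)

lemma pdev_eq: "pdev n b k = dev n b k - rem (comb n b k) + (\<Sum>j<n. b j *\<^sub>c rem (u (k j)))"
  by (simp add: dev_eq)

lemma pdev_mem [simp]: "pdev n b k \<in> l2"
  unfolding pdev_eq by (intro l2_add_mem l2_diff l2_sum l2_cscale rem_mem dev_mem comb_mem u_l2)

text \<open>The last sum is kept as it is: for given coefficients it may exceed the order of
  \<open>nrm n b\<close>, and it is tamed later by choosing signs.\<close>

lemma dev_le:
  assumes "k \<in> incr_tuples n N"
  shows "l2norm (dev n b k) \<le> l2norm (pdev n b k) + C * nrm n b + l2norm (\<Sum>j<n. b j *\<^sub>c rem (u (k j)))"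
  unfolding dev_eq using rem_le[OF comb_mem, of n b k] comb_norm[OF assms, of b]
  by (intro l2norm_diff_le l2norm_add_le l2_add_mem l2_sum l2_cscale rem_mem pdev_mem comb_mem u_l2) auto

text \<open>Multiplication of the coefficients is multiplication by an element of \<open>\<ell>\<^sub>\<infinity>\<close>; this uses that
  \<^term>\<open>pr\<close> respects supports.\<close>

lemma pdev_mult_le:
  assumes k: "k \<in> incr_tuples n N" and c: "\<And>j. j < n \<Longrightarrow> cmod (c j) \<le> B" and B: "0 \<le> B"
  shows "l2norm (pdev n (\<lambda>j. c j * b j) k) \<le> B * l2norm (pdev n b k) + C * B * nrm n b"
proof -
  define a :: cseq where "a = (\<Sum>j<n. c j *\<^sub>c ind (supp (u (k j))))"
  have d: "disj_supp n (\<lambda>j. c j *\<^sub>c ind (supp (u (k j))))"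
    using tuple_disj(1)[OF k] unfolding disj_supp_def supp_def ind_def by auto
  have ax: "a i = c l" if "l < n" "i \<in> supp (u (k l))" for i l
  proof -
    have "i \<notin> supp (u (k j))" if "j < n" "j \<noteq> l" for j
      using tuple_disj(1)[OF k, of j l] that \<open>l < n\<close> \<open>i \<in> supp (u (k l))\<close> by blast
    then have "(\<Sum>j<n. c j * ind (supp (u (k j))) i) = (\<Sum>j\<in>{l}. c j * ind (supp (u (k j))) i)"
      using that by (intro sum.mono_neutral_right) (auto simp: ind_def)
    then show ?thesis using that by (simp add: a_def sum_fun_apply ind_def)
  qed
  have a0: "a i = 0" if "\<And>l. l < n \<Longrightarrow> i \<notin> supp (u (k l))" for i
    using that by (simp add: a_def sum_fun_apply ind_def)
  have aB: "\<forall>i. cmod (a i) \<le> B"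
    using ax a0 c B by (metis norm_zero)
  have am: "a * x = c l *\<^sub>c x" if "l < n" "supp x \<subseteq> supp (u (k l))" for x l
  proof
    fix i show "(a * x) i = (c l *\<^sub>c x) i"
      using ax[of l i] that by (cases "x i = 0") (auto simp: supp_def)
  qed
  have 1: "a * comb n b k = comb n (\<lambda>j. c j * b j) k"
  proof -
    have "a * comb n b k = (\<Sum>j<n. b j *\<^sub>c (a * u (k j)))"
      by (simp add: comb_def fun_eq_iff sum_fun_apply sum_distrib_left algebra_simps)
    also have "\<dots> = (\<Sum>j<n. b j *\<^sub>c (c j *\<^sub>c u (k j)))"
      by (intro sum.cong refl) (simp add: am del: cscale_cscale)
    finally show ?thesis by (simp add: comb_def mult.commute)
  qed
  have 2: "a * (\<Sum>j<n. b j *\<^sub>c pr (u (k j))) = (\<Sum>j<n. (c j * b j) *\<^sub>c pr (u (k j)))"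
  proof -
    have "a * (\<Sum>j<n. b j *\<^sub>c pr (u (k j))) = (\<Sum>j<n. b j *\<^sub>c (a * pr (u (k j))))"
      by (simp add: fun_eq_iff sum_fun_apply sum_distrib_left algebra_simps)
    also have "\<dots> = (\<Sum>j<n. b j *\<^sub>c (c j *\<^sub>c pr (u (k j))))"
      by (intro sum.cong refl) (simp add: am supp_pr del: cscale_cscale)
    finally show ?thesis by (simp add: mult.commute)
  qed
  define E where "E = pr (a * comb n b k) - a * pr (comb n b k)"
  have E: "E \<in> l2" "l2norm E \<le> C * B * nrm n b"
    unfolding E_def using pr_mult[OF comb_mem aB, of n b k] comb_norm[OF k] by auto
  have e: "pdev n (\<lambda>j. c j * b j) k = a * pdev n b k + E"
    unfolding pdev_def E_def 1 2[symmetric] by (simp add: fun_eq_iff algebra_simps)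
  show ?thesis unfolding e
    using E aB l2_mult[OF pdev_mem, of a B n b k] by (intro l2norm_add_le) auto
qed

text \<open>Remainders may live on other blocks of the tuple. The threshold leaves at most
  \<open>1 / (n + 1)\<close> of each remainder on the union of the blocks, and at most
  \<open>nrm n b\<close> of their combination.\<close>

definition good :: "nat \<Rightarrow> (nat \<Rightarrow> nat) \<Rightarrow> bool" where
  "good n k \<longleftrightarrow> (\<forall>i<n. \<forall>j<n. l2norm (ind (supp (u (k i))) * rem (u (k j))) \<le> 1 / (real n + 1)\<^sup>2)"

text \<open>If Ramsey's theorem does not give an infinite set of good indices, then arbitrarily many blocks
  carry a fixed part of a single vector of norm at most \<open>C\<close>.\<close>

lemma good_exists: "\<exists>k\<in>incr_tuples n {\<nu><..}. good n k"
proof -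
  define \<delta> where "\<delta> = 1 / (real n + 1)\<^sup>2"
  have \<delta>: "\<delta> > 0" by (simp add: \<delta>_def add_nonneg_pos)
  define G where "G x y \<longleftrightarrow> l2norm (ind (supp (u x)) * rem (u y)) \<le> \<delta>" for x y
  have Gxx: "G x x" for x using \<delta> by (simp add: G_def ind_supp_rem)
  \<comment> \<open>Ramsey's theorem colours unordered pairs, so colour 0 asks for smallness in both
    directions; \<open>Gxx\<close> settles the diagonal.\<close>
  define f :: "nat set \<Rightarrow> nat" where "f Y = (if \<forall>x\<in>Y. \<forall>y\<in>Y. G x y then 0 else 1)" for Y
  have "\<exists>Y t. Y \<subseteq> {\<nu><..} \<and> infinite Y \<and> t < 2 \<and> (\<forall>x\<in>Y. \<forall>y\<in>Y. x \<noteq> y \<longrightarrow> f {x, y} = t)"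
    by (rule Ramsey2) (auto simp: f_def infinite_Ioi)
  then obtain Y t where Y: "Y \<subseteq> {\<nu><..}" "infinite Y" and t: "t < 2"
    and ft: "\<And>x y. x \<in> Y \<Longrightarrow> y \<in> Y \<Longrightarrow> x \<noteq> y \<Longrightarrow> f {x, y} = t" by blast
  define k where "k = enumerate Y"
  have k: "strict_mono k" "\<And>i. k i \<in> Y"
    unfolding k_def using Y(2) by (auto intro: strict_mono_enumerate enumerate_in_set)
  have kt: "k \<in> incr_tuples m {\<nu><..}" for m
    using k Y(1) strict_monoD[OF k(1)] unfolding incr_tuples_def by (auto simp: strict_mono_on_def)
  show ?thesis
  proof (cases "t = 0")
    case True
    have "G (k i) (k j)" for i j
    proof (cases "k i = k j")
      case False
      then have "f {k i, k j} = 0" using ft k True by auto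
      then show ?thesis unfolding f_def by (auto split: if_splits)
    qed (simp add: Gxx)
    then have "good n k" by (simp add: good_def G_def \<delta>_def)
    then show ?thesis using kt by blast
  next
    case False
    then have bad: "\<not> (G x y \<and> G y x)" if "x \<in> Y" "y \<in> Y" "x \<noteq> y" for x y
      using ft[OF that] Gxx by (auto simp: f_def split: if_splits)
    obtain m :: nat where m: "C\<^sup>2 / \<delta>\<^sup>2 < m" using reals_Archimedean2 by blast
    have "\<forall>i. \<exists>N. \<forall>A. A \<subseteq> {N..} \<longrightarrow> l2norm (ind A * rem (u (k i))) \<le> \<delta>"
      using l2norm_tail \<delta> by simp
    then obtain N where N: "\<And>i A. A \<subseteq> {N i..} \<Longrightarrow> l2norm (ind A * rem (u (k i))) \<le> \<delta>" by metis
    \<comment> \<open>Beyond \<open>L\<close>, a block lies in the tails of the first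
      \<open>m\<close> remainders, so \<open>G y (k i)\<close> holds; colour 1 then forces
      \<open>G (k i) y\<close> to fail for all \<open>i < m\<close>, which contradicts Bessel's
      inequality for \<open>rem (u y)\<close> by the choice of \<open>m\<close>.\<close>
    define L where "L = (\<Sum>i<m. N i + k i)"
    have L: "N i \<le> L" "k i \<le> L" if "i < m" for i
      using member_le_sum[of i "{..<m}" "\<lambda>i. N i + k i"] that by (auto simp: L_def)
    obtain y where y: "y \<in> Y" "y > L" using Y(2) by (meson infinite_nat_iff_unbounded)
    have "\<delta> < l2norm (ind (supp (u (k i))) * rem (u y))" if i: "i < m" for i
    proof -
      have "supp (u y) \<subseteq> {N i..}"
        using block_index_le[OF u_blocks, of _ y] L(1)[OF i] y(2) by fastforce
      then have "G y (k i)" using N by (simp add: G_def)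
      then show ?thesis using bad[OF k(2)[of i] y(1)] L(2)[OF i] y(2) by (auto simp: G_def)
    qed
    then have "(\<Sum>i<m. \<delta>\<^sup>2) \<le> (\<Sum>i<m. (l2norm (ind (supp (u (k i))) * rem (u y)))\<^sup>2)"
      using \<delta> by (intro sum_mono power_mono) (auto intro: less_imp_le)
    also have "\<dots> \<le> (l2norm (rem (u y)))\<^sup>2"
      using tuple_disj(1)[OF kt[of m]] by (intro bessel_ind) auto
    also have "\<dots> \<le> C\<^sup>2" using rem_le[of "u y"] by (intro power_mono) auto
    finally have "m * \<delta>\<^sup>2 \<le> C\<^sup>2" by simp
    then show ?thesis using m \<delta> by (simp add: field_simps)
  qed
qed

text \<open>\<open>pdev\<close> lives on the union \<open>A\<close> of the blocks, so everything may
  be restricted to \<open>A\<close>. There goodness leaves at most \<open>nrm n b\<close> of the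
  single remainders, and the remainder of the combination costs \<open>C * nrm n b\<close>.\<close>

lemma pdev_le:
  assumes k: "k \<in> incr_tuples n N" and g: "good n k"
  shows "l2norm (pdev n b k) \<le> l2norm (dev n b k) + (C + 1) * nrm n b"
proof -
  define A where "A = (\<Union>i<n. supp (u (k i)))"
  define H where "H = (\<Sum>j<n. b j *\<^sub>c (ind A * rem (u (k j))))"
  have "supp (comb n b k) \<subseteq> A"
    unfolding comb_def A_def using supp_sum[of "\<lambda>j. b j *\<^sub>c u (k j)" "{..<n}"] supp_cscale by fastforce
  then have s1: "supp (pr (comb n b k)) \<subseteq> A" using supp_pr by blast
  have "supp (\<Sum>j<n. b j *\<^sub>c pr (u (k j))) \<subseteq> A"
    unfolding A_def using supp_sum[of "\<lambda>j. b j *\<^sub>c pr (u (k j))" "{..<n}"] supp_cscale supp_pr by fastforce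
  with s1 have "supp (pdev n b k) \<subseteq> A"
    unfolding pdev_def using supp_diff by blast
  then have "pdev n b k i = 0" if "i \<notin> A" for i using that unfolding supp_def by blast
  then have "ind A * pdev n b k = pdev n b k"
    by (auto simp: fun_eq_iff ind_def)
  moreover have "ind A * pdev n b k = ind A * dev n b k - ind A * rem (comb n b k) + H"
    unfolding pdev_eq H_def by (simp add: fun_eq_iff sum_fun_apply sum_distrib_left algebra_simps)
  ultimately have e: "pdev n b k = ind A * dev n b k - ind A * rem (comb n b k) + H" by simp
  have Aj: "l2norm (ind A * rem (u (k j))) \<le> 1 / (real n + 1)" if j: "j < n" for j
  proof -
    have "ind A * rem (u (k j)) = (\<Sum>i<n. ind (supp (u (k i))) * rem (u (k j)))"
      unfolding A_def using tuple_disj(1)[OF k] by (intro sum_ind_disj[symmetric]) auto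
    then have "l2norm (ind A * rem (u (k j))) \<le> (\<Sum>i<n. l2norm (ind (supp (u (k i))) * rem (u (k j))))"
      by (simp add: l2norm_sum)
    also have "\<dots> \<le> (\<Sum>i<n. 1 / (real n + 1)\<^sup>2)"
      using g j by (intro sum_mono) (auto simp: good_def)
    also have "\<dots> \<le> (real n + 1) * (1 / (real n + 1)\<^sup>2)" by (simp add: divide_right_mono)
    also have "\<dots> = 1 / (real n + 1)" by (simp add: power2_eq_square)
    finally show ?thesis .
  qed
  have H: "H \<in> l2" unfolding H_def by (intro l2_sum l2_cscale l2_ind rem_mem u_l2)
  have "l2norm H \<le> (\<Sum>j<n. l2norm (b j *\<^sub>c (ind A * rem (u (k j)))))"
    unfolding H_def by (intro l2norm_sum l2_cscale l2_ind rem_mem u_l2)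
  also have "\<dots> = (\<Sum>j<n. cmod (b j) * l2norm (ind A * rem (u (k j))))"
    by (simp add: l2norm_cscale)
  also have "\<dots> \<le> (\<Sum>j<n. nrm n b * (1 / (real n + 1)))"
    using Aj nrm_coord by (intro sum_mono mult_mono) auto
  also have "\<dots> = nrm n b * (n / (real n + 1))" by simp
  also have "\<dots> \<le> nrm n b * 1" by (intro mult_left_mono) auto
  finally have Hn: "l2norm H \<le> nrm n b" by simp
  have R: "l2norm (ind A * rem (comb n b k)) \<le> C * nrm n b"
    using l2norm_ind[of "rem (comb n b k)" A] rem_le[of "comb n b k"] comb_norm[OF k, of b] by simp
  have "l2norm (pdev n b k) \<le> l2norm (dev n b k) + C * nrm n b + nrm n b"
    unfolding e using H Hn R
    by (intro l2norm_add_le l2norm_diff_le l2_diff l2_ind l2norm_ind rem_mem comb_mem dev_mem)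
  then show ?thesis by (simp add: algebra_simps)
qed

text \<open>The linear map from coefficients to the twisted space whose quasi-norm is
  \<open>tsm_expr\<close>. Being linear in \<open>v\<close>, it transfers the quasi-norm
  inequalities of the twisted space to the model.\<close>

definition lift :: "nat \<Rightarrow> cseq \<times> cseq \<Rightarrow> (nat \<Rightarrow> nat) \<Rightarrow> cseq \<times> cseq" where
  "lift n v k = ((\<Sum>j<n. fst v j *\<^sub>c u (k j)) + (\<Sum>j<n. snd v j *\<^sub>c \<Omega> (u (k j))), comb n (snd v) k)"

lemma tsm_expr_lift: "tsm_expr \<Omega> u n a b k = ztnorm \<Omega> (lift n (a, b) k)"
  by (simp add: tsm_expr_def lift_def ztnorm_def comb_def)

lemma lift_mem [simp]: "lift n v k \<in> zspace \<Omega>"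
proof -
  have "fst (lift n v k) - \<Omega> (snd (lift n v k)) = (\<Sum>j<n. fst v j *\<^sub>c u (k j)) - dev n (snd v) k"
    by (simp add: lift_def dev_def)
  moreover have "(\<Sum>j<n. fst v j *\<^sub>c u (k j)) - dev n (snd v) k \<in> l2"
    by (intro l2_diff l2_sum l2_cscale u_l2 dev_mem)
  ultimately show ?thesis by (simp add: zspace_def) (simp add: lift_def)
qed

lemma lift_add: "lift n (v + w) k = lift n v k + lift n w k"
  by (simp add: lift_def comb_def cscale_add_left sum.distrib)

lemma lift_scale: "lift n (pscale c v) k = pscale c (lift n v k)"
  by (simp add: prod_eq_iff lift_def comb_def cscale_add cscale_sum)

lemma lift_sum: "lift n (\<Sum>i<(m::nat). pscale (c i) (v i)) k = (\<Sum>i<m. pscale (c i) (lift n (v i) k))"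
proof (induction m)
  case 0
  show ?case by (simp add: lift_def comb_def prod_eq_iff)
next
  case (Suc m)
  then show ?case by (simp add: lift_add lift_scale)
qed

lemma tsm_expr_dev: "tsm_expr \<Omega> u n 0 b k = l2norm (dev n b k) + l2norm (comb n b k)"
proof -
  have "(\<Sum>j<n. 0 *\<^sub>c u (k j)) + (\<Sum>j<n. b j *\<^sub>c \<Omega> (u (k j))) - \<Omega> (\<Sum>j<n. b j *\<^sub>c u (k j)) = - dev n b k"
    by (simp add: dev_def comb_def)
  then show ?thesis by (simp add: tsm_expr_def comb_def)
qed

end

section \<open>Twisted spreading models\<close>

lemma coordinatewise_convergent_subseq:
  fixes x :: "nat \<Rightarrow> cseq"
  assumes b: "\<And>j i. cmod (x j i) \<le> M"
  shows "\<exists>r. strict_mono (r :: nat \<Rightarrow> nat) \<and> (\<forall>i. convergent (\<lambda>j. x (r j) i))"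
proof -
  interpret subseqs "\<lambda>i s. convergent (\<lambda>j. x (s j) i)"
  proof
    fix n and s :: "nat \<Rightarrow> nat" assume "strict_mono s"
    have "bounded (range (\<lambda>j. x (s j) n))" using b by (auto simp: bounded_iff)
    then obtain l r where "strict_mono (r :: nat \<Rightarrow> nat)" "((\<lambda>j. x (s j) n) \<circ> r) \<longlonglongrightarrow> l"
      using bounded_imp_convergent_subsequence by blast
    then show "\<exists>r'. strict_mono r' \<and> convergent (\<lambda>j. x ((s \<circ> r') j) n)"
      by (auto simp: convergent_def comp_def)
  qed
  \<comment> \<open>The diagonal sequence refines stage \<open>i\<close> only from index
    \<open>Suc i\<close> on; the shift is removed afterwards since it does not affect
    convergence.\<close>
  have "convergent (\<lambda>j. x ((diagseq \<circ> ((+) (Suc i))) j) i)" for i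
  proof (rule diagseq_holds)
    fix r s :: "nat \<Rightarrow> nat" and n
    assume "strict_mono r" "convergent (\<lambda>j. x (s j) n)"
    then show "convergent (\<lambda>j. x ((s \<circ> r) j) n)"
      using convergent_subseq_convergent[of "\<lambda>j. x (s j) n" r] by (simp add: comp_def)
  qed
  then have "convergent (\<lambda>j. x (diagseq (j + Suc i)) i)" for i
    unfolding comp_def by (simp only: add.commute[of _ "Suc i"])
  then have "convergent (\<lambda>j. x (diagseq j) i)" for i
    using convergent_ignore_initial_segment[of "\<lambda>j. x (diagseq j) i" "Suc i"] by simp
  then show ?thesis using subseq_diagseq by blast
qed

lemma l2norm_unit_vec [simp]: "l2norm (unit_vec i) = 1" and unit_vec_c00 [simp]: "unit_vec i \<in> c00"
proof -
  have *: "(\<lambda>j. (cmod (unit_vec i j))\<^sup>2) = (\<lambda>j. if j = i then 1 else 0)"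
    by (auto simp: unit_vec_def)
  then have "(\<lambda>j. (cmod (unit_vec i j))\<^sup>2) sums 1" using sums_single[of i "\<lambda>_. 1::real"] by simp
  then show "l2norm (unit_vec i) = 1" unfolding l2norm_def by (simp add: sums_iff)
  have "supp (unit_vec i) = {i}" by (auto simp: supp_def unit_vec_def)
  then show "unit_vec i \<in> c00" by (simp add: c00_def)
qed

lemma l2norm_initial_le:
  assumes "x \<in> l2" shows "l2norm (ind {..<K} * x) \<le> (\<Sum>i<K. cmod (x i))"
proof -
  have "ind {..<K} * x = (\<Sum>i<K. x i *\<^sub>c unit_vec i)"
  proof
    fix j
    show "(ind {..<K} * x) j = (\<Sum>i<K. x i *\<^sub>c unit_vec i) j"
      by (simp add: sum_fun_apply ind_def unit_vec_def of_bool_def if_distrib sum.delta' cong: if_cong)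
  qed
  then have "l2norm (ind {..<K} * x) \<le> (\<Sum>i<K. l2norm (x i *\<^sub>c unit_vec i))"
    by (simp add: l2norm_sum)
  also have "\<dots> = (\<Sum>i<K. cmod (x i))" by (simp add: l2norm_cscale)
  finally show ?thesis .
qed

text \<open>A late vector is small on the coordinates already used, and a late cut makes its tail
  small. Consecutive windows share an endpoint, so the cut vectors form blocks as soon as they are
  nonzero.\<close>

lemma gliding_hump:
  fixes x :: "nat \<Rightarrow> cseq" and \<epsilon> :: "nat \<Rightarrow> real"
  assumes x: "\<And>j. x j \<in> l2" and lim: "\<And>i. (\<lambda>j. x j i) \<longlonglongrightarrow> 0" and \<epsilon>: "\<And>j. \<epsilon> j > 0"
  obtains r N :: "nat \<Rightarrow> nat" where "strict_mono r" "j0 \<le> r 0" "strict_mono N"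
    "\<And>j. l2norm (x (r j) - ind {N j..<N (Suc j)} * x (r j)) \<le> \<epsilon> j"
proof -
  have step: "\<exists>\<rho> K'. R < \<rho> \<and> K < K' \<and> l2norm (x \<rho> - ind {K..<K'} * x \<rho>) \<le> e" if "e > 0" for R K :: nat and e :: real
  proof -
    have "(\<lambda>j. \<Sum>i<K. cmod (x j i)) \<longlonglongrightarrow> (\<Sum>i<K. 0)"
      by (intro tendsto_sum tendsto_norm_zero lim)
    then have "eventually (\<lambda>j. (\<Sum>i<K. cmod (x j i)) < e / 2) sequentially"
      by (rule order_tendstoD) (use that in simp)
    then obtain \<rho> where \<rho>: "\<rho> > R" "(\<Sum>i<K. cmod (x \<rho> i)) < e / 2"
      unfolding eventually_sequentially by (meson le_less_trans lessI max.cobounded1 max.cobounded2 not_le)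
    have "e / 2 > 0" using that by simp
    then obtain T where T: "\<And>A. A \<subseteq> {T..} \<Longrightarrow> l2norm (ind A * x \<rho>) \<le> e / 2"
      using l2norm_tail[OF x, of "e / 2" \<rho>] by blast
    define K' where "K' = max (Suc K) T"
    have e: "x \<rho> - ind {K..<K'} * x \<rho> = ind {..<K} * x \<rho> + ind {K'..} * x \<rho>"
      by (auto simp: fun_eq_iff ind_def K'_def)
    have "l2norm (ind {..<K} * x \<rho>) \<le> e / 2" using l2norm_initial_le[OF x, of K \<rho>] \<rho>(2) by linarith
    moreover have "l2norm (ind {K'..} * x \<rho>) \<le> e / 2" by (rule T) (simp add: K'_def)
    ultimately have "l2norm (x \<rho> - ind {K..<K'} * x \<rho>) \<le> e / 2 + e / 2"
      unfolding e using x by (intro l2norm_add_le l2_ind)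
    then show ?thesis using \<rho>(1) by (intro exI[of _ \<rho>] exI[of _ K']) (auto simp: K'_def)
  qed
  \<comment> \<open>The state \<open>(\<rho>, K, K')\<close> consists of an index and its window;
    \<open>Q\<close> makes the next window start where the present one ends.\<close>
  define P where "P j t \<longleftrightarrow> (case t of (\<rho>, K, K') \<Rightarrow> j0 \<le> \<rho> \<and> K < K' \<and> l2norm (x \<rho> - ind {K..<K'} * x \<rho>) \<le> \<epsilon> j)"
    for j and t :: "nat \<times> nat \<times> nat"
  define Q where "Q t t' \<longleftrightarrow> fst t < fst t' \<and> fst (snd t') = snd (snd t)" for t t' :: "nat \<times> nat \<times> nat"
  have "\<exists>f. \<forall>n. P n (f n) \<and> Q (f n) (f (Suc n))"
  proof (rule dependent_nat_choice)
    show "\<exists>t. P 0 t" using step[OF \<epsilon>[of 0], of j0 0] unfolding P_def by (auto intro: less_imp_le)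
    fix t n assume "P n t"
    then have "j0 \<le> fst t" by (simp add: P_def case_prod_beta)
    moreover obtain \<rho> K' where "fst t < \<rho>" "snd (snd t) < K'"
      "l2norm (x \<rho> - ind {snd (snd t)..<K'} * x \<rho>) \<le> \<epsilon> (Suc n)"
      using step[OF \<epsilon>[of "Suc n"]] by blast
    ultimately have "P (Suc n) (\<rho>, snd (snd t), K') \<and> Q t (\<rho>, snd (snd t), K')"
      by (simp add: P_def Q_def)
    then show "\<exists>t'. P (Suc n) t' \<and> Q t t'" by blast
  qed
  then obtain f where f: "\<And>n. P n (f n)" "\<And>n. Q (f n) (f (Suc n))" by blast
  define r where "r n = fst (f n)" for n
  define N where "N n = fst (snd (f n))" for n
  have N: "N (Suc n) = snd (snd (f n))" for n using f(2)[of n] by (simp add: N_def Q_def)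
  show ?thesis
  proof (rule that[of r N])
    show "strict_mono r" unfolding strict_mono_Suc_iff r_def using f(2) by (simp add: Q_def)
    show "strict_mono N" unfolding strict_mono_Suc_iff N using f(1) by (simp add: P_def N_def case_prod_beta)
    show "j0 \<le> r 0" using f(1)[of 0] by (simp add: P_def r_def case_prod_beta)
    show "l2norm (x (r j) - ind {N j..<N (Suc j)} * x (r j)) \<le> \<epsilon> j" for j
      unfolding N using f(1)[of j] by (simp add: P_def r_def N_def case_prod_beta)
  qed
qed

lemma sum_pairs:
  fixes f :: "nat \<Rightarrow> 'a::comm_monoid_add"
  shows "(\<Sum>i<2 * n. f i) = (\<Sum>j<n. f (2 * j) + f (2 * j + 1))"
  by (induction n) (simp_all add: add.assoc)

text \<open>The coefficients of the combination of the differences \<open>e_(2j) - e_(2j+1)\<close>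
  with scalars \<open>c j\<close>.\<close>

definition alt :: "cseq \<Rightarrow> cseq"
  where "alt c = (\<lambda>i. if even i then c (i div 2) else - c (i div 2))"

lemma alt_simps [simp]: "alt c (2 * j) = c j" "alt c (Suc (2 * j)) = - c j"
  by (simp_all add: alt_def)

lemma nrm_alt: "(nrm (2 * n) (alt c))\<^sup>2 = 2 * (nrm n c)\<^sup>2"
  unfolding nrm_sq sum_pairs by (simp add: sum_distrib_left)

lemma nrm_alt_le: "nrm (2 * n) (alt c) \<le> 2 * nrm n c"
proof (rule power2_le_imp_le)
  show "(nrm (2 * n) (alt c))\<^sup>2 \<le> (2 * nrm n c)\<^sup>2" unfolding nrm_alt by (simp add: power_mult_distrib)
qed simp

section \<open>The limit quasi-norm on finitely supported pairs\<close>

locale centr_model = centr_blocks +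
  assumes lim: "tsm_limits_exist \<Omega> u"
begin

definition tsm_norm :: "cseq \<times> cseq \<Rightarrow> real"
  where "tsm_norm = (\<lambda>(a, b). Lim (spread (joint_length a b)) (tsm_expr \<Omega> u (joint_length a b) a b))"

lemma c00_vanish:
  assumes "v \<in> c00 \<times> c00" shows "\<exists>n. \<forall>j\<ge>n. fst v j = 0 \<and> snd v j = 0"
proof -
  have f: "finite (supp (fst v) \<union> supp (snd v))" using assms by (auto simp: c00_def)
  obtain n where n: "\<And>i. i \<in> supp (fst v) \<union> supp (snd v) \<Longrightarrow> i < n"
    using f finite_nat_set_iff_bounded by meson
  have "fst v j = 0 \<and> snd v j = 0" if "j \<ge> n" for j
    using n[of j] that unfolding supp_def by fastforce
  then show ?thesis by blast
qed

text \<open>The quasi-norm is defined with the shortest joint length; zero padding and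
  \<open>spread_antimono\<close> allow any longer one, so that several vectors can share a
  length.\<close>

lemma tsm_norm_tendsto:
  assumes "\<And>j. j \<ge> n \<Longrightarrow> fst v j = 0 \<and> snd v j = 0"
  shows "((\<lambda>k. ztnorm \<Omega> (lift n v k)) \<longlongrightarrow> tsm_norm v) (spread n)"
proof -
  define m where "m = joint_length (fst v) (snd v)"
  have m: "m \<le> n" unfolding m_def joint_length_def using assms by (intro Least_le) auto
  have z: "fst v j = 0 \<and> snd v j = 0" if "j \<ge> m" for j
    using LeastI[of "\<lambda>n. \<forall>j\<ge>n. fst v j = 0 \<and> snd v j = 0" n] assms that
    unfolding m_def joint_length_def by blast
  obtain L where L: "(tsm_expr \<Omega> u m (fst v) (snd v) \<longlongrightarrow> L) (spread m)"
    using lim unfolding tsm_limits_exist_def by blast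
  then have "tsm_norm v = L" unfolding tsm_norm_def m_def by (auto simp: case_prod_beta intro!: tendsto_Lim)
  then have *: "((\<lambda>k. ztnorm \<Omega> (lift m v k)) \<longlongrightarrow> tsm_norm v) (spread n)"
    using tendsto_mono[OF spread_antimono[OF m] L] by (simp add: tsm_expr_lift[abs_def])
  have s: "(\<Sum>j<n. c j *\<^sub>c f j) = (\<Sum>j<m. c j *\<^sub>c f j)" if "\<And>j. j \<ge> m \<Longrightarrow> c j = 0" for c :: cseq and f :: "nat \<Rightarrow> cseq"
    by (rule sum.mono_neutral_right) (use m that in auto)
  have "lift n v k = lift m v k" for k
    unfolding lift_def comb_def by (simp only: s z)
  then show ?thesis using * by simp
qed

lemma tsm_norm_eqI:
  assumes "\<And>j. j \<ge> n \<Longrightarrow> fst v j = 0 \<and> snd v j = 0" "((\<lambda>k. ztnorm \<Omega> (lift n v k)) \<longlongrightarrow> L) (spread n)"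
  shows "tsm_norm v = L"
  using tendsto_unique[OF spread_nontrivial tsm_norm_tendsto[OF assms(1)] assms(2)] .

lemma supp_add: "supp (x + y) \<subseteq> supp x \<union> supp y"
  by (auto simp: supp_def)

lemma c00_add: "x \<in> c00 \<Longrightarrow> y \<in> c00 \<Longrightarrow> x + y \<in> c00"
  using finite_subset[OF supp_add, of x y] by (simp add: c00_def)

lemma c00_cscale: "x \<in> c00 \<Longrightarrow> c *\<^sub>c x \<in> c00"
  unfolding c00_def using finite_subset[OF supp_cscale] by blast

lemma c00_sum: "(\<And>j. j \<in> A \<Longrightarrow> f j \<in> c00) \<Longrightarrow> (\<Sum>j\<in>A. c j *\<^sub>c f j) \<in> c00"
proof (induction A rule: infinite_finite_induct)
  case (insert i A)
  have "(\<Sum>j\<in>A. c j *\<^sub>c f j) \<in> c00" by (rule insert.IH) (use insert.prems in simp)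
  then have "c i *\<^sub>c f i + (\<Sum>j\<in>A. c j *\<^sub>c f j) \<in> c00" using insert.prems by (intro c00_add c00_cscale) auto
  then show "(\<Sum>j\<in>insert i A. c j *\<^sub>c f j) \<in> c00" using insert.hyps by simp
qed (simp_all add: c00_def supp_def)

text \<open>Every axiom is the limit of the same inequality for \<open>lift\<close> at a common
  length; the constant \<open>1 + 4 * C\<close> is that of the twisted space.\<close>

sublocale qn: qn_vector_space "c00 \<times> c00" pscale tsm_norm "1 + 4 * C"
proof
  show "0 < 1 + 4 * C" using C_nonneg by linarith
  fix v :: "cseq \<times> cseq" assume v: "v \<in> c00 \<times> c00"
  obtain n where n: "\<And>j. j \<ge> n \<Longrightarrow> fst v j = 0 \<and> snd v j = 0" using c00_vanish[OF v] by blast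
  show "0 \<le> tsm_norm v"
    by (rule tendsto_lowerbound[OF tsm_norm_tendsto[OF n]]) auto
  show "tsm_norm (pscale c v) = cmod c * tsm_norm v" for c
  proof (rule tsm_norm_eqI[where n = n])
    have "((\<lambda>k. cmod c * ztnorm \<Omega> (lift n v k)) \<longlongrightarrow> cmod c * tsm_norm v) (spread n)"
      by (intro tendsto_intros tsm_norm_tendsto n)
    then show "((\<lambda>k. ztnorm \<Omega> (lift n (pscale c v) k)) \<longlongrightarrow> cmod c * tsm_norm v) (spread n)"
      by (simp add: lift_scale ztnorm_pscale)
  qed (use n in auto)
  show "pscale c v \<in> c00 \<times> c00" for c using v by (auto simp: mem_Times_iff c00_cscale)
  fix w :: "cseq \<times> cseq" assume w: "w \<in> c00 \<times> c00"
  show "v + w \<in> c00 \<times> c00" using v w by (auto simp: mem_Times_iff c00_add)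
  obtain n' where n': "\<And>j. j \<ge> n' \<Longrightarrow> fst w j = 0 \<and> snd w j = 0" using c00_vanish[OF w] by blast
  define m where "m = max n n'"
  show "tsm_norm (v + w) \<le> (1 + 4 * C) * (tsm_norm v + tsm_norm w)"
  proof (rule tendsto_le[OF spread_nontrivial[of m]])
    show "((\<lambda>k. (1 + 4 * C) * (ztnorm \<Omega> (lift m v k) + ztnorm \<Omega> (lift m w k))) \<longlongrightarrow> (1 + 4 * C) * (tsm_norm v + tsm_norm w)) (spread m)"
      by (intro tendsto_intros tsm_norm_tendsto) (use n n' in \<open>auto simp: m_def\<close>)
    show "((\<lambda>k. ztnorm \<Omega> (lift m (v + w) k)) \<longlongrightarrow> tsm_norm (v + w)) (spread m)"
      by (intro tsm_norm_tendsto) (use n n' in \<open>auto simp: m_def\<close>)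
    show "\<forall>\<^sub>F k in spread m. ztnorm \<Omega> (lift m (v + w) k) \<le> (1 + 4 * C) * (ztnorm \<Omega> (lift m v k) + ztnorm \<Omega> (lift m w k))"
      unfolding lift_add by (intro always_eventually allI ztnorm_add lift_mem)
  qed
next
  show "pscale c (v + w) = pscale c v + pscale c w" for c and v w :: "cseq \<times> cseq"
    by (simp add: prod_eq_iff cscale_add)
  show "pscale (-1) v = - v" for v by (simp add: prod_eq_iff)
  show "tsm_norm 0 = 0"
    by (rule tsm_norm_eqI[of 0]) (auto simp: lift_def comb_def ztnorm_def)
qed

lemma model_eq: "twisted_spreading_model \<Omega> u = completion qn.X"
  unfolding twisted_spreading_model_def tsm_norm_def ..

definition xvec :: "nat \<Rightarrow> cseq \<Rightarrow> (nat \<Rightarrow> nat) \<Rightarrow> cseq \<times> cseq"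
  where "xvec n c r = (0, \<Sum>j<n. c j *\<^sub>c unit_vec (r j))"

lemma xvec_mem [simp]: "xvec n c r \<in> c00 \<times> c00"
  unfolding xvec_def by (simp add: c00_sum) (simp add: c00_def supp_def)

text \<open>The limit does not involve \<open>r\<close>: a far tuple of length \<open>N\<close>
  composed with \<open>r\<close> is a far tuple of length \<open>n\<close>. Basis vectors may
  therefore be picked at will inside \<open>Z2\<close> while the norm is still computed along all
  far tuples.\<close>

lemma tsm_norm_xvec:
  assumes r: "strict_mono_on {..<n} r"
  shows "((\<lambda>k. l2norm (dev n c k) + l2norm (comb n c k)) \<longlongrightarrow> tsm_norm (xvec n c r)) (spread n)"
proof -
  define N where "N = (\<Sum>j<n. Suc (r j))"
  have rN: "r j < N" if "j < n" for j
    using member_le_sum[of j "{..<n}" "\<lambda>j. Suc (r j)"] that by (simp add: N_def)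
  obtain L where L: "(tsm_expr \<Omega> u n 0 c \<longlongrightarrow> L) (spread n)"
    using lim unfolding tsm_limits_exist_def by blast
  have "((\<lambda>k. tsm_expr \<Omega> u n 0 c (k \<circ> r)) \<longlongrightarrow> L) (spread N)"
    by (rule filterlim_compose[OF L filterlim_spread_comp]) (use r rN in auto)
  moreover have "tsm_expr \<Omega> u n 0 c (k \<circ> r) = ztnorm \<Omega> (lift N (xvec n c r) k)" for k
  proof -
    have "lift n (0, c) (k \<circ> r) = lift N (xvec n c r) k"
      using sum_unit_vec[of n r N c "\<lambda>i. u (k i)"] sum_unit_vec[of n r N c "\<lambda>i. \<Omega> (u (k i))"] rN
      by (simp add: lift_def comb_def xvec_def)
    then show ?thesis by (simp add: tsm_expr_lift)
  qed
  moreover have "(\<Sum>j<n. c j *\<^sub>c unit_vec (r j)) i = 0" if "i \<ge> N" for i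
    unfolding sum_fun_apply by (rule sum.neutral) (use rN that in \<open>force simp: unit_vec_def\<close>)
  ultimately have "tsm_norm (xvec n c r) = L"
    by (intro tsm_norm_eqI[of N]) (simp_all add: xvec_def)
  then show ?thesis using L by (simp add: tsm_expr_dev[abs_def])
qed

end

section \<open>Spreading models isomorphic to the Kalton-Peck space\<close>

lemma pair_sequence:
  fixes a b :: "nat \<Rightarrow> nat"
  assumes "\<And>j. a j < b j" "\<And>j. b j < a (Suc j)"
  obtains \<alpha> where "strict_mono \<alpha>" "\<And>j. \<alpha> (2 * j) = a j" "\<And>j. \<alpha> (Suc (2 * j)) = b j"
proof (rule that[of "\<lambda>i. if even i then a (i div 2) else b (i div 2)"])
  show "strict_mono (\<lambda>i. if even i then a (i div 2) else b (i div 2))"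
    unfolding strict_mono_Suc_iff
  proof
    fix i show "(if even i then a (i div 2) else b (i div 2)) < (if even (Suc i) then a (Suc i div 2) else b (Suc i div 2))"
      by (cases "even i") (use assms in \<open>auto elim!: evenE oddE\<close>)
  qed
qed auto

lemma sum_half_le: "(\<Sum>j<n. (1 / 2) ^ j) \<le> (2 :: real)"
proof -
  have "(\<Sum>j<n. (1 / 2 :: real) ^ j) \<le> (\<Sum>j. (1 / 2) ^ j)"
    by (intro sum_le_suminf summable_geometric) auto
  then show ?thesis by (simp add: suminf_geometric)
qed

lemma strict_mono_imp_strict_mono_on: "strict_mono r \<Longrightarrow> strict_mono_on A r"
  by (simp add: strict_mono_def strict_mono_on_def)

lemma (in centr) ztnorm_minus_le:
  assumes "v \<in> zspace \<Omega>" "w \<in> zspace \<Omega>"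
  shows "v - w \<in> zspace \<Omega>" and "ztnorm \<Omega> (v - w) \<le> (1 + 4 * C) * (ztnorm \<Omega> v + ztnorm \<Omega> w)"
proof -
  have e: "v - w = v + pscale (-1) w" by (simp add: prod_eq_iff)
  show "v - w \<in> zspace \<Omega>" unfolding e by (intro ztnorm_add ztnorm_pscale assms)
  show "ztnorm \<Omega> (v - w) \<le> (1 + 4 * C) * (ztnorm \<Omega> v + ztnorm \<Omega> w)"
    unfolding e using ztnorm_add(2)[OF assms(1) ztnorm_pscale(1)[OF assms(2), of "-1"]] ztnorm_pscale(2)[OF assms(2), of "-1"] by simp
qed

lemma c00_zero [simp]: "0 \<in> c00"
  by (simp add: c00_def supp_def)

locale model_embedding = centr_model +
  fixes S :: "cseq \<times> cseq \<Rightarrow> cseq \<times> cseq" and m M :: real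
  assumes m_pos: "0 < m" and M_pos: "0 < M"
    and S_mem: "v \<in> c00 \<times> c00 \<Longrightarrow> S v \<in> zspace kalton_peck"
    and S_add: "v \<in> c00 \<times> c00 \<Longrightarrow> w \<in> c00 \<times> c00 \<Longrightarrow> S (v + w) = S v + S w"
    and S_scale: "v \<in> c00 \<times> c00 \<Longrightarrow> S (pscale c v) = pscale c (S v)"
    and S_lower: "v \<in> c00 \<times> c00 \<Longrightarrow> m * tsm_norm v \<le> ztnorm kalton_peck (S v)"
    and S_upper: "v \<in> c00 \<times> c00 \<Longrightarrow> ztnorm kalton_peck (S v) \<le> M * tsm_norm v"
    and S_dense: "z \<in> zspace kalton_peck \<Longrightarrow> 0 < e \<Longrightarrow> \<exists>v\<in>c00 \<times> c00. ztnorm kalton_peck (z - S v) \<le> e"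
begin

lemma V_zero [simp]: "0 \<in> c00 \<times> c00"
  by (simp add: zero_prod_def)

lemma V_sum: "(\<And>j. j < n \<Longrightarrow> v j \<in> c00 \<times> c00) \<Longrightarrow> (\<Sum>j<(n::nat). pscale (c j) (v j)) \<in> c00 \<times> c00"
proof (induction n)
  case (Suc n)
  then have "(\<Sum>j<n. pscale (c j) (v j)) + pscale (c n) (v n) \<in> c00 \<times> c00" by (intro qn.V_add qn.V_scale) auto
  then show ?case by simp
qed (simp only: lessThan_0 sum.empty V_zero)

lemma S_zero: "S 0 = 0"
proof -
  have "pscale 0 (0 :: cseq \<times> cseq) = 0" "pscale 0 (S 0) = 0" by (simp_all add: prod_eq_iff)
  then show ?thesis using S_scale[OF V_zero, of 0] by simp
qed

lemma S_sum: "(\<And>j. j < n \<Longrightarrow> v j \<in> c00 \<times> c00) \<Longrightarrow> S (\<Sum>j<(n::nat). pscale (c j) (v j)) = (\<Sum>j<n. pscale (c j) (S (v j)))"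
proof (induction n)
  case (Suc n)
  have "S ((\<Sum>j<n. pscale (c j) (v j)) + pscale (c n) (v n)) = S (\<Sum>j<n. pscale (c j) (v j)) + pscale (c n) (S (v n))"
    using Suc.prems by (subst S_add) (auto intro: V_sum qn.V_scale S_scale)
  then show ?case using Suc.IH Suc.prems by simp
qed (simp add: S_zero)

definition zvec :: "nat \<Rightarrow> cseq \<times> cseq" where "zvec i = S (0, unit_vec i)"

definition yvec :: "nat \<Rightarrow> cseq" where "yvec i = snd (zvec i)"

lemma unit_mem [simp]: "(0, unit_vec i) \<in> c00 \<times> c00"
  by simp

lemma zvec_mem [simp]: "zvec i \<in> zspace kalton_peck"
  unfolding zvec_def by (rule S_mem) simp

lemma yvec_mem [simp]: "yvec i \<in> l2"
  using zvec_mem[of i] by (simp add: yvec_def zspace_def)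

lemma S_xvec: "S (xvec n c r) = (\<Sum>j<n. pscale (c j) (zvec (r j)))"
proof -
  have "xvec n c r = (\<Sum>j<n. pscale (c j) (0, unit_vec (r j)))"
    by (simp add: xvec_def prod_eq_iff fst_sum snd_sum)
  then show ?thesis unfolding zvec_def by (simp only: S_sum unit_mem)
qed

lemma tsm_norm_unit: "tsm_norm (0, unit_vec i) = 1"
proof -
  have x: "xvec 1 (\<lambda>_. 1) (\<lambda>_. i) = (0, unit_vec i)" by (simp add: xvec_def)
  have "strict_mono_on {..<1} (\<lambda>_::nat. i)" by (auto simp: strict_mono_on_def)
  from tsm_norm_xvec[OF this, of "\<lambda>_. 1"] have "((\<lambda>k. 1) \<longlongrightarrow> tsm_norm (0, unit_vec i)) (spread 1)"
    unfolding x by (simp add: dev_def comb_def)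
  then show ?thesis using tendsto_unique[OF spread_nontrivial _ tendsto_const] by blast
qed

lemma zvec_norm: "ztnorm kalton_peck (zvec i) \<le> M"
  using S_upper[OF unit_mem, of i] by (simp add: zvec_def tsm_norm_unit)

lemma yvec_norm: "l2norm (yvec i) \<le> M"
proof -
  have "0 \<le> l2norm (fst (zvec i) - kalton_peck (snd (zvec i)))"
    using zvec_mem[of i] by (intro l2norm_nonneg) (simp add: zspace_def)
  then show ?thesis using zvec_norm[of i] by (simp add: ztnorm_def yvec_def)
qed

definition dvec :: "(nat \<Rightarrow> nat) \<Rightarrow> nat \<Rightarrow> cseq \<times> cseq"
  where "dvec \<alpha> j = zvec (\<alpha> (2 * j)) - zvec (\<alpha> (Suc (2 * j)))"

lemma dvec_mem [simp]: "dvec \<alpha> j \<in> zspace kalton_peck"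
  unfolding dvec_def by (rule kp.ztnorm_minus_le) auto

lemma dvec_norm: "ztnorm kalton_peck (dvec \<alpha> j) \<le> 18 * M"
proof -
  \<comment> \<open>Here 9 = 1 + 4 * 2 is the quasi-triangle constant for
    \<open>kalton_peck\<close>, whose centralizer constant is 2.\<close>
  have "ztnorm kalton_peck (dvec \<alpha> j) \<le> 9 * (ztnorm kalton_peck (zvec (\<alpha> (2 * j))) + ztnorm kalton_peck (zvec (\<alpha> (Suc (2 * j)))))"
    unfolding dvec_def using kp.ztnorm_minus_le(2)[OF zvec_mem zvec_mem] by simp
  also have "\<dots> \<le> 9 * (M + M)" by (intro mult_left_mono add_mono zvec_norm) simp
  finally show ?thesis by simp
qed

lemma snd_dvec: "snd (dvec \<alpha> j) = yvec (\<alpha> (2 * j)) - yvec (\<alpha> (Suc (2 * j)))"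
  by (simp add: dvec_def yvec_def)

lemma snd_dvec_mem [simp]: "snd (dvec \<alpha> j) \<in> l2"
  unfolding snd_dvec by simp

lemma S_alt: "S (xvec (2 * n) (alt c) \<alpha>) = (\<Sum>j<n. pscale (c j) (dvec \<alpha> j))"
  unfolding S_xvec sum_pairs
  by (intro sum.cong refl) (simp add: dvec_def prod_eq_iff cscale_diff minus_cscale)

section \<open>Signed sums of pairs, and separated second components\<close>

lemma pdev_pad:
  assumes "n \<le> N" "\<And>i. i < n \<Longrightarrow> c' i = c i" "\<And>i. n \<le> i \<Longrightarrow> i < N \<Longrightarrow> c' i = 0"
  shows "pdev N c' k = pdev n c k"
proof -
  have *: "(\<Sum>j<N. c' j *\<^sub>c f j) = (\<Sum>j<n. c j *\<^sub>c f j)" for f :: "nat \<Rightarrow> cseq"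
  proof -
    have "(\<Sum>j<N. c' j *\<^sub>c f j) = (\<Sum>j<n. c' j *\<^sub>c f j)"
      by (rule sum.mono_neutral_right) (use assms in auto)
    also have "\<dots> = (\<Sum>j<n. c j *\<^sub>c f j)" using assms by (intro sum.cong) auto
    finally show ?thesis .
  qed
  show ?thesis unfolding pdev_def comb_def * ..
qed

lemma eventually_tsm_norm_xvec:
  assumes "finite F" "strict_mono_on {..<n} r" "e > 0"
  shows "\<forall>\<^sub>F k in spread n. \<forall>c\<in>F. \<bar>l2norm (dev n c k) + l2norm (comb n c k) - tsm_norm (xvec n c r)\<bar> < e"
proof (rule eventually_ball_finite[OF assms(1)], intro ballI)
  fix c
  show "\<forall>\<^sub>F k in spread n. \<bar>l2norm (dev n c k) + l2norm (comb n c k) - tsm_norm (xvec n c r)\<bar> < e"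
    using tendstoD[OF tsm_norm_xvec[OF assms(2)] assms(3), of c] by (simp add: dist_real_def)
qed

lemma eventually_incr_tuples: "\<forall>\<^sub>F k in spread n. k \<in> incr_tuples n UNIV"
  unfolding eventually_spread by (auto simp: incr_tuples_def)

lemma incr_tuples_le: "k \<in> incr_tuples N UNIV \<Longrightarrow> n \<le> N \<Longrightarrow> k \<in> incr_tuples n UNIV"
  by (auto simp: incr_tuples_def strict_mono_on_def)

text \<open>A single tuple with small \<open>pdev\<close> for coefficients 1 is good for all signs
  up to \<open>C * sqrt N\<close>. Signs are then adapted to this tuple, so that differences of its
  remainders and the given vectors \<open>t j\<close> both add up to order sqrt n.\<close>

lemma signed_pairs_bound:
  assumes freq: "\<exists>\<^sub>F k in spread N. l2norm (pdev N (\<lambda>_. 1) k) \<le> B * sqrt N"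
    and \<alpha>: "strict_mono \<alpha>" and N: "1 \<le> N" and n: "n = N div 2"
    and t: "\<And>j. j < n \<Longrightarrow> t j \<in> l2 \<and> l2norm (t j) \<le> L" and L: "0 \<le> L"
  shows "\<exists>\<theta>\<in>signs n. tsm_norm (xvec (2 * n) (alt \<theta>) \<alpha>) \<le> sqrt N * (B + 5 * C + L + 3)
    \<and> l2norm (\<Sum>j<n. \<theta> j *\<^sub>c t j) \<le> sqrt n * (L + 2 * C)"
proof -
  have le: "2 * n \<le> N" using n by simp
  have ev: "\<forall>\<^sub>F k in spread N. \<forall>c\<in>alt ` signs n.
      \<bar>l2norm (dev (2 * n) c k) + l2norm (comb (2 * n) c k) - tsm_norm (xvec (2 * n) c \<alpha>)\<bar> < 1"
    by (rule filter_leD[OF spread_antimono[OF le] eventually_tsm_norm_xvec])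
      (use finite_signs \<alpha> in \<open>auto intro: strict_mono_imp_strict_mono_on\<close>)
  have "\<exists>\<^sub>F k in spread N. l2norm (pdev N (\<lambda>_. 1) k) \<le> B * sqrt N \<and> k \<in> incr_tuples N UNIV \<and>
     (\<forall>c\<in>alt ` signs n. \<bar>l2norm (dev (2 * n) c k) + l2norm (comb (2 * n) c k) - tsm_norm (xvec (2 * n) c \<alpha>)\<bar> < 1)"
    by (rule frequently_rev_mp[OF freq], rule eventually_mono[OF eventually_conj[OF eventually_incr_tuples ev]]) blast
  then obtain k where k: "l2norm (pdev N (\<lambda>_. 1) k) \<le> B * sqrt N" "k \<in> incr_tuples N UNIV"
    and tqk: "\<And>\<theta>. \<theta> \<in> signs n \<Longrightarrow> \<bar>l2norm (dev (2 * n) (alt \<theta>) k) + l2norm (comb (2 * n) (alt \<theta>) k) - tsm_norm (xvec (2 * n) (alt \<theta>) \<alpha>)\<bar> < 1"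
    by (auto dest!: frequently_ex)
  have k2: "k \<in> incr_tuples (2 * n) UNIV" using incr_tuples_le[OF k(2) le] .
  define h where "h j = rem (u (k (2 * j))) - rem (u (k (Suc (2 * j))))" for j
  have h: "h j \<in> l2 \<and> l2norm (h j) \<le> 2 * C" for j
    unfolding h_def using rem_le[of "u (k (2 * j))"] rem_le[of "u (k (Suc (2 * j)))"]
      l2norm_triangle_diff[of "rem (u (k (2 * j)))" "rem (u (k (Suc (2 * j))))"] by simp
  obtain \<theta> where \<theta>: "\<theta> \<in> signs n" "l2norm (\<Sum>j<n. \<theta> j *\<^sub>c t j) \<le> sqrt n * (L + 2 * C)"
      "l2norm (\<Sum>j<n. \<theta> j *\<^sub>c h j) \<le> sqrt n * (L + 2 * C)"
    by (rule signs_exist_bounded[of n t L h "2 * C"]) (use t h L C_nonneg in auto)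
  have "(\<Sum>i<2 * n. alt \<theta> i *\<^sub>c rem (u (k i))) = (\<Sum>j<n. \<theta> j *\<^sub>c h j)"
    unfolding sum_pairs by (simp add: h_def cscale_diff minus_cscale)
  with \<theta>(3) have H: "l2norm (\<Sum>i<2 * n. alt \<theta> i *\<^sub>c rem (u (k i))) \<le> sqrt n * (L + 2 * C)" by simp
  have nn: "sqrt n \<le> sqrt N" using le by simp
  have "nrm n \<theta> = sqrt n" using signs_norm[OF \<theta>(1)] by (intro nrm_unimodular)
  then have nalt: "nrm (2 * n) (alt \<theta>) \<le> 2 * sqrt N" using nrm_alt_le[of n \<theta>] nn by linarith
  \<comment> \<open>If \<open>N\<close> is odd, the zero multiplier discards the unpaired last
    block.\<close>
  define c' :: cseq where "c' i = (if i < 2 * n then alt \<theta> i else 0)" for i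
  have "cmod (alt \<theta> i) = 1" for i using signs_norm[OF \<theta>(1)] by (simp add: alt_def)
  then have "cmod (c' i) \<le> 1" for i by (simp add: c'_def)
  then have "l2norm (pdev N (\<lambda>j. c' j * 1) k) \<le> 1 * l2norm (pdev N (\<lambda>_. 1) k) + C * 1 * nrm N (\<lambda>_. 1)"
    by (intro pdev_mult_le[OF k(2)]) auto
  moreover have "pdev N (\<lambda>j. c' j * 1) k = pdev (2 * n) (alt \<theta>) k"
    by (rule pdev_pad) (use le in \<open>auto simp: c'_def\<close>)
  moreover have "nrm N (\<lambda>_. 1) = sqrt N" by (rule nrm_unimodular) simp
  ultimately have p: "l2norm (pdev (2 * n) (alt \<theta>) k) \<le> B * sqrt N + C * sqrt N" using k(1) by simp
  have "l2norm (dev (2 * n) (alt \<theta>) k) \<le> B * sqrt N + C * sqrt N + C * (2 * sqrt N) + sqrt n * (L + 2 * C)"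
    using dev_le[OF k2, of "alt \<theta>"] p H mult_left_mono[OF nalt C_nonneg] by linarith
  moreover have "sqrt n * (L + 2 * C) \<le> sqrt N * (L + 2 * C)" using nn L C_nonneg by (intro mult_right_mono) auto
  moreover have "l2norm (comb (2 * n) (alt \<theta>) k) \<le> 2 * sqrt N" using comb_norm[OF k2] nalt by simp
  moreover have "1 \<le> sqrt N" using N by simp
  ultimately have "tsm_norm (xvec (2 * n) (alt \<theta>) \<alpha>) \<le> sqrt N + B * sqrt N + C * sqrt N + C * (2 * sqrt N) + sqrt N * (L + 2 * C) + 2 * sqrt N"
    using tqk[OF \<theta>(1)] by linarith
  \<comment> \<open>Besides \<open>B\<close>: 1 for the limit and 2 for \<open>comb\<close>;
    \<open>C\<close> for the change of coefficients, \<open>2 * C\<close> from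
    \<open>dev_le\<close>, and \<open>L + 2 * C\<close> for the remainders.\<close>
  also have "\<dots> = sqrt N * (B + 5 * C + L + 3)" by (simp add: algebra_simps)
  finally show ?thesis using \<theta> by blast
qed

text \<open>Differences along a coordinatewise convergent subsequence are coordinatewise null, and
  separation keeps their norms away from 0, so the gliding hump applies to them.\<close>

lemma separated_blocks:
  assumes \<delta>: "\<delta> > 0" and sep: "\<And>i j. N0 \<le> i \<Longrightarrow> i < j \<Longrightarrow> \<delta> \<le> l2norm (yvec i - yvec j)"
  obtains \<alpha> q \<rho> where "strict_mono \<alpha>" "\<And>j. snd (dvec \<alpha> j) = q j + \<rho> j"
    "\<And>j. q j \<in> l2" "\<And>j. \<rho> j \<in> l2" "\<And>n. disj_supp n q" "\<And>j. \<delta> / 2 \<le> l2norm (q j)" "\<And>j. l2norm (q j) \<le> 2 * M"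
    "\<And>j. (real j + 1) * l2norm (\<rho> j) \<le> (1 / 2) ^ j"
proof -
  have "cmod (yvec j i) \<le> M" for i j using l2_coord[OF yvec_mem] yvec_norm order_trans by blast
  then obtain r0 where r0: "strict_mono r0" "\<And>i. convergent (\<lambda>j. yvec (r0 j) i)"
    using coordinatewise_convergent_subseq[of yvec M] by blast
  define x where "x j = yvec (r0 (2 * j)) - yvec (r0 (Suc (2 * j)))" for j
  have x: "x j \<in> l2" for j by (simp add: x_def)
  have xn: "l2norm (x j) \<le> 2 * M" for j
    unfolding x_def using l2norm_diff_le[OF yvec_mem yvec_mem yvec_norm yvec_norm] by simp
  have xlim: "(\<lambda>j. x j i) \<longlonglongrightarrow> 0" for i
  proof -
    obtain l where l: "(\<lambda>j. yvec (r0 j) i) \<longlonglongrightarrow> l" using r0(2) by (auto simp: convergent_def)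
    have "strict_mono (\<lambda>j::nat. 2 * j)" "strict_mono (\<lambda>j::nat. Suc (2 * j))" by (auto simp: strict_mono_def)
    from this[THEN LIMSEQ_subseq_LIMSEQ[OF l]] have "(\<lambda>j. yvec (r0 (2 * j)) i) \<longlonglongrightarrow> l" "(\<lambda>j. yvec (r0 (Suc (2 * j))) i) \<longlonglongrightarrow> l"
      by (simp_all add: comp_def)
    from tendsto_diff[OF this] show ?thesis by (simp add: x_def)
  qed
  \<comment> \<open>The first term preserves norm at least \<open>\<delta> / 2\<close> after
    cutting; the second absorbs the weights \<open>j + 1\<close> of long sums.\<close>
  define \<epsilon> :: "nat \<Rightarrow> real" where "\<epsilon> j = min (\<delta> / 2) ((1 / 2) ^ j / (real j + 1))" for j
  have \<epsilon>: "\<epsilon> j > 0" for j using \<delta> by (simp add: \<epsilon>_def add_nonneg_pos)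
  obtain r N where r: "strict_mono r" "N0 \<le> r 0" and N: "strict_mono N"
    and le: "\<And>j. l2norm (x (r j) - ind {N j..<N (Suc j)} * x (r j)) \<le> \<epsilon> j"
    using that by (rule gliding_hump[of x \<epsilon> N0, OF x xlim \<epsilon>])
  have r0m: "r0 i < r0 j \<longleftrightarrow> i < j" for i j using r0(1) strict_mono_less by blast
  have rS: "r j < r (Suc j)" for j using r(1) by (simp add: strict_mono_Suc_iff)
  have r01: "r0 (2 * r j) < r0 (Suc (2 * r j))" and r02: "r0 (Suc (2 * r j)) < r0 (2 * r (Suc j))" for j
    using rS[of j] by (simp_all add: r0m)
  obtain \<alpha> where \<alpha>: "strict_mono \<alpha>" "\<And>j. \<alpha> (2 * j) = r0 (2 * r j)" "\<And>j. \<alpha> (Suc (2 * j)) = r0 (Suc (2 * r j))"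
    using that by (rule pair_sequence[of "\<lambda>j. r0 (2 * r j)" "\<lambda>j. r0 (Suc (2 * r j))", OF r01 r02])
  define q where "q j = ind {N j..<N (Suc j)} * x (r j)" for j
  define \<rho> where "\<rho> j = x (r j) - q j" for j
  have q: "q j \<in> l2" for j by (simp add: q_def x)
  have \<rho>: "\<rho> j \<in> l2" for j unfolding \<rho>_def using q x by simp
  have \<rho>n: "l2norm (\<rho> j) \<le> \<epsilon> j" for j using le by (simp add: \<rho>_def q_def)
  show ?thesis
  proof (rule that[of \<alpha> q \<rho>])
    show "strict_mono \<alpha>" by fact
    show "snd (dvec \<alpha> j) = q j + \<rho> j" for j by (simp add: snd_dvec \<alpha> \<rho>_def x_def)
    show "q j \<in> l2" "\<rho> j \<in> l2" for j by fact+
    show "disj_supp n q" for n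
    proof -
      have "supp (q i) \<subseteq> {N i..<N (Suc i)}" for i by (auto simp: q_def supp_def ind_def)
      moreover have "{N i..<N (Suc i)} \<inter> {N j..<N (Suc j)} = {}" if "i < j" for i j
        using that strict_mono_less_eq[OF N, of "Suc i" j] by auto
      ultimately have "supp (q i) \<inter> supp (q j) = {}" if "i < j" for i j using that by blast
      then show ?thesis unfolding disj_supp_def by (metis Int_commute linorder_neqE_nat)
    qed
    show "\<delta> / 2 \<le> l2norm (q j)" for j
    proof -
      have "r 0 \<le> r j" using r(1) by (simp add: strict_mono_less_eq)
      moreover have "2 * r j \<le> r0 (2 * r j)" using r0(1) by (rule seq_suble)
      ultimately have "\<delta> \<le> l2norm (x (r j))" unfolding x_def using r(2) r0m by (intro sep) auto
      also have "x (r j) = q j + \<rho> j" by (simp add: \<rho>_def)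
      also have "l2norm (q j + \<rho> j) \<le> l2norm (q j) + l2norm (\<rho> j)" using q \<rho> by (rule l2norm_triangle)
      finally show ?thesis using \<rho>n[of j] by (simp add: \<epsilon>_def)
    qed
    show "l2norm (q j) \<le> 2 * M" for j
      unfolding q_def using l2norm_ind[OF x] xn order_trans by blast
    show "(real j + 1) * l2norm (\<rho> j) \<le> (1 / 2) ^ j" for j
    proof -
      have "l2norm (\<rho> j) \<le> (1 / 2) ^ j / (real j + 1)" using \<rho>n[of j] by (simp add: \<epsilon>_def)
      then show ?thesis by (simp add: pos_le_divide_eq add_nonneg_pos mult.commute)
    qed
  qed
qed

lemma separated_case:
  assumes \<delta>: "\<delta> > 0" and sep: "\<And>i j. N0 \<le> i \<Longrightarrow> i < j \<Longrightarrow> \<delta> \<le> l2norm (yvec i - yvec j)"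
    and freq: "\<And>N1. \<exists>N\<ge>N1. \<exists>\<^sub>F k in spread N. l2norm (pdev N (\<lambda>_. 1) k) \<le> B * sqrt N"
  shows False
proof -
  obtain \<alpha> q \<rho> where \<alpha>: "strict_mono \<alpha>" and s: "\<And>j. snd (dvec \<alpha> j) = q j + \<rho> j"
    and q: "\<And>j. q j \<in> l2" and \<rho>: "\<And>j. \<rho> j \<in> l2" and d: "\<And>n. disj_supp n q"
    and qn: "\<And>j. \<delta> / 2 \<le> l2norm (q j)" "\<And>j. l2norm (q j) \<le> 2 * M"
    and \<rho>n: "\<And>j. (real j + 1) * l2norm (\<rho> j) \<le> (1 / 2) ^ j"
    by (rule separated_blocks[OF \<delta>], erule (1) sep, rule that)
  define t where "t j = fst (dvec \<alpha> j) - kp.pr (q j) - kalton_peck (\<rho> j)" for j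
  \<comment> \<open>The bound of \<open>pr_sum_le\<close> for a single pair:
    \<open>dvec_norm\<close>, and 10 = 5 * 2 times norms at most \<open>2 * M\<close> and 1.\<close>
  define L where "L = 18 * M + 10 * (2 * M + 1)"
  have L: "0 \<le> L" using M_pos by (simp add: L_def)
  have \<rho>1: "l2norm (\<rho> j) \<le> 1" for j
  proof -
    have "1 * l2norm (\<rho> j) \<le> (real j + 1) * l2norm (\<rho> j)" using \<rho> by (intro mult_right_mono) auto
    also have "\<dots> \<le> 1" using \<rho>n[of j] power_le_one[of "1/2::real" j] by linarith
    finally show ?thesis by simp
  qed
  have t: "t j \<in> l2 \<and> l2norm (t j) \<le> L" for j
  proof -
    have "t j \<in> l2 \<and> l2norm (t j) \<le> ztnorm kalton_peck (dvec \<alpha> j) + 5 * 2 * (l2norm (q j) + l2norm (\<rho> j))"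
      unfolding t_def by (rule kp.pr_sum_le(1)[of "Suc j" "dvec \<alpha>" q \<rho> j]) (simp_all add: q \<rho> s)
    moreover have "ztnorm kalton_peck (dvec \<alpha> j) + 5 * 2 * (l2norm (q j) + l2norm (\<rho> j)) \<le> 18 * M + 5 * 2 * (2 * M + 1)"
      by (intro add_mono mult_left_mono dvec_norm qn \<rho>1) simp
    ultimately show ?thesis unfolding L_def by simp
  qed
  \<comment> \<open>\<open>R\<close> bounds the deviation in \<open>Z2\<close> divided by sqrt n:
    the model norm (with \<open>sqrt N \<le> 2 * sqrt n\<close>), the \<open>t j\<close>, 5 * 2
    times the norm of the block sum, and 8 * 2 * 2 for the perturbation. \<open>X\<close> is the
    largest sqrt n for which the logarithmic lower bound can stay below \<open>R\<close>.\<close>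
  define R where "R = 2 * M * \<bar>B + 5 * C + L + 3\<bar> + L + 2 * C + 20 * M + 32"
  define X where "X = 2 * M * exp (2 * R / \<delta>) * 2 / \<delta>"
  have X: "X > 0" using M_pos \<delta> by (simp add: X_def)
  obtain P :: nat where P: "X\<^sup>2 < P" using reals_Archimedean2 by blast
  obtain N where N: "N \<ge> 2 * P + 2" and fr: "\<exists>\<^sub>F k in spread N. l2norm (pdev N (\<lambda>_. 1) k) \<le> B * sqrt N"
    using freq by blast
  define n where "n = N div 2"
  have n: "n \<ge> 1" "P \<le> n" "N \<le> 4 * n" using N unfolding n_def by linarith+
  have sN: "sqrt N \<le> 2 * sqrt n"
  proof -
    have "sqrt N \<le> sqrt (4 * n)" using n(3) by (simp add: of_nat_le_iff[symmetric, where 'a = real] del: of_nat_le_iff)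
    also have "\<dots> = 2 * sqrt n" by (simp add: real_sqrt_mult)
    finally show ?thesis .
  qed
  obtain \<theta> where \<theta>: "\<theta> \<in> signs n" and th1: "tsm_norm (xvec (2 * n) (alt \<theta>) \<alpha>) \<le> sqrt N * (B + 5 * C + L + 3)"
    and th2: "l2norm (\<Sum>j<n. \<theta> j *\<^sub>c t j) \<le> sqrt n * (L + 2 * C)"
    using signed_pairs_bound[OF fr \<alpha> _ n_def, of t L] N t L by auto
  have "ztnorm kalton_peck (\<Sum>j<n. pscale (\<theta> j) (dvec \<alpha> j)) \<le> M * (sqrt N * (B + 5 * C + L + 3))"
    using S_upper[OF xvec_mem, of "2 * n" "alt \<theta>" \<alpha>] mult_left_mono[OF th1, of M] M_pos unfolding S_alt by linarith
  also have "\<dots> \<le> M * (sqrt N * \<bar>B + 5 * C + L + 3\<bar>)"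
    using M_pos by (intro mult_left_mono) auto
  also have "\<dots> \<le> M * (2 * sqrt n * \<bar>B + 5 * C + L + 3\<bar>)"
    using M_pos sN by (intro mult_left_mono mult_right_mono) auto
  finally have z: "ztnorm kalton_peck (\<Sum>j<n. pscale (\<theta> j) (dvec \<alpha> j)) \<le> M * (2 * sqrt n * \<bar>B + 5 * C + L + 3\<bar>)" .
  have Q: "l2norm (\<Sum>j<n. \<theta> j *\<^sub>c q j) \<le> sqrt n * (2 * M)"
  proof (rule power2_le_imp_le)
    have "(l2norm (\<Sum>j<n. \<theta> j *\<^sub>c q j))\<^sup>2 = (\<Sum>j<n. (l2norm (\<theta> j *\<^sub>c q j))\<^sup>2)"
      using q by (intro l2norm_disj_sum disj_cscale d) auto
    also have "\<dots> \<le> (\<Sum>j<n. (2 * M)\<^sup>2)"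
      using qn(2) q signs_norm[OF \<theta>] by (intro sum_mono power_mono) (auto simp: l2norm_cscale)
    finally show "(l2norm (\<Sum>j<n. \<theta> j *\<^sub>c q j))\<^sup>2 \<le> (sqrt n * (2 * M))\<^sup>2" by (simp add: power_mult_distrib)
  qed (use M_pos in simp)
  have G: "(\<Sum>j<n. (real j + 1) * (cmod (\<theta> j) * l2norm (\<rho> j))) \<le> 2"
  proof -
    have "(\<Sum>j<n. (real j + 1) * (cmod (\<theta> j) * l2norm (\<rho> j))) \<le> (\<Sum>j<n. (1 / 2) ^ j)"
      using \<rho>n signs_norm[OF \<theta>] by (intro sum_mono) simp
    then show ?thesis using sum_half_le[of n] by linarith
  qed
  have "sqrt n * (\<delta> / 2) * ln (sqrt n * (\<delta> / 2) / (2 * M))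
    \<le> l2norm (kalton_peck (\<Sum>j<n. \<theta> j *\<^sub>c q j) - (\<Sum>j<n. \<theta> j *\<^sub>c kalton_peck (q j)))"
    using d q signs_norm[OF \<theta>] qn \<delta> n(1) by (intro kalton_peck_disj_sum) auto
  also have "\<dots> \<le> ztnorm kalton_peck (\<Sum>j<n. pscale (\<theta> j) (dvec \<alpha> j)) + l2norm (\<Sum>j<n. \<theta> j *\<^sub>c t j)
        + 5 * 2 * l2norm (\<Sum>j<n. \<theta> j *\<^sub>c q j) + 8 * 2 * (\<Sum>j<n. (real j + 1) * (cmod (\<theta> j) * l2norm (\<rho> j)))"
    using kp.pr_sum_le(2)[of n "dvec \<alpha>" q \<rho> \<theta>] q \<rho> s by (simp add: t_def)
  also have "\<dots> \<le> M * (2 * sqrt n * \<bar>B + 5 * C + L + 3\<bar>) + sqrt n * (L + 2 * C) + 5 * 2 * (sqrt n * (2 * M)) + 8 * 2 * 2"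
    by (intro add_mono z th2 mult_left_mono Q G) auto
  also have "\<dots> \<le> M * (2 * sqrt n * \<bar>B + 5 * C + L + 3\<bar>) + sqrt n * (L + 2 * C) + 5 * 2 * (sqrt n * (2 * M)) + 32 * sqrt n"
    using n(1) by simp
  also have "\<dots> = sqrt n * R" by (simp add: R_def algebra_simps)
  finally have "sqrt n * ((\<delta> / 2) * ln (sqrt n * (\<delta> / 2) / (2 * M))) \<le> sqrt n * R" by (simp add: mult.assoc)
  then have "(\<delta> / 2) * ln (sqrt n * (\<delta> / 2) / (2 * M)) \<le> R" using n(1) by (simp add: mult_le_cancel_left_pos)
  then have "ln (sqrt n * (\<delta> / 2) / (2 * M)) \<le> 2 * R / \<delta>" using \<delta> by (simp add: field_simps)
  moreover have "0 < sqrt n * (\<delta> / 2) / (2 * M)" using n(1) \<delta> M_pos by simp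
  ultimately have "sqrt n * (\<delta> / 2) / (2 * M) \<le> exp (2 * R / \<delta>)" by (metis exp_le_cancel_iff exp_ln)
  then have "sqrt n \<le> X" using \<delta> M_pos by (simp add: X_def field_simps)
  then have "(sqrt n)\<^sup>2 \<le> X\<^sup>2" by (intro power_mono) auto
  then show False using P n(2) by simp
qed

end

section \<open>Second components that are not separated\<close>

lemma ln_sqrt_unbounded: "\<exists>p\<ge>1. R < ln (sqrt (real p))"
proof -
  obtain p :: nat where p: "(exp R)\<^sup>2 < p" using reals_Archimedean2 by blast
  have p0: "real p > 0" using p zero_le_power2[of "exp R"] by linarith
  have "exp R < sqrt p" using p by (simp add: real_less_rsqrt)
  then have "ln (exp R) < ln (sqrt p)" by (intro ln_less_cancel_iff[THEN iffD2]) (use p0 in auto)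
  then have "R < ln (sqrt p)" by simp
  moreover have "p \<ge> 1" using p0 by simp
  ultimately show ?thesis by blast
qed

lemma (in centr) ztnorm_sum_le:
  fixes n :: nat
  assumes w: "\<And>j. j < n \<Longrightarrow> w j \<in> zspace \<Omega>" "\<And>j. j < n \<Longrightarrow> ztnorm \<Omega> (w j) \<le> \<epsilon>"
    and c: "\<And>j. cmod (c j) = 1" and e: "0 \<le> \<epsilon>"
  shows "ztnorm \<Omega> (\<Sum>j<n. pscale (c j) (w j)) \<le> n * ((2 + 4 * C * n) * \<epsilon>)"
proof -
  define s where "s j = fst (w j) - \<Omega> (snd (w j))" for j
  have s: "s j \<in> l2" "l2norm (s j) \<le> \<epsilon>" and y: "snd (w j) \<in> l2" "l2norm (snd (w j)) \<le> \<epsilon>" if "j < n" for j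
  proof -
    show *: "s j \<in> l2" "snd (w j) \<in> l2" using w(1)[OF that] by (auto simp: zspace_def s_def)
    show "l2norm (s j) \<le> \<epsilon>" "l2norm (snd (w j)) \<le> \<epsilon>"
      using w(2)[OF that] l2norm_nonneg[OF *(1)] l2norm_nonneg[OF *(2)] by (auto simp: ztnorm_def s_def)
  qed
  have "l2norm (\<Sum>j<n. c j *\<^sub>c s j) \<le> (\<Sum>j<n. l2norm (c j *\<^sub>c s j))" using s by (intro l2norm_sum) auto
  also have "\<dots> \<le> (\<Sum>j<n. \<epsilon>)" using s c by (intro sum_mono) (simp add: l2norm_cscale)
  finally have 1: "l2norm (\<Sum>j<n. c j *\<^sub>c s j) \<le> n * \<epsilon>" by simp
  have 2: "(\<Sum>j<n. cmod (c j) * l2norm (snd (w j))) \<le> n * \<epsilon>"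
    using sum_mono[of "{..<n}" "\<lambda>j. cmod (c j) * l2norm (snd (w j))" "\<lambda>_. \<epsilon>"] y c by simp
  have "(\<Sum>j<n. (real j + 1) * (cmod (c j) * l2norm (snd (w j)))) \<le> (\<Sum>j<n. real n * \<epsilon>)"
    using y c e by (intro sum_mono mult_mono) auto
  then have "(\<Sum>j<n. (real j + 1) * (cmod (c j) * l2norm (snd (w j)))) \<le> n * (n * \<epsilon>)" by simp
  then have 3: "4 * C * (\<Sum>j<n. (real j + 1) * (cmod (c j) * l2norm (snd (w j)))) \<le> 4 * C * (n * (n * \<epsilon>))"
    using C_nonneg by (intro mult_left_mono) auto
  have "ztnorm \<Omega> (\<Sum>j<n. pscale (c j) (w j)) \<le> n * \<epsilon> + 4 * C * (n * (n * \<epsilon>)) + n * \<epsilon>"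
    using ztnorm_sum_small[of n w c, OF w(1)] 1 2 3 unfolding ztnorm_def s_def[symmetric] by linarith
  then show ?thesis by (simp add: algebra_simps)
qed

context model_embedding
begin

lemma near_pairs:
  assumes near: "\<And>\<eta> N0. \<eta> > 0 \<Longrightarrow> \<exists>i j. N0 \<le> i \<and> i < j \<and> l2norm (yvec i - yvec j) \<le> \<eta>"
  obtains \<alpha> where "strict_mono \<alpha>" "\<And>j. (real j + 1) * l2norm (snd (dvec \<alpha> j)) \<le> (1 / 2) ^ j"
proof -
  define P where "P j t \<longleftrightarrow> fst t < snd t \<and> (real j + 1) * l2norm (yvec (fst t) - yvec (snd t)) \<le> (1 / 2) ^ j"
    for j and t :: "nat \<times> nat"
  have step: "\<exists>t. P j t \<and> N0 < fst t" for j N0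
  proof -
    have "(1 / 2) ^ j / (real j + 1) > 0" by (simp add: add_nonneg_pos)
    then obtain i l where "Suc N0 \<le> i" "i < l" "l2norm (yvec i - yvec l) \<le> (1 / 2) ^ j / (real j + 1)"
      using near by blast
    then have "P j (i, l) \<and> N0 < fst (i, l)" by (simp add: P_def pos_le_divide_eq add_nonneg_pos mult.commute)
    then show ?thesis by blast
  qed
  have "\<exists>f. \<forall>n. P n (f n) \<and> snd (f n) < fst (f (Suc n))"
    using step by (intro dependent_nat_choice) blast+
  then obtain f where f: "\<And>n. P n (f n)" "\<And>n. snd (f n) < fst (f (Suc n))" by blast
  have f1: "fst (f j) < snd (f j)" for j using f(1)[of j] by (simp add: P_def)
  obtain \<alpha> where \<alpha>: "strict_mono \<alpha>" "\<And>j. \<alpha> (2 * j) = fst (f j)" "\<And>j. \<alpha> (Suc (2 * j)) = snd (f j)"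
    using that by (rule pair_sequence[of "\<lambda>j. fst (f j)" "\<lambda>j. snd (f j)", OF f1 f(2)])
  show ?thesis using \<alpha>(1) by (rule that) (use f(1) in \<open>simp add: snd_dvec \<alpha> P_def\<close>)
qed

text \<open>With negligible second components the pairs behave in \<open>Z2\<close> like bounded
  vectors of a Hilbert space, where suitable signs give an upper estimate by \<open>nrm n b\<close>;
  \<open>S_lower\<close> carries it back to the model.\<close>

lemma near_signed_bound:
  assumes \<alpha>: "\<And>j. (real j + 1) * l2norm (snd (dvec \<alpha> j)) \<le> (1 / 2) ^ j"
  shows "\<exists>\<theta>\<in>signs n. tsm_norm (xvec (2 * n) (alt (\<lambda>j. \<theta> j * b j)) \<alpha>) \<le> (18 * M + 18) / m * nrm n b"
proof -
  define s where "s j = fst (dvec \<alpha> j) - kalton_peck (snd (dvec \<alpha> j))" for j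
  have s: "s j \<in> l2" "l2norm (s j) \<le> 18 * M" for j
  proof -
    show "s j \<in> l2" using dvec_mem[of \<alpha> j] by (simp add: zspace_def s_def)
    show "l2norm (s j) \<le> 18 * M"
      using dvec_norm[of \<alpha> j] l2norm_nonneg[OF snd_dvec_mem, of \<alpha> j] unfolding ztnorm_def s_def by linarith
  qed
  obtain \<theta> where \<theta>: "\<theta> \<in> signs n" and "(l2norm (\<Sum>j<n. \<theta> j *\<^sub>c b j *\<^sub>c s j))\<^sup>2 + (l2norm (\<Sum>j<n. \<theta> j *\<^sub>c (0 :: cseq)))\<^sup>2
      \<le> (\<Sum>j<n. (l2norm (b j *\<^sub>c s j))\<^sup>2 + (l2norm 0)\<^sup>2)"
    using signs_exist[of n "\<lambda>j. b j *\<^sub>c s j" "\<lambda>_. 0"] s(1) by auto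
  then have "(l2norm (\<Sum>j<n. \<theta> j *\<^sub>c b j *\<^sub>c s j))\<^sup>2 \<le> (\<Sum>j<n. (l2norm (b j *\<^sub>c s j))\<^sup>2)" by simp
  also have "\<dots> \<le> (\<Sum>j<n. (18 * M * cmod (b j))\<^sup>2)"
  proof (intro sum_mono power_mono)
    show "l2norm (b j *\<^sub>c s j) \<le> 18 * M * cmod (b j)" for j
      using mult_left_mono[OF s(2)[of j], of "cmod (b j)"] s(1) by (simp add: l2norm_cscale mult_ac)
  qed (use s(1) in auto)
  also have "\<dots> = (18 * M * nrm n b)\<^sup>2"
    unfolding power_mult_distrib nrm_sq by (simp add: sum_distrib_left)
  finally have "l2norm (\<Sum>j<n. \<theta> j *\<^sub>c b j *\<^sub>c s j) \<le> 18 * M * nrm n b"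
    by (rule power2_le_imp_le) (use M_pos in simp)
  then have 1: "l2norm (\<Sum>j<n. (\<theta> j * b j) *\<^sub>c s j) \<le> 18 * M * nrm n b" by simp
  have c: "cmod (\<theta> j * b j) = cmod (b j)" for j using signs_norm[OF \<theta>] by (simp add: norm_mult)
  have "(\<Sum>j<n. (real j + 1) * (cmod (\<theta> j * b j) * l2norm (snd (dvec \<alpha> j)))) \<le> (\<Sum>j<n. nrm n b * (1 / 2) ^ j)"
  proof (intro sum_mono)
    fix j assume "j \<in> {..<n}"
    then have "cmod (b j) * ((real j + 1) * l2norm (snd (dvec \<alpha> j))) \<le> nrm n b * (1 / 2) ^ j"
      using \<alpha>[of j] nrm_coord by (intro mult_mono) auto
    then show "(real j + 1) * (cmod (\<theta> j * b j) * l2norm (snd (dvec \<alpha> j))) \<le> nrm n b * (1 / 2) ^ j"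
      unfolding c by (simp add: mult_ac)
  qed
  also have "\<dots> \<le> nrm n b * 2" unfolding sum_distrib_left[symmetric] using sum_half_le by (intro mult_left_mono) auto
  finally have 2: "(\<Sum>j<n. (real j + 1) * (cmod (\<theta> j * b j) * l2norm (snd (dvec \<alpha> j)))) \<le> nrm n b * 2" .
  have "(\<Sum>j<n. cmod (\<theta> j * b j) * l2norm (snd (dvec \<alpha> j))) \<le> (\<Sum>j<n. (real j + 1) * (cmod (\<theta> j * b j) * l2norm (snd (dvec \<alpha> j))))"
    by (intro sum_mono) (simp add: algebra_simps)
  then have 3: "(\<Sum>j<n. cmod (\<theta> j * b j) * l2norm (snd (dvec \<alpha> j))) \<le> nrm n b * 2" using 2 by linarith
  \<comment> \<open>Here 4 * 2 is \<open>4 * C\<close> for \<open>kalton_peck\<close>; the two error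
    terms make up the summand 18 = 16 + 2.\<close>
  have "ztnorm kalton_peck (\<Sum>j<n. pscale (\<theta> j * b j) (dvec \<alpha> j)) \<le> 18 * M * nrm n b + 4 * 2 * (nrm n b * 2) + nrm n b * 2"
    using kp.ztnorm_sum_small[of n "dvec \<alpha>" "\<lambda>j. \<theta> j * b j", OF dvec_mem] 1 2 3
    unfolding ztnorm_def s_def[symmetric] by linarith
  then have "m * tsm_norm (xvec (2 * n) (alt (\<lambda>j. \<theta> j * b j)) \<alpha>) \<le> (18 * M + 18) * nrm n b"
    using S_lower[OF xvec_mem, of "2 * n" "alt (\<lambda>j. \<theta> j * b j)" \<alpha>] unfolding S_alt by (simp add: algebra_simps)
  then have "tsm_norm (xvec (2 * n) (alt (\<lambda>j. \<theta> j * b j)) \<alpha>) \<le> (18 * M + 18) / m * nrm n b"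
    using m_pos by (simp add: field_simps)
  then show ?thesis using \<theta> by blast
qed

text \<open>The signs disappear because \<open>pdev\<close> admits bounded multipliers, at the price
  of a multiple of \<open>nrm n b\<close>. Good tuples of double length convert \<open>dev\<close>
  into \<open>pdev\<close>, and their even entries form the tuple sought. A finite set
  \<open>F\<close> is treated at once since the next step compares several vectors along one
  tuple.\<close>

lemma near_pdev_bound:
  assumes near: "\<And>\<eta> N0. \<eta> > 0 \<Longrightarrow> \<exists>i j. N0 \<le> i \<and> i < j \<and> l2norm (yvec i - yvec j) \<le> \<eta>"
  obtains K where "0 \<le> K" "\<And>n F. finite F \<Longrightarrow> \<exists>\<^sub>F k in spread n. \<forall>b\<in>F. l2norm (pdev n b k) \<le> K * nrm n b + 1"
proof -
  obtain \<alpha> where \<alpha>: "strict_mono \<alpha>" "\<And>j. (real j + 1) * l2norm (snd (dvec \<alpha> j)) \<le> (1 / 2) ^ j"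
    by (rule near_pairs, erule near, rule that)
  define K0 where "K0 = (18 * M + 18) / m"
  have K0: "K0 \<ge> 0" using m_pos M_pos by (simp add: K0_def)
  \<comment> \<open>\<open>2 * (C + 1)\<close> from \<open>pdev_le\<close> and \<open>2 * C\<close>
    from the multiplier, both because \<open>nrm (2 * n) c \<le> 2 * nrm n b\<close>.\<close>
  define K where "K = K0 + 4 * C + 2"
  show ?thesis
  proof (rule that[of K])
    show "0 \<le> K" using K0 C_nonneg by (simp add: K_def)
    fix n and F :: "cseq set" assume F: "finite F"
    have "\<forall>b. \<exists>\<theta>. \<theta> \<in> signs n \<and> tsm_norm (xvec (2 * n) (alt (\<lambda>j. \<theta> j * b j)) \<alpha>) \<le> K0 * nrm n b"
      using near_signed_bound[OF \<alpha>(2)] unfolding K0_def by blast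
    then obtain \<theta> where \<theta>: "\<And>b. \<theta> b \<in> signs n" "\<And>b. tsm_norm (xvec (2 * n) (alt (\<lambda>j. \<theta> b j * b j)) \<alpha>) \<le> K0 * nrm n b"
      by metis
    have "\<forall>\<^sub>F k in spread (2 * n). \<forall>c\<in>(\<lambda>b. alt (\<lambda>j. \<theta> b j * b j)) ` F.
        \<bar>l2norm (dev (2 * n) c k) + l2norm (comb (2 * n) c k) - tsm_norm (xvec (2 * n) c \<alpha>)\<bar> < 1"
      by (rule eventually_tsm_norm_xvec[OF finite_imageI[OF F] strict_mono_imp_strict_mono_on[OF \<alpha>(1)]]) simp
    then obtain \<nu>0 where \<nu>0: "\<And>k b. k \<in> incr_tuples (2 * n) {\<nu>0<..} \<Longrightarrow> b \<in> F \<Longrightarrow>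
        \<bar>l2norm (dev (2 * n) (alt (\<lambda>j. \<theta> b j * b j)) k) + l2norm (comb (2 * n) (alt (\<lambda>j. \<theta> b j * b j)) k)
          - tsm_norm (xvec (2 * n) (alt (\<lambda>j. \<theta> b j * b j)) \<alpha>)\<bar> < 1"
      unfolding eventually_spread by auto
    show "\<exists>\<^sub>F k in spread n. \<forall>b\<in>F. l2norm (pdev n b k) \<le> K * nrm n b + 1"
      unfolding frequently_spread
    proof
      fix \<nu>
      obtain k where k: "k \<in> incr_tuples (2 * n) {max \<nu> \<nu>0<..}" "good (2 * n) k" using good_exists by blast
      have k1: "k \<in> incr_tuples (2 * n) {\<nu>0<..}" "k \<in> incr_tuples (2 * n) {\<nu><..}" using k(1) by (auto simp: incr_tuples_def)
      define k' where "k' = k \<circ> (\<lambda>j. 2 * j)"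
      have k': "k' \<in> incr_tuples n {\<nu><..}"
        unfolding k'_def using k1(2) by (rule incr_tuples_comp) (auto simp: strict_mono_on_def)
      have "l2norm (pdev n b k') \<le> K * nrm n b + 1" if b: "b \<in> F" for b
      proof -
        define c where "c = alt (\<lambda>j. \<theta> b j * b j)"
        \<comment> \<open>The multiplier undoes the signs on even entries, as their squares are 1,
          and deletes the odd entries.\<close>
        define e :: cseq where "e i = (if even i then \<theta> b (i div 2) else 0)" for i
        define b' :: cseq where "b' i = (if even i then b (i div 2) else 0)" for i
        have "nrm n (\<lambda>j. \<theta> b j * b j) = nrm n b"
          unfolding nrm_def norm_mult using signs_norm[OF \<theta>(1)] by simp
        then have nc: "nrm (2 * n) c \<le> 2 * nrm n b" unfolding c_def using nrm_alt_le[of n "\<lambda>j. \<theta> b j * b j"] by simp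
        have "l2norm (dev (2 * n) c k) \<le> K0 * nrm n b + 1"
          using \<nu>0[OF k1(1) b] \<theta>(2)[of b] l2norm_nonneg[OF comb_mem, of "2 * n" c k] unfolding c_def by linarith
        moreover have "(C + 1) * nrm (2 * n) c \<le> (C + 1) * (2 * nrm n b)" using nc C_nonneg by (intro mult_left_mono) auto
        ultimately have 1: "l2norm (pdev (2 * n) c k) \<le> K0 * nrm n b + 1 + (C + 1) * (2 * nrm n b)"
          using pdev_le[OF k, of c] by linarith
        have "cmod (e i) \<le> 1" for i using signs_norm[OF \<theta>(1)] by (simp add: e_def)
        then have "l2norm (pdev (2 * n) (\<lambda>i. e i * c i) k) \<le> 1 * l2norm (pdev (2 * n) c k) + C * 1 * nrm (2 * n) c"
          by (intro pdev_mult_le[OF k(1)]) auto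
        moreover have "C * nrm (2 * n) c \<le> C * (2 * nrm n b)" using nc C_nonneg by (intro mult_left_mono)
        moreover have "(\<lambda>i. e i * c i) = b'"
          using signs_sq[OF \<theta>(1)[of b]] by (auto simp: fun_eq_iff e_def c_def b'_def alt_def mult.assoc[symmetric])
        moreover have "pdev (2 * n) b' k = pdev n b k'"
          unfolding pdev_def comb_def sum_pairs k'_def by (simp add: b'_def)
        ultimately show ?thesis using 1 by (simp add: K_def algebra_simps)
      qed
      then show "\<exists>k\<in>incr_tuples n {\<nu><..}. \<forall>b\<in>F. l2norm (pdev n b k) \<le> K * nrm n b + 1" using k' by blast
    qed
  qed
qed

text \<open>If \<open>pdev\<close> is dominated by \<open>nrm\<close>, then along a suitable tuple
  \<open>\<Omega>\<close> differs from a linear map of the coefficients by a bounded error.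
  Subtracting this map turns the model locally into a sum of two Hilbert spaces, where signs keep
  sums of \<open>p\<close> bounded vectors of order sqrt p.\<close>

lemma near_type_two:
  assumes K: "0 \<le> K" "\<And>n F. finite F \<Longrightarrow> \<exists>\<^sub>F k in spread n. \<forall>b\<in>F. l2norm (pdev n b k) \<le> K * nrm n b + 1"
    and \<xi>: "\<And>j. j < p \<Longrightarrow> \<xi> j \<in> c00 \<times> c00" "\<And>j. j < p \<Longrightarrow> tsm_norm (\<xi> j) \<le> T" and T: "0 \<le> T" and p: "p \<ge> 1"
  defines "W \<equiv> (T + 1) + K * (T + 1) + 1 + C * (T + 1) + (T + 1)"
  shows "\<exists>\<theta>\<in>signs p. tsm_norm (\<Sum>j<p. pscale (\<theta> j) (\<xi> j)) \<le> sqrt p * (W * (2 + K + C) + 2)"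
proof -
  have "\<forall>j. \<exists>n. j < p \<longrightarrow> (\<forall>i\<ge>n. fst (\<xi> j) i = 0 \<and> snd (\<xi> j) i = 0)" using c00_vanish[OF \<xi>(1)] by blast
  then obtain n0 where n0: "\<And>j i. j < p \<Longrightarrow> n0 j \<le> i \<Longrightarrow> fst (\<xi> j) i = 0 \<and> snd (\<xi> j) i = 0" by metis
  define n where "n = (\<Sum>j<p. n0 j)"
  have n: "fst (\<xi> j) i = 0 \<and> snd (\<xi> j) i = 0" if "j < p" "n \<le> i" for i j
    using n0[OF that(1), of i] that member_le_sum[of j "{..<p}" n0] by (auto simp: n_def)
  define \<Xi> where "\<Xi> \<theta> = (\<Sum>j<p. pscale (\<theta> j) (\<xi> j))" for \<theta> :: cseq
  have \<Xi>n: "fst (\<Xi> \<theta>) i = 0 \<and> snd (\<Xi> \<theta>) i = 0" if "n \<le> i" for i \<theta>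
    using n that by (simp add: \<Xi>_def fst_sum snd_sum sum_fun_apply)
  \<comment> \<open>The signs will depend on the tuple, so the tuple has to suit the combinations
    for all signs as well as the single vectors.\<close>
  define F where "F = (\<lambda>j. snd (\<xi> j)) ` {..<p} \<union> (\<lambda>\<theta>. snd (\<Xi> \<theta>)) ` signs p"
  have "finite F" by (simp add: F_def finite_signs)
  note freq = K(2)[OF this, of n]
  define V where "V = \<xi> ` {..<p} \<union> \<Xi> ` signs p"
  have fV: "finite V" by (simp add: V_def finite_signs)
  have "\<forall>\<^sub>F k in spread n. \<forall>v\<in>V. \<bar>ztnorm \<Omega> (lift n v k) - tsm_norm v\<bar> < 1"
  proof (rule eventually_ball_finite[OF fV], intro ballI)
    fix v assume "v \<in> V"
    then have "((\<lambda>k. ztnorm \<Omega> (lift n v k)) \<longlongrightarrow> tsm_norm v) (spread n)"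
      using n \<Xi>n by (intro tsm_norm_tendsto) (auto simp: V_def)
    from tendstoD[OF this, of 1] show "\<forall>\<^sub>F k in spread n. \<bar>ztnorm \<Omega> (lift n v k) - tsm_norm v\<bar> < 1"
      by (simp add: dist_real_def)
  qed
  note ev = eventually_conj[OF this eventually_incr_tuples]
  have "\<exists>\<^sub>F k in spread n. (\<forall>b\<in>F. l2norm (pdev n b k) \<le> K * nrm n b + 1) \<and>
      (\<forall>v\<in>V. \<bar>ztnorm \<Omega> (lift n v k) - tsm_norm v\<bar> < 1) \<and> k \<in> incr_tuples n UNIV"
    by (rule frequently_rev_mp[OF freq], rule eventually_mono[OF ev]) blast
  then obtain k where kF: "\<And>b. b \<in> F \<Longrightarrow> l2norm (pdev n b k) \<le> K * nrm n b + 1"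
    and kV: "\<And>v. v \<in> V \<Longrightarrow> \<bar>ztnorm \<Omega> (lift n v k) - tsm_norm v\<bar> < 1" and k: "k \<in> incr_tuples n UNIV"
    by (auto dest!: frequently_ex)
  \<comment> \<open>\<open>\<Lambda>\<close> is the linear map in question;
    \<open>\<Omega> (comb n b k)\<close> differs from it by \<open>pdev\<close> and a
    remainder.\<close>
  define \<Lambda> where "\<Lambda> b = (\<Sum>i<n. b i *\<^sub>c pr (u (k i)))" for b :: cseq
  have \<Lambda>_eq: "\<Omega> (comb n b k) = pdev n b k + \<Lambda> b + rem (comb n b k)" for b
    by (simp add: pdev_def \<Lambda>_def rem_def)
  define \<beta> where "\<beta> j = comb n (snd (\<xi> j)) k" for j
  define t where "t j = fst (lift n (\<xi> j) k) - \<Lambda> (snd (\<xi> j))" for j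
  define s where "s v = fst (lift n v k) - \<Omega> (snd (lift n v k))" for v
  have s: "s v \<in> l2" for v using lift_mem[of n v k] by (simp add: s_def zspace_def)
  have lamn: "ztnorm \<Omega> (lift n v k) = l2norm (s v) + l2norm (comb n (snd v) k)" for v
    by (simp add: ztnorm_def s_def) (simp add: lift_def)
  have \<beta>: "\<beta> j \<in> l2 \<and> l2norm (\<beta> j) \<le> T + 1" and t: "t j \<in> l2 \<and> l2norm (t j) \<le> (T + 1) + K * (T + 1) + 1 + C * (T + 1)" if j: "j < p" for j
  proof -
    have "ztnorm \<Omega> (lift n (\<xi> j) k) \<le> T + 1" using kV[of "\<xi> j"] j \<xi>(2)[OF j] by (auto simp: V_def)
    then have b: "l2norm (s (\<xi> j)) \<le> T + 1" "l2norm (\<beta> j) \<le> T + 1"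
      using l2norm_nonneg[OF s, of "\<xi> j"] l2norm_nonneg[OF comb_mem, of n "snd (\<xi> j)" k] unfolding lamn \<beta>_def by linarith+
    then show "\<beta> j \<in> l2 \<and> l2norm (\<beta> j) \<le> T + 1" by (simp add: \<beta>_def)
    have nb: "nrm n (snd (\<xi> j)) \<le> T + 1" using b(2) comb_norm[OF k] by (simp add: \<beta>_def)
    have "l2norm (pdev n (snd (\<xi> j)) k) \<le> K * nrm n (snd (\<xi> j)) + 1" using kF j by (auto simp: F_def)
    also have "\<dots> \<le> K * (T + 1) + 1" using nb K(1) by (intro add_mono mult_left_mono) auto
    finally have pd: "l2norm (pdev n (snd (\<xi> j)) k) \<le> K * (T + 1) + 1" .
    have "l2norm (rem (\<beta> j)) \<le> C * l2norm (\<beta> j)" unfolding \<beta>_def by (rule rem_le) simp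
    also have "\<dots> \<le> C * (T + 1)" using b(2) C_nonneg by (intro mult_left_mono)
    finally have rd: "l2norm (rem (\<beta> j)) \<le> C * (T + 1)" .
    have te: "t j = s (\<xi> j) + pdev n (snd (\<xi> j)) k + rem (\<beta> j)"
    proof -
      have "snd (lift n (\<xi> j) k) = comb n (snd (\<xi> j)) k" by (simp add: lift_def)
      then show ?thesis unfolding t_def s_def \<beta>_def by (simp add: \<Lambda>_eq)
    qed
    have "l2norm (t j) \<le> (T + 1) + (K * (T + 1) + 1) + C * (T + 1)"
      unfolding te by (intro l2norm_add_le l2_add_mem s pdev_mem rem_mem b pd rd) (simp add: \<beta>_def)
    moreover have "t j \<in> l2" unfolding te by (intro l2_add_mem s pdev_mem rem_mem) (simp add: \<beta>_def)
    ultimately show "t j \<in> l2 \<and> l2norm (t j) \<le> (T + 1) + K * (T + 1) + 1 + C * (T + 1)" by simp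
  qed
  have W0: "0 \<le> (T + 1) + K * (T + 1) + 1 + C * (T + 1)" using T K(1) C_nonneg by simp
  obtain \<theta> where \<theta>: "\<theta> \<in> signs p" and th1: "l2norm (\<Sum>j<p. \<theta> j *\<^sub>c t j) \<le> sqrt p * W"
    and th2: "l2norm (\<Sum>j<p. \<theta> j *\<^sub>c \<beta> j) \<le> sqrt p * W"
    by (rule signs_exist_bounded[of p t "(T + 1) + K * (T + 1) + 1 + C * (T + 1)" \<beta> "T + 1"])
      (use t \<beta> W0 T in \<open>auto simp: W_def\<close>)
  define b where "b = snd (\<Xi> \<theta>)"
  have lift\<Xi>: "lift n (\<Xi> \<theta>) k = (\<Sum>j<p. pscale (\<theta> j) (lift n (\<xi> j) k))" unfolding \<Xi>_def by (rule lift_sum)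
  have cb: "comb n b k = (\<Sum>j<p. \<theta> j *\<^sub>c \<beta> j)"
  proof -
    have "comb n b k = snd (lift n (\<Xi> \<theta>) k)" by (simp add: lift_def b_def)
    also have "\<dots> = (\<Sum>j<p. \<theta> j *\<^sub>c \<beta> j)" unfolding lift\<Xi> by (simp add: snd_sum) (simp add: lift_def \<beta>_def)
    finally show ?thesis .
  qed
  have \<Lambda>b: "\<Lambda> b = (\<Sum>j<p. \<theta> j *\<^sub>c \<Lambda> (snd (\<xi> j)))"
  proof -
    have "\<Lambda> b = (\<Sum>i<n. \<Sum>j<p. (\<theta> j * snd (\<xi> j) i) *\<^sub>c pr (u (k i)))"
      by (simp add: \<Lambda>_def b_def \<Xi>_def snd_sum sum_fun_apply cscale_sum_left)
    also have "\<dots> = (\<Sum>j<p. \<Sum>i<n. (\<theta> j * snd (\<xi> j) i) *\<^sub>c pr (u (k i)))" by (rule sum.swap)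
    finally show ?thesis by (simp add: \<Lambda>_def cscale_sum)
  qed
  have se: "s (\<Xi> \<theta>) = (\<Sum>j<p. \<theta> j *\<^sub>c t j) - pdev n b k - rem (comb n b k)"
  proof -
    have "fst (lift n (\<Xi> \<theta>) k) = (\<Sum>j<p. \<theta> j *\<^sub>c t j) + \<Lambda> b"
      unfolding lift\<Xi> \<Lambda>b t_def by (simp add: fst_sum cscale_diff sum_subtractf)
    moreover have "snd (lift n (\<Xi> \<theta>) k) = comb n b k" by (simp add: lift_def b_def)
    ultimately show ?thesis unfolding s_def by (simp add: \<Lambda>_eq)
  qed
  have nb: "nrm n b \<le> sqrt p * W" using th2 comb_norm[OF k, of b] unfolding cb by simp
  have "l2norm (pdev n b k) \<le> K * nrm n b + 1" using kF \<theta> by (auto simp: F_def b_def)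
  also have "\<dots> \<le> K * (sqrt p * W) + 1" using nb K(1) by (intro add_mono mult_left_mono) auto
  finally have pd: "l2norm (pdev n b k) \<le> K * (sqrt p * W) + 1" .
  have "l2norm (rem (comb n b k)) \<le> C * nrm n b" using rem_le[of "comb n b k"] comb_norm[OF k] by simp
  also have "\<dots> \<le> C * (sqrt p * W)" using nb C_nonneg by (intro mult_left_mono)
  finally have rd: "l2norm (rem (comb n b k)) \<le> C * (sqrt p * W)" .
  have "l2norm (s (\<Xi> \<theta>)) \<le> sqrt p * W + (K * (sqrt p * W) + 1) + C * (sqrt p * W)"
    unfolding se using t by (intro l2norm_diff_le l2_diff l2_sum l2_cscale pdev_mem rem_mem comb_mem th1 pd rd) auto
  moreover have "l2norm (comb n b k) \<le> sqrt p * W" using th2 unfolding cb .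
  moreover have "\<bar>ztnorm \<Omega> (lift n (\<Xi> \<theta>) k) - tsm_norm (\<Xi> \<theta>)\<bar> < 1" using \<theta> by (intro kV) (auto simp: V_def)
  moreover have "1 \<le> sqrt p" using p by simp
  ultimately have "tsm_norm (\<Xi> \<theta>) \<le> sqrt p * W + (K * (sqrt p * W) + sqrt p) + C * (sqrt p * W) + sqrt p * W + sqrt p"
    unfolding lamn b_def by linarith
  \<comment> \<open>\<open>W\<close> twice, for the \<open>t j\<close> and for the second component;
    \<open>K * W\<close> and \<open>C * W\<close> for \<open>pdev\<close> and the remainder; 2 for
    the additive 1 of \<open>pdev\<close> and the limit error.\<close>
  also have "\<dots> = sqrt p * (W * (2 + K + C) + 2)" by (simp add: algebra_simps)
  finally show ?thesis using \<theta> unfolding \<Xi>_def by blast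
qed

text \<open>The unit vectors \<open>(0, e_j)\<close> of \<open>Z2\<close> have signed sums of norm
  at least \<open>sqrt p * ln (sqrt p)\<close> for all signs. Approximating them by images of
  \<open>S\<close> contradicts the order sqrt p that the model permits for some signs.\<close>

lemma near_case:
  assumes near: "\<And>\<eta> N0. \<eta> > 0 \<Longrightarrow> \<exists>i j. N0 \<le> i \<and> i < j \<and> l2norm (yvec i - yvec j) \<le> \<eta>"
  shows False
proof -
  obtain K where K: "0 \<le> K" "\<And>n F. finite F \<Longrightarrow> \<exists>\<^sub>F k in spread n. \<forall>b\<in>F. l2norm (pdev n b k) \<le> K * nrm n b + 1"
    by (rule near_pdev_bound, erule near, rule that)
  \<comment> \<open>18 = 9 * (1 + 1): quasi-triangle constant, unit norm, and approximation error at
    most 1.\<close>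
  define T where "T = 18 / m"
  have T: "0 \<le> T" using m_pos by (simp add: T_def)
  define W where "W = (T + 1) + K * (T + 1) + 1 + C * (T + 1) + (T + 1)"
  define R where "R = 9 * (M * (W * (2 + K + C) + 2) + 10)"
  obtain p where p: "p \<ge> 1" "R < ln (sqrt (real p))" using ln_sqrt_unbounded by blast
  define \<zeta> :: "nat \<Rightarrow> cseq \<times> cseq" where "\<zeta> j = (0, unit_vec j)" for j
  have kp0: "kalton_peck (unit_vec j) = 0" for j 
  proof
    have "unit_vec j i = of_bool (i = j)" for i by (simp add: unit_vec_def)
    then show "kalton_peck (unit_vec j) i = 0 i" for i by (simp add: kalton_peck_def)
  qed
  have \<zeta>: "\<zeta> j \<in> zspace kalton_peck" "ztnorm kalton_peck (\<zeta> j) = 1" for j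
    by (simp_all add: \<zeta>_def zspace_def ztnorm_def kp0)
  \<comment> \<open>Compensates the quadratic growth in \<open>ztnorm_sum_le\<close>, leaving a
    total approximation error of at most 10, the summand in \<open>R\<close>.\<close>
  define \<epsilon> where "\<epsilon> = 1 / (real p + 1)\<^sup>2"
  have \<epsilon>: "0 < \<epsilon>" "\<epsilon> \<le> 1" by (simp_all add: \<epsilon>_def add_nonneg_pos)
  have "\<forall>j. \<exists>v. v \<in> c00 \<times> c00 \<and> ztnorm kalton_peck (\<zeta> j - S v) \<le> \<epsilon>" using S_dense[OF \<zeta>(1) \<epsilon>(1)] by blast
  then obtain \<xi> where \<xi>: "\<And>j. \<xi> j \<in> c00 \<times> c00" "\<And>j. ztnorm kalton_peck (\<zeta> j - S (\<xi> j)) \<le> \<epsilon>" by metis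
  note Sm = S_mem[OF \<xi>(1)]
  have dm: "\<zeta> j - S (\<xi> j) \<in> zspace kalton_peck" for j by (rule kp.ztnorm_minus_le(1)[OF \<zeta>(1) Sm])
  have "tsm_norm (\<xi> j) \<le> T" for j
  proof -
    have "ztnorm kalton_peck (\<zeta> j - (\<zeta> j - S (\<xi> j))) \<le> (1 + 4 * 2) * (ztnorm kalton_peck (\<zeta> j) + ztnorm kalton_peck (\<zeta> j - S (\<xi> j)))"
      by (rule kp.ztnorm_minus_le(2)[OF \<zeta>(1) dm])
    also have "\<dots> \<le> (1 + 4 * 2) * (1 + 1)" using \<xi>(2)[of j] \<epsilon>(2) \<zeta>(2)[of j] by (intro mult_left_mono add_mono) auto
    finally have "ztnorm kalton_peck (S (\<xi> j)) \<le> 18" by simp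
    then have "m * tsm_norm (\<xi> j) \<le> 18" using S_lower[OF \<xi>(1)[of j]] by linarith
    then show ?thesis using m_pos by (simp add: T_def field_simps)
  qed
  then obtain \<theta> where \<theta>: "\<theta> \<in> signs p" and le: "tsm_norm (\<Sum>j<p. pscale (\<theta> j) (\<xi> j)) \<le> sqrt p * (W * (2 + K + C) + 2)"
    using near_type_two[OF K, of p \<xi> T] \<xi>(1) T p(1) unfolding W_def by blast
  define Z1 where "Z1 = (\<Sum>j<p. pscale (\<theta> j) (S (\<xi> j)))"
  define Z2' where "Z2' = (\<Sum>j<p. pscale (\<theta> j) (\<zeta> j - S (\<xi> j)))"
  have "ztnorm kalton_peck Z1 \<le> M * (sqrt p * (W * (2 + K + C) + 2))"
  proof -
    have "Z1 = S (\<Sum>j<p. pscale (\<theta> j) (\<xi> j))" unfolding Z1_def using \<xi>(1) by (simp add: S_sum)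
    then have "ztnorm kalton_peck Z1 \<le> M * tsm_norm (\<Sum>j<p. pscale (\<theta> j) (\<xi> j))" using S_upper[OF V_sum] \<xi>(1) by simp
    also have "\<dots> \<le> M * (sqrt p * (W * (2 + K + C) + 2))" using le M_pos by (intro mult_left_mono) auto
    finally show ?thesis .
  qed
  moreover have "ztnorm kalton_peck Z2' \<le> 10"
  proof -
    have "ztnorm kalton_peck Z2' \<le> real p * ((2 + 4 * 2 * real p) * \<epsilon>)"
      unfolding Z2'_def using dm \<xi>(2) signs_norm[OF \<theta>] \<epsilon>(1) by (intro kp.ztnorm_sum_le) auto
    also have "\<dots> \<le> (real p + 1) * ((10 * (real p + 1)) * \<epsilon>)"
      using \<epsilon>(1) by (intro mult_mono) auto
    also have "\<dots> = 10 * ((real p + 1)\<^sup>2 * \<epsilon>)" by (simp add: power2_eq_square)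
    also have "(real p + 1)\<^sup>2 * \<epsilon> = 1" by (simp add: \<epsilon>_def add_nonneg_eq_0_iff)
    finally show ?thesis by simp
  qed
  moreover have "1 \<le> sqrt p" using p(1) by simp
  moreover have m12: "Z1 \<in> zspace kalton_peck" "Z2' \<in> zspace kalton_peck"
    unfolding Z1_def Z2'_def using Sm dm by (auto intro!: kp.zspace_sum kp.ztnorm_pscale)
  then have "ztnorm kalton_peck (Z1 + Z2') \<le> 9 * (ztnorm kalton_peck Z1 + ztnorm kalton_peck Z2')"
    using kp.ztnorm_add(2)[OF m12] by simp
  moreover have "9 * (ztnorm kalton_peck Z1 + ztnorm kalton_peck Z2') \<le> 9 * (M * (sqrt p * (W * (2 + K + C) + 2)) + 10 * sqrt p)"
  proof (intro mult_left_mono add_mono)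
    show "ztnorm kalton_peck Z2' \<le> 10 * sqrt p" using calculation(2,3) by linarith
  qed (use calculation(1) in auto)
  ultimately have "ztnorm kalton_peck (Z1 + Z2') \<le> 9 * (M * (sqrt p * (W * (2 + K + C) + 2)) + 10 * sqrt p)"
    by linarith
  also have "\<dots> = sqrt p * R" by (simp add: R_def algebra_simps)
  finally have up: "ztnorm kalton_peck (Z1 + Z2') \<le> sqrt p * R" .
  have "Z1 + Z2' = (\<Sum>j<p. pscale (\<theta> j) (\<zeta> j))"
    unfolding Z1_def Z2'_def sum.distrib[symmetric] by (intro sum.cong refl) (simp add: prod_eq_iff cscale_diff)
  then have Ze: "Z1 + Z2' = (0, \<Sum>j<p. \<theta> j *\<^sub>c unit_vec j)"
    by (simp add: prod_eq_iff fst_sum snd_sum \<zeta>_def)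
  have "disj_supp p unit_vec" by (auto simp: disj_supp_def supp_def unit_vec_def)
  then have "sqrt p * 1 * ln (sqrt p * 1 / 1) \<le> l2norm (kalton_peck (\<Sum>j<p. \<theta> j *\<^sub>c unit_vec j) - (\<Sum>j<p. \<theta> j *\<^sub>c kalton_peck (unit_vec j)))"
    using signs_norm[OF \<theta>] p(1) by (intro kalton_peck_disj_sum) auto
  also have "\<dots> = l2norm (fst (Z1 + Z2') - kalton_peck (snd (Z1 + Z2')))"
    unfolding Ze by (simp add: kp0)
  also have "\<dots> \<le> ztnorm kalton_peck (Z1 + Z2')"
    using kp.ztnorm_add(1)[OF m12] by (simp add: ztnorm_def zspace_def)
  finally have "sqrt p * ln (sqrt p) \<le> sqrt p * R" using up by simp
  then show False using p by (simp add: mult_le_cancel_left_pos)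
qed

text \<open>Either arbitrarily late second components come arbitrarily close, or they are uniformly
  separated from some index on; both are incompatible with small deviation for infinitely many
  \<open>N\<close>.\<close>

theorem pdev_unbounded: "\<exists>N0. \<forall>N\<ge>N0. \<forall>\<^sub>F k in spread N. B * sqrt N < l2norm (pdev N (\<lambda>_. 1) k)"
proof (rule ccontr)
  assume "\<not> ?thesis"
  then have freq: "\<exists>N\<ge>N1. \<exists>\<^sub>F k in spread N. l2norm (pdev N (\<lambda>_. 1) k) \<le> B * sqrt N" for N1
    by (simp add: not_eventually not_less)
  show False
  proof (cases "\<forall>\<eta>>0. \<forall>N0. \<exists>i j. N0 \<le> i \<and> i < j \<and> l2norm (yvec i - yvec j) \<le> \<eta>")
    case True
    then show False using near_case by blast
  next
    case False
    then obtain \<delta> N0 where \<delta>: "\<delta> > 0" and "\<And>i j. N0 \<le> i \<Longrightarrow> i < j \<Longrightarrow> \<delta> < l2norm (yvec i - yvec j)"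
      by (meson not_le)
    then show False using separated_case[OF \<delta>, of N0 B] freq by (meson less_imp_le)
  qed
qed

end

section \<open>Maximality\<close>

lemma (in centr_model) pdev_unbounded_of_isomorphic:
  assumes "isomorphic (twisted_spreading_model \<Omega> u) Z2"
  shows "\<exists>N0. \<forall>N\<ge>N0. \<forall>\<^sub>F k in spread N. B * sqrt N < l2norm (pdev N (\<lambda>_. 1) k)"
proof -
  have iso: "isomorphic (completion qn.X) Z2" using assms unfolding model_eq .
  show ?thesis
  proof (rule qn.dense_embedding[OF iso])
    fix S :: "cseq \<times> cseq \<Rightarrow> cseq \<times> cseq" and m M :: real
    assume S: "0 < m" "0 < M"
      "\<And>v. v \<in> c00 \<times> c00 \<Longrightarrow> S v \<in> zspace kalton_peck"
      "\<And>v w. v \<in> c00 \<times> c00 \<Longrightarrow> w \<in> c00 \<times> c00 \<Longrightarrow> S (v + w) = S v + S w"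
      "\<And>c v. v \<in> c00 \<times> c00 \<Longrightarrow> S (pscale c v) = pscale c (S v)"
      "\<And>v. v \<in> c00 \<times> c00 \<Longrightarrow> m * tsm_norm v \<le> ztnorm kalton_peck (S v)"
      "\<And>v. v \<in> c00 \<times> c00 \<Longrightarrow> ztnorm kalton_peck (S v) \<le> M * tsm_norm v"
      "\<And>z e. z \<in> zspace kalton_peck \<Longrightarrow> 0 < e \<Longrightarrow> \<exists>v\<in>c00 \<times> c00. ztnorm kalton_peck (z - S v) \<le> e"
    interpret model_embedding \<Omega> C u S m M
      by unfold_locales (fact S)+
    show ?thesis by (rule pdev_unbounded)
  qed
qed

text \<open>The deviation converges along far tuples, so it suffices to bound it for the good ones.\<close>

lemma (in centr_model) dev_unbounded:
  assumes "isomorphic (twisted_spreading_model \<Omega> u) Z2"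
  obtains \<nu> :: "nat \<Rightarrow> nat" where
    "\<And>B. \<exists>N0. \<forall>N\<ge>N0. \<forall>k\<in>incr_tuples N {\<nu> N<..}. B * sqrt N \<le> l2norm (dev N (\<lambda>_. 1) k)"
proof -
  define g where "g N = tsm_norm (xvec N (\<lambda>_. 1) id)" for N
  have nrm1: "nrm N (\<lambda>_. 1) = sqrt N" for N by (rule nrm_unimodular) simp
  have "\<forall>\<^sub>F k in spread N. \<bar>l2norm (dev N (\<lambda>_. 1) k) + l2norm (comb N (\<lambda>_. 1) k) - g N\<bar> < 1" for N
    using tendstoD[OF tsm_norm_xvec[of N id "\<lambda>_. 1"], of 1] by (simp add: dist_real_def strict_mono_on_def g_def)
  \<comment> \<open>\<open>\<nu>\<close> is fixed by the limit alone, before any bound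
    \<open>B\<close> is given, as the definition of maximality requires.\<close>
  then have "\<forall>N. \<exists>\<nu>. \<forall>k\<in>incr_tuples N {\<nu><..}. \<bar>l2norm (dev N (\<lambda>_. 1) k) + l2norm (comb N (\<lambda>_. 1) k) - g N\<bar> < 1"
    unfolding eventually_spread by blast
  then obtain \<nu> where "\<And>N k. k \<in> incr_tuples N {\<nu> N<..} \<Longrightarrow> \<bar>l2norm (dev N (\<lambda>_. 1) k) + l2norm (comb N (\<lambda>_. 1) k) - g N\<bar> < 1"
    by metis
  then have \<nu>: "\<bar>l2norm (dev N (\<lambda>_. 1) k) + sqrt N - g N\<bar> < 1" if "k \<in> incr_tuples N {\<nu> N<..}" for N k
    using that comb_norm[OF that, of "\<lambda>_. 1"] nrm1[of N] by metis
  show ?thesis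
  proof (rule that[of \<nu>])
    fix B
    \<comment> \<open>\<open>C + 1\<close> is lost to \<open>pdev_le\<close>, and 2 in comparing an
      arbitrary far tuple with a good one, each lying within 1 of the limit.\<close>
    obtain N0 where N0: "\<And>N. N \<ge> N0 \<Longrightarrow> \<forall>\<^sub>F k in spread N. (B + C + 3) * sqrt N < l2norm (pdev N (\<lambda>_. 1) k)"
      using pdev_unbounded_of_isomorphic[OF assms] by blast
    have "B * sqrt N \<le> l2norm (dev N (\<lambda>_. 1) k)" if N: "N \<ge> max N0 1" and k: "k \<in> incr_tuples N {\<nu> N<..}" for N k
    proof -
      obtain \<mu> where \<mu>: "\<And>k. k \<in> incr_tuples N {\<mu><..} \<Longrightarrow> (B + C + 3) * sqrt N < l2norm (pdev N (\<lambda>_. 1) k)"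
        using N0[of N] N unfolding eventually_spread by auto
      obtain l where l: "l \<in> incr_tuples N {max \<mu> (\<nu> N)<..}" "good N l" using good_exists by blast
      have l': "l \<in> incr_tuples N {\<mu><..}" "l \<in> incr_tuples N {\<nu> N<..}" using l(1) by (auto simp: incr_tuples_def)
      have "(B + C + 3) * sqrt N < l2norm (dev N (\<lambda>_. 1) l) + (C + 1) * sqrt N"
        using \<mu>[OF l'(1)] pdev_le[OF l, of "\<lambda>_. 1"] unfolding nrm1 by linarith
      then have "B * sqrt N + 2 * sqrt N < l2norm (dev N (\<lambda>_. 1) l)" by (simp add: algebra_simps)
      moreover have "1 \<le> sqrt N" using N by simp
      ultimately show ?thesis using \<nu>[OF k] \<nu>[OF l'(2)] by linarith
    qed
    then show "\<exists>N0. \<forall>N\<ge>N0. \<forall>k\<in>incr_tuples N {\<nu> N<..}. B * sqrt N \<le> l2norm (dev N (\<lambda>_. 1) k)" by blast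
  qed
qed

lemma supp_cscale_eq: "c \<noteq> 0 \<Longrightarrow> supp (c *\<^sub>c x) = supp x"
  by (auto simp: supp_def)

lemma blocks_cscale: "blocks u \<Longrightarrow> (\<And>j. c j \<noteq> 0) \<Longrightarrow> blocks (\<lambda>j. c j *\<^sub>c u j)"
  unfolding blocks_def c00_def by (simp add: supp_cscale_eq)

lemma normalize_blocks:
  assumes "blocks u" "\<And>j. u j \<in> l2" "\<And>j. 0 < l2norm (u j)"
  shows "normalized_blocks (\<lambda>j. complex_of_real (1 / l2norm (u j)) *\<^sub>c u j)"
  unfolding normalized_blocks_def
proof (intro conjI allI)
  show "blocks (\<lambda>j. complex_of_real (1 / l2norm (u j)) *\<^sub>c u j)"
    using assms(3) by (intro blocks_cscale assms(1)) (simp add: less_imp_neq[symmetric])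
  show "l2norm (complex_of_real (1 / l2norm (u j)) *\<^sub>c u j) = 1" for j
    using assms(2,3)[of j] by (simp add: l2norm_cscale norm_divide)
qed

text \<open>The sum of rescaled blocks is \<open>a * x\<close> for a multiplier \<open>a\<close>
  equal to \<open>\<mu> (k j)\<close> on each block. Since \<open>\<Omega> (u (k j))\<close> may
  leave its block, \<open>a\<close> has to be nearly constant everywhere; this is why the factors
  must agree up to \<open>1 / (n + 1)\<close>, so that \<open>n\<close> remainders contribute only
  \<open>2 * C\<close>.\<close>

lemma (in centr_model) dev_rescaled:
  assumes k: "k \<in> incr_tuples n N" and c0: "0 < c0" and n: "n \<ge> 1"
    and \<mu>: "\<And>j. j < n \<Longrightarrow> c0 \<le> \<mu> (k j)" "\<And>j. j < n \<Longrightarrow> \<mu> (k j) \<le> D" and \<mu>0: "c0 \<le> \<mu>0" "\<mu>0 \<le> D"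
    and near: "\<And>j. j < n \<Longrightarrow> \<bar>\<mu> (k j) - \<mu>0\<bar> \<le> 1 / (real n + 1)"
  shows "c0 * l2norm (dev n (\<lambda>_. 1) k) - C * D * sqrt n - 2 * C
    \<le> l2norm (\<Omega> (\<Sum>j<n. complex_of_real (\<mu> (k j)) *\<^sub>c u (k j)) - (\<Sum>j<n. \<Omega> (complex_of_real (\<mu> (k j)) *\<^sub>c u (k j))))"
proof -
  define \<mu>' where "\<mu>' j = complex_of_real (\<mu> (k j))" for j
  \<comment> \<open>Disjointness makes the index unique. The value \<open>\<mu>0\<close> off the
    blocks, instead of 0, keeps \<open>a\<close> bounded below by \<open>c0\<close>, so that
    \<open>a * dev\<close> controls \<open>dev\<close>.\<close>
  define a :: cseq where "a i = (if \<exists>l<n. i \<in> supp (u (k l)) then \<mu>' (THE l. l < n \<and> i \<in> supp (u (k l))) else complex_of_real \<mu>0)" for i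
  have a1: "a i = \<mu>' l" if "l < n" "i \<in> supp (u (k l))" for i l
  proof -
    have "(THE l. l < n \<and> i \<in> supp (u (k l))) = l"
      by (rule the_equality) (use that tuple_disj(1)[OF k] in blast)+
    then show ?thesis unfolding a_def using that by auto
  qed
  have a2: "a i = complex_of_real \<mu>0" if "\<not> (\<exists>l<n. i \<in> supp (u (k l)))" for i
    unfolding a_def using that by auto
  have acase: "(\<exists>l<n. a i = complex_of_real (\<mu> (k l))) \<or> a i = complex_of_real \<mu>0" for i
    using a1 a2 unfolding \<mu>'_def by metis
  have aD: "\<forall>i. cmod (a i) \<le> D" and ac: "\<And>i. c0 \<le> cmod (a i)"
    using acase \<mu> \<mu>0 c0 by (metis abs_of_pos less_le_trans norm_of_real)+
  have an: "cmod ((a - (\<lambda>_. \<mu>' j)) i) \<le> 2 / (real n + 1)" if j: "j < n" for i j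
  proof -
    have "cmod (a i - complex_of_real \<mu>0) \<le> 1 / (real n + 1)"
      using acase[of i] near by (auto simp: of_real_diff[symmetric] simp del: of_real_diff)
    moreover have "cmod (complex_of_real \<mu>0 - \<mu>' j) \<le> 1 / (real n + 1)"
      using near[OF j] by (simp add: \<mu>'_def of_real_diff[symmetric] abs_minus_commute del: of_real_diff)
    ultimately have "cmod ((a i - complex_of_real \<mu>0) + (complex_of_real \<mu>0 - \<mu>' j)) \<le> 1 / (real n + 1) + 1 / (real n + 1)"
      by (rule norm_triangle_mono)
    then show ?thesis by simp
  qed
  define x where "x = comb n (\<lambda>_. 1) k"
  have ax: "a * x = (\<Sum>j<n. \<mu>' j *\<^sub>c u (k j))"
  proof -
    have "a * u (k j) = \<mu>' j *\<^sub>c u (k j)" if "j < n" for j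
    proof
      fix i show "(a * u (k j)) i = (\<mu>' j *\<^sub>c u (k j)) i"
        using a1[OF that, of i] by (cases "u (k j) i = 0") (auto simp: supp_def)
    qed
    then have "(\<Sum>j<n. a * u (k j)) = (\<Sum>j<n. \<mu>' j *\<^sub>c u (k j))" by (intro sum.cong) auto
    then show ?thesis by (simp add: x_def comb_def sum_distrib_left)
  qed
  define r where "r j = (a - (\<lambda>_. \<mu>' j)) * rem (u (k j))" for j
  \<comment> \<open>The factor vanishes on the block itself, where \<open>pr\<close> lives, so only
    the remainder survives.\<close>
  have r: "(a - (\<lambda>_. \<mu>' j)) * \<Omega> (u (k j)) = r j" if j: "j < n" for j
  proof
    fix i
    have "(a i - \<mu>' j) * pr (u (k j)) i = 0"
      using a1[OF j, of i] supp_pr[of "u (k j)"] by (cases "pr (u (k j)) i = 0") (auto simp: supp_def)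
    then show "((a - (\<lambda>_. \<mu>' j)) * \<Omega> (u (k j))) i = r j i"
      unfolding r_def Om_split[of "u (k j)"] by (simp add: algebra_simps)
  qed
  have rm: "r j \<in> l2" "l2norm (r j) \<le> 2 / (real n + 1) * C" if j: "j < n" for j
  proof -
    show "r j \<in> l2" unfolding r_def by (rule l2_mult[OF rem_mem[OF u_l2] an[OF j]])
    have "l2norm (r j) \<le> 2 / (real n + 1) * l2norm (rem (u (k j)))"
      unfolding r_def by (rule l2_mult[OF rem_mem[OF u_l2] an[OF j]])
    also have "\<dots> \<le> 2 / (real n + 1) * C" using rem_le[of "u (k j)"] by (intro mult_left_mono) auto
    finally show "l2norm (r j) \<le> 2 / (real n + 1) * C" .
  qed
  have "l2norm (\<Sum>j<n. r j) \<le> (\<Sum>j<n. l2norm (r j))" using rm by (intro l2norm_sum) auto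
  also have "\<dots> \<le> (\<Sum>j<n. 2 / (real n + 1) * C)" using rm by (intro sum_mono) auto
  also have "\<dots> = (n / (real n + 1)) * (2 * C)" by simp
  also have "\<dots> \<le> 1 * (2 * C)" using C_nonneg by (intro mult_right_mono) auto
  finally have Rn: "l2norm (\<Sum>j<n. r j) \<le> 2 * C" by simp
  define E where "E = \<Omega> (a * x) - a * \<Omega> x"
  have x: "x \<in> l2" "l2norm x = sqrt n"
    unfolding x_def using comb_norm[OF k, of "\<lambda>_. 1"] nrm_unimodular[of n "\<lambda>_. 1"] by simp_all
  have E: "E \<in> l2" "l2norm E \<le> C * D * sqrt n"
    unfolding E_def using mult_mem[OF x(1) aD] mult_le[OF x(1) aD] x(2) by simp_all
  define G where "G = \<Omega> (\<Sum>j<n. \<mu>' j *\<^sub>c u (k j)) - (\<Sum>j<n. \<Omega> (\<mu>' j *\<^sub>c u (k j)))"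
  have e: "G = E + a * dev n (\<lambda>_. 1) k + (\<Sum>j<n. r j)"
  proof -
    have "(\<Sum>j<n. r j) = (\<Sum>j<n. a * \<Omega> (u (k j)) - \<mu>' j *\<^sub>c \<Omega> (u (k j)))"
      by (intro sum.cong refl) (simp add: r[symmetric] fun_eq_iff algebra_simps)
    also have "\<dots> = a * (\<Sum>j<n. \<Omega> (u (k j))) - (\<Sum>j<n. \<Omega> (\<mu>' j *\<^sub>c u (k j)))"
      by (simp add: sum_subtractf sum_distrib_left hom)
    finally show ?thesis
      unfolding G_def E_def ax[symmetric] dev_def x_def[symmetric] by (simp add: right_diff_distrib)
  qed
  have S: "(\<Sum>j<n. r j) \<in> l2" using rm by auto
  have ad: "a * dev n (\<lambda>_. 1) k \<in> l2" by (rule l2_mult(1)[OF dev_mem aD[rule_format]])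
  have pw: "cmod (dev n (\<lambda>_. 1) k i) \<le> 1 / c0 * cmod ((a * dev n (\<lambda>_. 1) k) i)" for i
  proof -
    have "c0 * cmod (dev n (\<lambda>_. 1) k i) \<le> cmod (a i) * cmod (dev n (\<lambda>_. 1) k i)" using ac by (intro mult_right_mono) auto
    then show ?thesis using c0 by (simp add: norm_mult field_simps)
  qed
  have "l2norm (dev n (\<lambda>_. 1) k) \<le> 1 / c0 * l2norm (a * dev n (\<lambda>_. 1) k)"
    by (rule l2_mono(2)[OF ad _ pw]) (use c0 in simp)
  then have 1: "c0 * l2norm (dev n (\<lambda>_. 1) k) \<le> l2norm (a * dev n (\<lambda>_. 1) k)" using c0 by (simp add: field_simps)
  have Gm: "G \<in> l2" unfolding e using E ad S by simp
  have "a * dev n (\<lambda>_. 1) k = G - E - (\<Sum>j<n. r j)" unfolding e by simp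
  moreover have "l2norm (G - E - (\<Sum>j<n. r j)) \<le> l2norm G + C * D * sqrt n + 2 * C"
    using Gm E S Rn by (intro l2norm_diff_le l2_diff order_refl)
  ultimately have "l2norm (a * dev n (\<lambda>_. 1) k) \<le> l2norm G + C * D * sqrt n + 2 * C" by metis
  then show ?thesis using 1 unfolding G_def \<mu>'_def by linarith
qed

theorem maximal_of_models:
  assumes \<Omega>: "centr \<Omega> C"
    and limits: "\<And>u. normalized_blocks u \<Longrightarrow> \<exists>r. strict_mono r \<and> tsm_limits_exist \<Omega> (u \<circ> r)"
    and models: "\<And>u. normalized_blocks u \<Longrightarrow> tsm_limits_exist \<Omega> u \<Longrightarrow> isomorphic (twisted_spreading_model \<Omega> u) Z2"
  shows "maximal \<Omega>"
  unfolding maximal_def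
proof (intro allI impI)
  fix u assume u: "seminormalized_blocks u"
  define \<mu> where "\<mu> j = l2norm (u j)" for j
  define c0 where "c0 = (INF j. l2norm (u j))"
  have ub: "blocks u" and c0: "0 < c0" and bd: "bdd_above (range (\<lambda>j. l2norm (u j)))"
    using u by (auto simp: seminormalized_blocks_def c0_def)
  have ul: "u j \<in> l2" for j using ub by (simp add: blocks_def)
  obtain D where D: "\<And>j. \<mu> j \<le> D" using bd by (auto simp: bdd_above_def \<mu>_def)
  have "bdd_below (range (\<lambda>j. l2norm (u j)))" by (rule bdd_belowI2[of _ 0]) (simp add: ul)
  then have c\<mu>: "c0 \<le> \<mu> j" for j unfolding c0_def \<mu>_def by (intro cINF_lower) auto
  define v where "v j = complex_of_real (1 / l2norm (u j)) *\<^sub>c u j" for j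
  have v: "normalized_blocks v"
    unfolding v_def using c\<mu> c0 by (intro normalize_blocks ub ul) (auto simp: \<mu>_def intro: less_le_trans)
  have uv: "u j = complex_of_real (\<mu> j) *\<^sub>c v j" for j
  proof -
    have "\<mu> j \<noteq> 0" using c\<mu>[of j] c0 by linarith
    then show ?thesis unfolding v_def \<mu>_def[symmetric] by simp
  qed
  obtain r1 where r1: "strict_mono r1" "tsm_limits_exist \<Omega> (v \<circ> r1)" using limits[OF v] by blast
  have "\<bar>\<mu> (r1 j)\<bar> \<le> D" for j using c\<mu>[of "r1 j"] c0 D[of "r1 j"] by linarith
  then have "bounded (range (\<lambda>j. \<mu> (r1 j)))" by (auto simp: bounded_iff)
  \<comment> \<open>A further subsequence makes the norms of the blocks converge, which provides the
    near equality of factors needed for \<open>dev_rescaled\<close>.\<close>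
  then obtain \<mu>0 r2 where r2: "strict_mono r2" "((\<lambda>j. \<mu> (r1 j)) \<circ> r2) \<longlonglongrightarrow> \<mu>0"
    using bounded_imp_convergent_subsequence by blast
  define r where "r = r1 \<circ> r2"
  have r: "strict_mono r" unfolding r_def using r1(1) r2(1) by (rule strict_mono_o)
  have \<mu>lim: "(\<lambda>j. \<mu> (r j)) \<longlonglongrightarrow> \<mu>0" using r2(2) by (simp add: r_def comp_def)
  have \<mu>0: "c0 \<le> \<mu>0" "\<mu>0 \<le> D"
    using LIMSEQ_le_const[OF \<mu>lim, of c0] LIMSEQ_le_const2[OF \<mu>lim, of D] c\<mu> D by auto
  have lv: "tsm_limits_exist \<Omega> (v \<circ> r)"
    using tsm_limits_exist_subseq[OF r1(2) r2(1)] by (simp add: r_def comp_assoc)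
  have nv: "normalized_blocks (v \<circ> r)" using normalized_blocks_subseq[OF v r] .
  interpret centr \<Omega> C by fact
  interpret centr_model \<Omega> C "v \<circ> r" by unfold_locales (fact nv lv)+
  obtain \<nu>1 :: "nat \<Rightarrow> nat" where \<nu>1: "\<And>B. \<exists>N0. \<forall>N\<ge>N0. \<forall>k\<in>incr_tuples N {\<nu>1 N<..}. B * sqrt N \<le> l2norm (dev N (\<lambda>_. 1) k)"
    using that by (rule dev_unbounded[OF models[OF nv lv]])
  have "\<forall>n. \<exists>K. \<forall>j\<ge>K. \<bar>\<mu> (r j) - \<mu>0\<bar> < 1 / (real n + 1)"
  proof
    fix n :: nat
    have "0 < 1 / (real n + 1)" by (simp add: add_nonneg_pos)
    from LIMSEQ_D[OF \<mu>lim this] show "\<exists>K. \<forall>j\<ge>K. \<bar>\<mu> (r j) - \<mu>0\<bar> < 1 / (real n + 1)" by simp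
  qed
  then obtain \<nu>2 :: "nat \<Rightarrow> nat" where \<nu>2: "\<And>n j. \<nu>2 n \<le> j \<Longrightarrow> \<bar>\<mu> (r j) - \<mu>0\<bar> < 1 / (real n + 1)" by metis
  \<comment> \<open>\<open>Suc\<close> reconciles the strict bound of \<open>spread\<close> with the
    weak bound in the definition of maximality.\<close>
  define \<nu> where "\<nu> n = max (Suc (\<nu>1 n)) (\<nu>2 n)" for n
  have "filterlim (\<lambda>n. INF k\<in>incr_tuples n {\<nu> n..}.
      l2norm (\<Omega> (\<Sum>j<n. (u \<circ> r) (k j)) - (\<Sum>j<n. \<Omega> ((u \<circ> r) (k j)))) / sqrt (real n)) at_top sequentially"
    unfolding filterlim_at_top
  proof
    fix Z
    \<comment> \<open>Solves the estimate of \<open>dev_rescaled\<close> for a quotient of at least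
      \<open>Z\<close>, with \<open>2 * C \<le> 2 * C * sqrt n\<close>.\<close>
    define B where "B = (Z + C * D + 2 * C) / c0"
    obtain N0 where N0: "\<And>N k. N \<ge> N0 \<Longrightarrow> k \<in> incr_tuples N {\<nu>1 N<..} \<Longrightarrow> B * sqrt N \<le> l2norm (dev N (\<lambda>_. 1) k)"
      using \<nu>1[of B] by blast
    have "Z \<le> (INF k\<in>incr_tuples n {\<nu> n..}.
      l2norm (\<Omega> (\<Sum>j<n. (u \<circ> r) (k j)) - (\<Sum>j<n. \<Omega> ((u \<circ> r) (k j)))) / sqrt (real n))" if n: "n \<ge> max N0 1" for n
    proof (rule cINF_greatest)
      show "incr_tuples n {\<nu> n..} \<noteq> {}" using incr_tuples_shift(1) by blast
      fix k assume k: "k \<in> incr_tuples n {\<nu> n..}"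
      have k1: "k \<in> incr_tuples n {\<nu>1 n<..}" using k unfolding incr_tuples_def \<nu>_def by fastforce
      have kj: "\<nu>2 n \<le> k j" if "j < n" for j using k that by (auto simp: incr_tuples_def \<nu>_def image_subset_iff)
      define G where "G = l2norm (\<Omega> (\<Sum>j<n. (u \<circ> r) (k j)) - (\<Sum>j<n. \<Omega> ((u \<circ> r) (k j))))"
      have "c0 * l2norm (dev n (\<lambda>_. 1) k) - C * D * sqrt n - 2 * C
        \<le> l2norm (\<Omega> (\<Sum>j<n. complex_of_real ((\<mu> \<circ> r) (k j)) *\<^sub>c (v \<circ> r) (k j)) - (\<Sum>j<n. \<Omega> (complex_of_real ((\<mu> \<circ> r) (k j)) *\<^sub>c (v \<circ> r) (k j))))"
        by (rule dev_rescaled[OF k1 c0 _ _ _ \<mu>0]) (use n c\<mu> D \<nu>2 kj in \<open>auto intro: less_imp_le\<close>)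
      also have "\<dots> = G" unfolding G_def by (simp add: uv)
      finally have G: "c0 * l2norm (dev n (\<lambda>_. 1) k) - C * D * sqrt n - 2 * C \<le> G" .
      have s1: "1 \<le> sqrt n" using n by simp
      have "(Z + C * D + 2 * C) * sqrt n = c0 * (B * sqrt n)" using c0 by (simp add: B_def)
      also have "\<dots> \<le> c0 * l2norm (dev n (\<lambda>_. 1) k)" using c0 N0[OF _ k1] n by (intro mult_left_mono) auto
      finally have "Z * sqrt n + C * D * sqrt n + 2 * C * sqrt n \<le> G + C * D * sqrt n + 2 * C" using G by (simp add: algebra_simps)
      moreover have "2 * C * 1 \<le> 2 * C * sqrt n" using s1 C_nonneg by (intro mult_left_mono) auto
      ultimately have "Z * sqrt n \<le> G" by linarith
      then show "Z \<le> l2norm (\<Omega> (\<Sum>j<n. (u \<circ> r) (k j)) - (\<Sum>j<n. \<Omega> ((u \<circ> r) (k j)))) / sqrt (real n)"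
        unfolding G_def[symmetric] using s1 by (simp add: pos_le_divide_eq)
    qed
    then show "\<forall>\<^sub>F n in sequentially. Z \<le> (INF k\<in>incr_tuples n {\<nu> n..}.
      l2norm (\<Omega> (\<Sum>j<n. (u \<circ> r) (k j)) - (\<Sum>j<n. \<Omega> ((u \<circ> r) (k j)))) / sqrt (real n))"
      unfolding eventually_sequentially by blast
  qed
  then show "\<exists>r. strict_mono r \<and> (let u' = u \<circ> r in \<exists>\<nu> :: nat \<Rightarrow> nat.
      filterlim (\<lambda>n. INF k\<in>incr_tuples n {\<nu> n..}.
         l2norm (\<Omega> (\<Sum>j<n. u' (k j)) - (\<Sum>j<n. \<Omega> (u' (k j)))) / sqrt (real n)) at_top sequentially)"
    unfolding Let_def using r by blast
qed

section \<open>Upper l2-estimates and cutting into blocks\<close>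

lemma l2norm_sum_unit_vec:
  assumes "inj_on r {..<n}" shows "l2norm (\<Sum>j<n. c j *\<^sub>c unit_vec (r j)) = nrm n c"
proof -
  have "disj_supp n (\<lambda>j. unit_vec (r j))"
    using assms by (auto simp: disj_supp_def supp_def unit_vec_def dest: inj_onD)
  then have "(l2norm (\<Sum>j<n. c j *\<^sub>c unit_vec (r j)))\<^sup>2 = (\<Sum>j<n. (l2norm (c j *\<^sub>c unit_vec (r j)))\<^sup>2)"
    by (intro l2norm_disj_sum disj_cscale) auto
  also have "\<dots> = (nrm n c)\<^sup>2" unfolding nrm_sq by (simp add: l2norm_cscale)
  finally show ?thesis by (simp add: power2_eq_iff_nonneg l2_sum)
qed

text \<open>Testing the upper estimate with the conjugates of the i-th coordinates bounds their
  square sums by \<open>M\<^sup>2\<close>, so they even form a square-summable sequence.\<close>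

lemma coordinates_null:
  fixes x :: "nat \<Rightarrow> cseq"
  assumes x: "\<And>j. x j \<in> l2" and M: "\<And>n c. l2norm (\<Sum>j<n. c j *\<^sub>c x j) \<le> M * nrm n c"
  shows "(\<lambda>j. x j i) \<longlonglongrightarrow> 0"
proof -
  have M0: "0 \<le> M"
  proof -
    have "0 \<le> l2norm (\<Sum>j<1. 1 *\<^sub>c x j)" using x by simp
    also have "\<dots> \<le> M * nrm 1 (\<lambda>_. 1)" using M[where n = 1 and c = "\<lambda>_. 1"] by simp
    finally show ?thesis by (simp add: nrm_unimodular)
  qed
  have le: "nrm n (\<lambda>j. x j i) \<le> M" for n
  proof -
    define c where "c j = cnj (x j i)" for j
    have nc: "nrm n c = nrm n (\<lambda>j. x j i)" by (simp add: nrm_def c_def)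
    have "c j * x j i = complex_of_real ((cmod (x j i))\<^sup>2)" for j
      unfolding c_def complex_norm_square by (rule mult.commute)
    then have "(\<Sum>j<n. c j *\<^sub>c x j) i = (\<Sum>j<n. complex_of_real ((cmod (x j i))\<^sup>2))"
      by (simp add: sum_fun_apply)
    also have "\<dots> = complex_of_real ((nrm n c)\<^sup>2)" unfolding nc nrm_sq by simp
    finally have "cmod ((\<Sum>j<n. c j *\<^sub>c x j) i) = (nrm n c)\<^sup>2" by (simp add: norm_power)
    then have "(nrm n c)\<^sup>2 \<le> M * nrm n c"
      using l2_coord[OF l2_sum, of "{..<n}" "\<lambda>j. c j *\<^sub>c x j" i] x M[where n = n and c = c] by simp
    then have "nrm n c * nrm n c \<le> M * nrm n c" by (simp add: power2_eq_square)
    then show ?thesis unfolding nc[symmetric] using M0 nrm_nonneg[of n c]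
      by (cases "nrm n c = 0") (auto simp: mult_le_cancel_right)
  qed
  have "summable (\<lambda>j. (cmod (x j i))\<^sup>2)"
  proof (rule bounded_imp_summable[of _ "M\<^sup>2"])
    fix n
    have "(\<Sum>j<Suc n. (cmod (x j i))\<^sup>2) \<le> M\<^sup>2" unfolding nrm_sq[symmetric] using le by (intro power_mono) auto
    then show "(\<Sum>j\<le>n. (cmod (x j i))\<^sup>2) \<le> M\<^sup>2" by (simp add: lessThan_Suc_atMost)
  qed simp
  then have "(\<lambda>j. (cmod (x j i))\<^sup>2) \<longlonglongrightarrow> 0" by (rule summable_LIMSEQ_zero)
  then have "(\<lambda>j. sqrt ((cmod (x j i))\<^sup>2)) \<longlonglongrightarrow> sqrt 0" by (rule tendsto_real_sqrt)
  then show ?thesis by (simp add: tendsto_norm_zero_iff)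
qed

lemma cut_blocks:
  assumes "strict_mono N" "\<And>j. ind {N j..<N (Suc j)} * x j \<noteq> 0"
  shows "blocks (\<lambda>j. ind {N j..<N (Suc j)} * x j)"
proof (rule blocksI)
  have s: "supp (ind {N j..<N (Suc j)} * x j) \<subseteq> {N j..<N (Suc j)}" for j by (auto simp: supp_def ind_def)
  show "ind {N j..<N (Suc j)} * x j \<in> c00" for j unfolding c00_def using finite_subset[OF s] by simp
  show "supp (ind {N j..<N (Suc j)} * x j) \<noteq> {}" for j
    using assms(2)[of j] by (auto simp: supp_def fun_eq_iff)
  show "a < b" if "a \<in> supp (ind {N j..<N (Suc j)} * x j)" "b \<in> supp (ind {N (Suc j)..<N (Suc (Suc j))} * x (Suc j))" for j a b
    using s[of j] s[of "Suc j"] that by fastforce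
qed

lemma incr_tuples_ge:
  assumes "k \<in> incr_tuples n N" "j < n" shows "j \<le> k j"
  using assms(2)
proof (induction j)
  case (Suc j)
  then have "j \<le> k j" by simp
  also have "k j < k (Suc j)" using assms(1) Suc.prems by (auto simp: incr_tuples_def strict_mono_on_def)
  finally show ?case by simp
qed simp

section \<open>Small perturbations\<close>

locale l2_basis_sequence = centr +
  fixes w :: "nat \<Rightarrow> cseq \<times> cseq" and m M :: real
  assumes w_mem: "w j \<in> zspace \<Omega>" and m_pos: "0 < m" and M_pos: "0 < M"
    and w_lower: "m * nrm n c \<le> ztnorm \<Omega> (\<Sum>j<n. pscale (c j) (w j))"
    and w_upper: "ztnorm \<Omega> (\<Sum>j<n. pscale (c j) (w j)) \<le> M * nrm n c"
begin

text \<open>Padding with zeros reduces to an initial segment; injectivity of \<open>r\<close>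
  ensures that the padded coefficients keep their norm.\<close>

lemma subsequence_bounds:
  assumes "inj_on r {..<n}"
  shows "m * nrm n c \<le> ztnorm \<Omega> (\<Sum>j<n. pscale (c j) (w (r j)))"
    and "ztnorm \<Omega> (\<Sum>j<n. pscale (c j) (w (r j))) \<le> M * nrm n c"
proof -
  define N where "N = (\<Sum>j<n. Suc (r j))"
  have rN: "r j < N" if "j < n" for j
    using member_le_sum[of j "{..<n}" "\<lambda>j. Suc (r j)"] that by (simp add: N_def)
  define b where "b = (\<Sum>j<n. c j *\<^sub>c unit_vec (r j))"
  have s: "(\<Sum>i<N. b i *\<^sub>c f i) = (\<Sum>j<n. c j *\<^sub>c f (r j))" for f :: "nat \<Rightarrow> cseq"
    unfolding b_def using rN by (intro sum_unit_vec) auto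
  have "nrm N b = l2norm (\<Sum>i<N. b i *\<^sub>c unit_vec i)"
    using l2norm_sum_unit_vec[of id N b] by simp
  also have "\<dots> = nrm n c" unfolding s using assms by (rule l2norm_sum_unit_vec)
  finally have "nrm N b = nrm n c" .
  moreover have "(\<Sum>i<N. pscale (b i) (w i)) = (\<Sum>j<n. pscale (c j) (w (r j)))"
    using s[of "\<lambda>i. fst (w i)"] s[of "\<lambda>i. snd (w i)"] by (simp add: prod_eq_iff fst_sum snd_sum)
  ultimately show "m * nrm n c \<le> ztnorm \<Omega> (\<Sum>j<n. pscale (c j) (w (r j)))"
    "ztnorm \<Omega> (\<Sum>j<n. pscale (c j) (w (r j))) \<le> M * nrm n c"
    using w_lower[where n = N and c = b] w_upper[where n = N and c = b] by simp_all
qed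

lemma snd_mem [simp]: "snd (w j) \<in> l2"
  using w_mem[of j] by (simp add: zspace_def)

lemma rem_part_mem [simp]: "fst (w j) - \<Omega> (snd (w j)) \<in> l2"
  using w_mem[of j] by (simp add: zspace_def)

lemma w_norm: "ztnorm \<Omega> (w j) \<le> M" and w_norm_ge: "m \<le> ztnorm \<Omega> (w j)"
proof -
  have "pscale 1 (w j) = w j" by (simp add: prod_eq_iff)
  \<comment> \<open>A constant index map is injective on a single point, so single vectors are the
    case of length 1.\<close>
  then show "ztnorm \<Omega> (w j) \<le> M" "m \<le> ztnorm \<Omega> (w j)"
    using subsequence_bounds[of "\<lambda>_. j" 1 "\<lambda>_. 1"] by (simp_all add: nrm_unimodular inj_on_def)
qed

lemma snd_le_ztnorm: "v \<in> zspace \<Omega> \<Longrightarrow> l2norm (snd v) \<le> ztnorm \<Omega> v"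
  by (simp add: ztnorm_def zspace_def)

lemma snd_norm: "l2norm (snd (w j)) \<le> M"
  using snd_le_ztnorm[OF w_mem] w_norm order_trans by blast

lemma sum_mem: "(\<Sum>j<(n::nat). pscale (c j) (w (r j))) \<in> zspace \<Omega>"
  by (intro zspace_sum ztnorm_pscale w_mem)

lemma snd_coordinates_null: "(\<lambda>j. snd (w j) i) \<longlonglongrightarrow> 0"
proof (rule coordinates_null)
  show "l2norm (\<Sum>j<n. c j *\<^sub>c snd (w j)) \<le> M * nrm n c" for n c
    using snd_le_ztnorm[OF sum_mem[where r = "\<lambda>j. j" and n = n and c = c]] w_upper[where n = n and c = c]
    by (simp add: snd_sum)
qed simp

end

text \<open>Second components bounded below would yield normalized blocks, hence a spreading model
  and a deviation of \<open>pr\<close> beyond every multiple of sqrt n. The upper l2-estimate for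
  \<open>w\<close>, with signs that control the \<open>t j\<close>, keeps this deviation of order
  sqrt n.\<close>

lemma (in l2_basis_sequence) snd_not_separated:
  assumes limits: "\<And>u. normalized_blocks u \<Longrightarrow> \<exists>r. strict_mono r \<and> tsm_limits_exist \<Omega> (u \<circ> r)"
    and models: "\<And>u. normalized_blocks u \<Longrightarrow> tsm_limits_exist \<Omega> u \<Longrightarrow> isomorphic (twisted_spreading_model \<Omega> u) Z2"
    and \<eta>: "\<eta> > 0"
  shows "\<exists>j\<ge>N0. l2norm (snd (w j)) \<le> \<eta>"
proof (rule ccontr)
  assume "\<not> ?thesis"
  then have sep: "\<eta> < l2norm (snd (w j))" if "N0 \<le> j" for j using that not_le by blast
  define \<epsilon> :: "nat \<Rightarrow> real" where "\<epsilon> j = min (\<eta> / 2) ((1 / 2) ^ j / (real j + 1))" for j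
  have \<epsilon>: "\<epsilon> j > 0" for j using \<eta> by (simp add: \<epsilon>_def add_nonneg_pos)
  obtain r N where r: "strict_mono r" "N0 \<le> r 0" and N: "strict_mono N"
    and le: "\<And>j. l2norm (snd (w (r j)) - ind {N j..<N (Suc j)} * snd (w (r j))) \<le> \<epsilon> j"
    using that by (rule gliding_hump[of "\<lambda>j. snd (w j)" \<epsilon> N0, OF snd_mem snd_coordinates_null \<epsilon>])
  define q where "q j = ind {N j..<N (Suc j)} * snd (w (r j))" for j
  define \<rho> where "\<rho> j = snd (w (r j)) - q j" for j
  have q: "q j \<in> l2" for j by (simp add: q_def)
  have \<rho>: "\<rho> j \<in> l2" for j unfolding \<rho>_def by (intro l2_diff snd_mem q)
  have \<rho>n: "l2norm (\<rho> j) \<le> \<epsilon> j" for j using le by (simp add: \<rho>_def q_def)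
  have q_ge: "\<eta> / 2 \<le> l2norm (q j)" for j
  proof -
    have "r 0 \<le> r j" using r(1) by (simp add: strict_mono_less_eq)
    then have "\<eta> < l2norm (snd (w (r j)))" using r(2) by (intro sep) simp
    also have "snd (w (r j)) = q j + \<rho> j" by (simp add: \<rho>_def)
    also have "l2norm (q j + \<rho> j) \<le> l2norm (q j) + l2norm (\<rho> j)" using q \<rho> by (rule l2norm_triangle)
    finally show ?thesis using \<rho>n[of j] by (simp add: \<epsilon>_def)
  qed
  have q_le: "l2norm (q j) \<le> M" for j
    unfolding q_def using l2norm_ind[OF snd_mem] snd_norm order_trans by blast
  have q_pos: "0 < l2norm (q j)" for j using q_ge[of j] \<eta> by linarith
  have qb: "blocks q"
    unfolding q_def
  proof (rule cut_blocks[OF N])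
    show "ind {N j..<N (Suc j)} * snd (w (r j)) \<noteq> 0" for j using q_pos[of j] unfolding q_def by (metis l2norm_zero less_irrefl)
  qed
  define v where "v j = complex_of_real (1 / l2norm (q j)) *\<^sub>c q j" for j
  have v: "normalized_blocks v" unfolding v_def by (rule normalize_blocks[OF qb q q_pos])
  obtain r2 where r2: "strict_mono r2" "tsm_limits_exist \<Omega> (v \<circ> r2)" using limits[OF v] by blast
  have nv: "normalized_blocks (v \<circ> r2)" using normalized_blocks_subseq[OF v r2(1)] .
  interpret V: centr_model \<Omega> C "v \<circ> r2" by unfold_locales (fact nv r2)+
  define L where "L = M + 5 * C * (M + 1)"
  have L: "0 \<le> L" using M_pos C_nonneg by (simp add: L_def)
  \<comment> \<open>The bound reached at the end: the first bracket is the estimate for the blocks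
    themselves, the factors \<open>2 / \<eta>\<close> come from normalizing them.\<close>
  define B where "B = 2 / \<eta> * (M + 2 * L + 5 * C * M + 16 * C) + C * (2 / \<eta>) * M"
  obtain n where n: "n \<ge> 1" and ev: "\<forall>\<^sub>F k in spread n. B * sqrt n < l2norm (V.pdev n (\<lambda>_. 1) k)"
    using V.pdev_unbounded_of_isomorphic[OF models[OF nv r2(2)], of B] by (metis max.cobounded1 max.cobounded2)
  then obtain \<nu> where \<nu>: "\<And>k. k \<in> incr_tuples n {\<nu><..} \<Longrightarrow> B * sqrt n < l2norm (V.pdev n (\<lambda>_. 1) k)"
    unfolding eventually_spread by blast
  define k where "k j = Suc \<nu> + j" for j
  have k: "k \<in> incr_tuples n {\<nu><..}" unfolding k_def by (rule incr_tuples_shift)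
  \<comment> \<open>Since \<open>j \<le> K j\<close>, the perturbations retain their weighted decay
    after selection.\<close>
  define K where "K j = r2 (k j)" for j
  have Kj: "j \<le> K j" for j using seq_suble[OF r2(1), of "k j"] by (simp add: K_def k_def)
  have K_inj: "inj_on (\<lambda>j. r (K j)) {..<n}"
    using strict_mono_eq[OF r(1)] strict_mono_eq[OF r2(1)] by (auto simp: inj_on_def K_def k_def)
  define W where "W j = w (r (K j))" for j
  define q' where "q' j = q (K j)" for j
  define \<rho>' where "\<rho>' j = \<rho> (K j)" for j
  have s: "snd (W j) = q' j + \<rho>' j" for j by (simp add: W_def q'_def \<rho>'_def \<rho>_def)
  have \<rho>'n: "(real j + 1) * l2norm (\<rho>' j) \<le> (1 / 2) ^ j" for j
  proof -
    have "(real j + 1) * l2norm (\<rho>' j) \<le> (real (K j) + 1) * l2norm (\<rho>' j)"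
      using Kj[of j] \<rho> by (intro mult_right_mono) (auto simp: \<rho>'_def)
    also have "\<dots> \<le> (1 / 2) ^ K j"
    proof -
      have "l2norm (\<rho> (K j)) \<le> (1 / 2) ^ K j / (real (K j) + 1)" using \<rho>n[of "K j"] by (simp add: \<epsilon>_def)
      then show ?thesis by (simp add: \<rho>'_def pos_le_divide_eq add_nonneg_pos mult.commute)
    qed
    also have "\<dots> \<le> (1 / 2) ^ j" using Kj[of j] by (intro power_decreasing) auto
    finally show ?thesis .
  qed
  have \<rho>'1: "l2norm (\<rho>' j) \<le> 1" for j
  proof -
    have "1 * l2norm (\<rho>' j) \<le> (real j + 1) * l2norm (\<rho>' j)" using \<rho> by (intro mult_right_mono) (auto simp: \<rho>'_def)
    also have "\<dots> \<le> 1" using \<rho>'n[of j] power_le_one[of "1/2::real" j] by linarith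
    finally show ?thesis by simp
  qed
  define t where "t j = fst (W j) - pr (q' j) - \<Omega> (\<rho>' j)" for j
  have t: "t j \<in> l2 \<and> l2norm (t j) \<le> L" for j
  proof -
    have "t j \<in> l2 \<and> l2norm (t j) \<le> ztnorm \<Omega> (W j) + 5 * C * (l2norm (q' j) + l2norm (\<rho>' j))"
      unfolding t_def by (rule pr_sum_le(1)[of "Suc j" W q' \<rho>' j]) (use q \<rho> s w_mem in \<open>simp_all add: q'_def \<rho>'_def W_def\<close>)
    moreover have "ztnorm \<Omega> (W j) + 5 * C * (l2norm (q' j) + l2norm (\<rho>' j)) \<le> M + 5 * C * (M + 1)"
      using C_nonneg by (intro add_mono mult_left_mono) (auto simp: W_def w_norm q'_def q_le \<rho>'1)
    ultimately show ?thesis unfolding L_def by simp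
  qed
  obtain \<theta> where \<theta>: "\<theta> \<in> signs n" and th: "l2norm (\<Sum>j<n. \<theta> j *\<^sub>c t j) \<le> sqrt n * (L + L)"
    by (rule signs_exist_bounded[of n t L t L]) (use t L in auto)
  have "cmod (\<theta> j) = 1" for j using signs_norm[OF \<theta>] .
  define b where "b j = \<theta> j * complex_of_real (l2norm (q' j))" for j
  have q'v: "\<theta> j *\<^sub>c q' j = b j *\<^sub>c (v \<circ> r2) (k j)" for j
    using q_pos[of "r2 (k j)"] by (simp add: b_def v_def q'_def K_def)
  have comb: "V.comb n b k = (\<Sum>j<n. \<theta> j *\<^sub>c q' j)" by (simp only: V.comb_def q'v)
  have "b j *\<^sub>c pr ((v \<circ> r2) (k j)) = \<theta> j *\<^sub>c pr (q' j)" for j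
  proof -
    have "pr (\<theta> j *\<^sub>c q' j) = \<theta> j *\<^sub>c pr (q' j)" by (rule pr_hom) (simp add: q'_def q)
    then show ?thesis unfolding q'v pr_hom[OF V.u_l2] .
  qed
  then have pdev: "V.pdev n b k = pr (\<Sum>j<n. \<theta> j *\<^sub>c q' j) - (\<Sum>j<n. \<theta> j *\<^sub>c pr (q' j))"
    unfolding V.pdev_def comb by (simp only:)
  have nb: "nrm n b \<le> M * sqrt n"
  proof -
    have "nrm n (\<lambda>j. complex_of_real (l2norm (q' j)) * \<theta> j) \<le> M * nrm n \<theta>"
      using q_le q M_pos by (intro nrm_mult_le) (auto simp: q'_def)
    then show ?thesis using nrm_unimodular[of n \<theta>] signs_norm[OF \<theta>] by (simp add: b_def[abs_def] mult.commute)
  qed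
  have Q: "l2norm (\<Sum>j<n. \<theta> j *\<^sub>c q' j) \<le> M * sqrt n"
    using nb V.comb_norm[OF k, of b] unfolding comb by simp
  have "ztnorm \<Omega> (\<Sum>j<n. pscale (\<theta> j) (W j)) \<le> M * nrm n \<theta>"
    unfolding W_def by (rule subsequence_bounds(2)[OF K_inj])
  then have z: "ztnorm \<Omega> (\<Sum>j<n. pscale (\<theta> j) (W j)) \<le> M * sqrt n"
    using nrm_unimodular[of n \<theta>] signs_norm[OF \<theta>] by simp
  have "(\<Sum>j<n. (real j + 1) * (cmod (\<theta> j) * l2norm (\<rho>' j))) \<le> (\<Sum>j<n. (1 / 2) ^ j)"
    using \<rho>'n signs_norm[OF \<theta>] by (intro sum_mono) simp
  then have G: "(\<Sum>j<n. (real j + 1) * (cmod (\<theta> j) * l2norm (\<rho>' j))) \<le> 2" using sum_half_le[of n] by linarith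
  have s1: "1 \<le> sqrt n" using n by simp
  have "l2norm (V.pdev n b k) \<le> ztnorm \<Omega> (\<Sum>j<n. pscale (\<theta> j) (W j)) + l2norm (\<Sum>j<n. \<theta> j *\<^sub>c t j)
        + 5 * C * l2norm (\<Sum>j<n. \<theta> j *\<^sub>c q' j) + 8 * C * (\<Sum>j<n. (real j + 1) * (cmod (\<theta> j) * l2norm (\<rho>' j)))"
    unfolding pdev t_def by (rule pr_sum_le(2)) (use q \<rho> s w_mem in \<open>simp_all add: q'_def \<rho>'_def W_def\<close>)
  also have "\<dots> \<le> M * sqrt n + sqrt n * (L + L) + 5 * C * (M * sqrt n) + 8 * C * 2"
    using C_nonneg by (intro add_mono z th mult_left_mono Q G) auto
  also have "\<dots> \<le> M * sqrt n + sqrt n * (L + L) + 5 * C * (M * sqrt n) + 16 * C * sqrt n"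
    using mult_left_mono[OF s1, of "16 * C"] C_nonneg by simp
  finally have p: "l2norm (V.pdev n b k) \<le> sqrt n * (M + 2 * L + 5 * C * M + 16 * C)" by (simp add: algebra_simps)
  \<comment> \<open>Multiplier that turns the coefficients \<open>b\<close> into 1: the squares of
    the signs are 1 and the norms cancel.\<close>
  define c where "c j = \<theta> j / complex_of_real (l2norm (q' j))" for j
  have c: "cmod (c j) \<le> 2 / \<eta>" for j
  proof -
    have "1 / l2norm (q' j) \<le> 1 / (\<eta> / 2)" using q_ge[of "K j"] \<eta> q_pos[of "K j"] unfolding q'_def by (intro divide_left_mono) auto
    then show ?thesis using signs_norm[OF \<theta>] q_pos[of "K j"] by (simp add: c_def norm_divide q'_def)
  qed
  have "(\<lambda>j. c j * b j) = (\<lambda>_. 1)"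
    using signs_sq[OF \<theta>] q_pos by (auto simp: fun_eq_iff c_def b_def q'_def less_imp_neq[symmetric])
  then have "l2norm (V.pdev n (\<lambda>_. 1) k) \<le> 2 / \<eta> * l2norm (V.pdev n b k) + C * (2 / \<eta>) * nrm n b"
    using V.pdev_mult_le[OF k, of c "2 / \<eta>" b] c \<eta> by simp
  also have "\<dots> \<le> 2 / \<eta> * (sqrt n * (M + 2 * L + 5 * C * M + 16 * C)) + C * (2 / \<eta>) * (M * sqrt n)"
    using \<eta> C_nonneg by (intro add_mono mult_left_mono p nb) auto
  also have "\<dots> = B * sqrt n" by (simp add: B_def algebra_simps)
  finally show False using \<nu>[OF k] by linarith
qed

text \<open>Once the second components are negligible, \<open>w\<close> is close to a sequence
  \<open>(z j, 0)\<close> that inherits the upper l2-estimate. Its coordinates therefore tend to 0,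
  and a gliding hump followed by normalization gives the blocks.\<close>

lemma (in l2_basis_sequence) perturbed_blocks:
  assumes small: "\<And>N0 \<eta>. \<eta> > 0 \<Longrightarrow> \<exists>j\<ge>N0. l2norm (snd (w j)) \<le> \<eta>"
  shows "\<exists>(r :: nat \<Rightarrow> nat) (t :: nat \<Rightarrow> real) y. strict_mono r \<and>
        (\<forall>j. 0 < t j) \<and> 0 < (INF j. t j) \<and> bdd_above (range t) \<and> blocks y \<and>
        (\<forall>j. ztnorm \<Omega> (y j, 0) = 1 \<and> ztnorm \<Omega> (pscale (complex_of_real (t j)) (w (r j)) - (y j, 0)) \<le> 1 / 2 ^ Suc j)"
proof -
  \<comment> \<open>\<open>m / 8\<close> leaves norm at least \<open>m / 2\<close> for
    \<open>z\<close> and \<open>m / 4\<close> for the cut vectors, so the scalars are at most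
    \<open>4 / m\<close>; two errors \<open>\<epsilon> j\<close> then make exactly
    \<open>1 / 2 ^ Suc j\<close>. The second term of \<open>\<epsilon>'\<close> again absorbs the
    weights \<open>j + 1\<close>.\<close>
  define \<epsilon> :: "nat \<Rightarrow> real" where "\<epsilon> j = m / 8 * (1 / 2) ^ Suc j" for j
  define \<epsilon>' :: "nat \<Rightarrow> real" where "\<epsilon>' j = min (\<epsilon> j) ((1 / 2) ^ j / (real j + 1))" for j
  have \<epsilon>: "\<epsilon> j > 0" "\<epsilon>' j > 0" for j using m_pos by (simp_all add: \<epsilon>_def \<epsilon>'_def add_nonneg_pos)
  have "\<exists>f. \<forall>n. l2norm (snd (w (f n))) \<le> \<epsilon>' n \<and> f n < f (Suc n)"
  proof (rule dependent_nat_choice)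
    show "\<exists>x. l2norm (snd (w x)) \<le> \<epsilon>' 0" using small[OF \<epsilon>(2)] by blast
    show "\<exists>y. l2norm (snd (w y)) \<le> \<epsilon>' (Suc n) \<and> x < y" for x n using small[OF \<epsilon>(2), of "Suc x" "Suc n"] by (auto simp: Suc_le_eq)
  qed
  then obtain r1 where r1: "\<And>j. l2norm (snd (w (r1 j))) \<le> \<epsilon>' j" "\<And>j. r1 j < r1 (Suc j)" by blast
  have r1m: "strict_mono r1" using r1(2) by (simp add: strict_mono_Suc_iff)
  define z where "z j = fst (w (r1 j)) - \<Omega> (snd (w (r1 j)))" for j
  have z: "z j \<in> l2" for j by (simp add: z_def)
  have wz: "ztnorm \<Omega> (w (r1 j)) = l2norm (z j) + l2norm (snd (w (r1 j)))" for j by (simp add: ztnorm_def z_def)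
  have zM: "l2norm (z j) \<le> M" for j
    using w_norm[of "r1 j"] l2norm_nonneg[OF snd_mem, of "r1 j"] unfolding wz by linarith
  have \<epsilon>8: "\<epsilon> j \<le> m / 8" for j
  proof -
    have "m / 8 * (1 / 2) ^ Suc j \<le> m / 8 * 1" using m_pos by (intro mult_left_mono power_le_one) auto
    then show ?thesis by (simp add: \<epsilon>_def)
  qed
  have zm: "m / 2 \<le> l2norm (z j)" for j
    using w_norm_ge[of "r1 j"] r1(1)[of j] \<epsilon>8[of j] m_pos unfolding wz by (simp add: \<epsilon>'_def)
  have znull: "(\<lambda>j. z j i) \<longlonglongrightarrow> 0" for i
  \<comment> \<open>The additional 8 is 4 times the bound 2 for the geometric sum of weighted second
    components.\<close>
  proof (rule coordinates_null[where M = "M + 8 * C"])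
    fix n c
    define f where "f = (\<Sum>j<n. pscale (c j) (w (r1 j)))"
    have fm: "f \<in> zspace \<Omega>" unfolding f_def by (rule sum_mem)
    have "inj_on r1 {..<n}" using strict_mono_eq[OF r1m] by (simp add: inj_on_def)
    then have fn: "ztnorm \<Omega> f \<le> M * nrm n c" unfolding f_def by (rule subsequence_bounds(2))
    have "(\<Sum>j<n. (real j + 1) * (cmod (c j) * l2norm (snd (w (r1 j))))) \<le> (\<Sum>j<n. nrm n c * (1 / 2) ^ j)"
    proof (intro sum_mono)
      fix j assume "j \<in> {..<n}"
      then have cj: "cmod (c j) \<le> nrm n c" by (simp add: nrm_coord)
      have "l2norm (snd (w (r1 j))) \<le> (1 / 2) ^ j / (real j + 1)" using r1(1)[of j] by (simp add: \<epsilon>'_def)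
      then have "(real j + 1) * l2norm (snd (w (r1 j))) \<le> (1 / 2) ^ j" by (simp add: pos_le_divide_eq add_nonneg_pos mult.commute)
      then have "cmod (c j) * ((real j + 1) * l2norm (snd (w (r1 j)))) \<le> nrm n c * (1 / 2) ^ j"
        using cj by (intro mult_mono) auto
      then show "(real j + 1) * (cmod (c j) * l2norm (snd (w (r1 j)))) \<le> nrm n c * (1 / 2) ^ j" by (simp add: mult_ac)
    qed
    also have "\<dots> \<le> nrm n c * 2" unfolding sum_distrib_left[symmetric] using sum_half_le by (intro mult_left_mono) auto
    finally have "4 * C * (\<Sum>j<n. (real j + 1) * (cmod (c j) * l2norm (snd (w (r1 j))))) \<le> 4 * C * (nrm n c * 2)"
      using C_nonneg by (intro mult_left_mono) auto
    moreover have "l2norm (fst f - \<Omega> (snd f)) \<le> ztnorm \<Omega> f" using fm by (simp add: ztnorm_def zspace_def)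
    moreover have "\<bar>l2norm (fst f - \<Omega> (snd f)) - l2norm (\<Sum>j<n. c j *\<^sub>c z j)\<bar> \<le> 4 * C * (\<Sum>j<n. (real j + 1) * (cmod (c j) * l2norm (snd (w (r1 j)))))"
      unfolding f_def z_def by (rule ztnorm_sum_small(1)[of n "\<lambda>j. w (r1 j)"]) (rule w_mem)
    ultimately have "l2norm (\<Sum>j<n. c j *\<^sub>c z j) \<le> M * nrm n c + 4 * C * (nrm n c * 2)" using fn by linarith
    then show "l2norm (\<Sum>j<n. c j *\<^sub>c z j) \<le> (M + 8 * C) * nrm n c" by (simp add: algebra_simps)
  qed (rule z)
  obtain r2 N where r2: "strict_mono r2" and N: "strict_mono N"
    and le: "\<And>j. l2norm (z (r2 j) - ind {N j..<N (Suc j)} * z (r2 j)) \<le> \<epsilon> j"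
    by (rule gliding_hump[of z \<epsilon> 0, OF z znull \<epsilon>(1)]) blast
  define Y where "Y j = ind {N j..<N (Suc j)} * z (r2 j)" for j
  have Y: "Y j \<in> l2" for j by (simp add: Y_def z)
  have Ym: "m / 4 \<le> l2norm (Y j)" for j
  proof -
    have "l2norm (Y j + (z (r2 j) - Y j)) \<le> l2norm (Y j) + l2norm (z (r2 j) - Y j)"
      using Y z by (intro l2norm_triangle l2_diff)
    then show ?thesis using zm[of "r2 j"] le[of j] \<epsilon>8[of j] m_pos by (simp add: Y_def)
  qed
  have YM: "l2norm (Y j) \<le> M" for j unfolding Y_def using l2norm_ind[OF z] zM order_trans by blast
  have Y_pos: "0 < l2norm (Y j)" for j using Ym[of j] m_pos by linarith
  define t where "t j = 1 / l2norm (Y j)" for j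
  define y where "y j = complex_of_real (t j) *\<^sub>c Y j" for j
  have t_le: "t j \<le> 4 / m" for j
  proof -
    have "1 / l2norm (Y j) \<le> 1 / (m / 4)" using Ym[of j] m_pos Y_pos[of j] by (intro divide_left_mono) auto
    then show ?thesis by (simp add: t_def)
  qed
  have t_pos: "0 < t j" for j using Y_pos by (simp add: t_def)
  have t_ge: "1 / M \<le> t j" for j unfolding t_def using YM[of j] Y_pos[of j] M_pos by (intro divide_left_mono) auto
  show ?thesis
  proof (intro exI conjI allI)
    show "strict_mono (r1 \<circ> r2)" using r1m r2 by (rule strict_mono_o)
    show "0 < t j" for j by (rule t_pos)
    have "1 / M \<le> (INF j. t j)" using t_ge by (intro cINF_greatest) auto
    moreover have "0 < 1 / M" using M_pos by simp
    ultimately show "0 < (INF j. t j)" by linarith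
    show "bdd_above (range t)" using t_le by (intro bdd_aboveI2)
    have "normalized_blocks (\<lambda>j. complex_of_real (1 / l2norm (Y j)) *\<^sub>c Y j)"
    proof (rule normalize_blocks)
      show "blocks Y" unfolding Y_def
      proof (rule cut_blocks[OF N])
        show "ind {N j..<N (Suc j)} * z (r2 j) \<noteq> 0" for j
          using Y_pos[of j] unfolding Y_def by (metis l2norm_zero less_irrefl)
      qed
    qed (rule Y Y_pos)+
    then have nb: "normalized_blocks y" by (simp add: y_def[abs_def] t_def)
    then show "blocks y" by (simp add: normalized_blocks_def)
    fix j
    show "ztnorm \<Omega> (y j, 0) = 1" using nb by (simp add: ztnorm_def normalized_blocks_def)
    define x where "x = snd (w (r1 (r2 j)))"
    have x: "x \<in> l2" by (simp add: x_def)
    define d where "d = pscale (complex_of_real (t j)) (w ((r1 \<circ> r2) j)) - (y j, 0)"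
    have sd: "snd d = complex_of_real (t j) *\<^sub>c x" by (simp add: d_def x_def)
    \<comment> \<open>Homogeneity makes this an identity: the correction by \<open>\<Omega>\<close>
      of the small second component is already contained in \<open>z\<close>.\<close>
    have "fst d - \<Omega> (snd d) = complex_of_real (t j) *\<^sub>c (z (r2 j) - Y j)"
      unfolding sd hom[OF x] by (simp add: d_def y_def z_def x_def cscale_diff)
    then have "ztnorm \<Omega> d = l2norm (complex_of_real (t j) *\<^sub>c (z (r2 j) - Y j)) + l2norm (complex_of_real (t j) *\<^sub>c x)"
      unfolding ztnorm_def sd by simp
    also have "\<dots> = t j * (l2norm (z (r2 j) - Y j) + l2norm x)"
      using z Y x t_pos[of j] by (simp add: l2norm_cscale algebra_simps)
    also have "\<dots> \<le> 4 / m * (\<epsilon> j + \<epsilon> j)"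
    proof (intro mult_mono add_mono t_le)
      show "l2norm (z (r2 j) - Y j) \<le> \<epsilon> j" using le by (simp add: Y_def)
      have "l2norm x \<le> \<epsilon> (r2 j)" using r1(1)[of "r2 j"] by (simp add: x_def \<epsilon>'_def)
      also have "\<dots> \<le> \<epsilon> j" unfolding \<epsilon>_def using m_pos seq_suble[OF r2, of j]
        by (intro mult_left_mono power_decreasing) auto
      finally show "l2norm x \<le> \<epsilon> j" .
    qed (use m_pos z Y x in \<open>auto intro!: add_nonneg_nonneg l2norm_nonneg l2_diff\<close>)
    also have "\<dots> = 1 / 2 ^ Suc j" using m_pos by (simp add: \<epsilon>_def power_one_over)
    finally show "ztnorm \<Omega> (pscale (complex_of_real (t j)) (w ((r1 \<circ> r2) j)) - (y j, 0)) \<le> 1 / 2 ^ Suc j"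
      unfolding d_def .
  qed
qed

theorem theorem5:
  fixes \<Omega> :: "(nat \<Rightarrow> complex) \<Rightarrow> (nat \<Rightarrow> complex)"
  assumes centr: "centralizer \<Omega>"
    and limits: "\<And>u. normalized_blocks u \<Longrightarrow>
      \<exists>r. strict_mono r \<and> tsm_limits_exist \<Omega> (u \<circ> r)"
    and models: "\<And>u. normalized_blocks u \<Longrightarrow> tsm_limits_exist \<Omega> u \<Longrightarrow>
      isomorphic (twisted_spreading_model \<Omega> u) Z2"
  shows "maximal \<Omega> \<and> small_perturbations \<Omega>"
proof
  obtain C where C: "centr \<Omega> C" using centralizer_imp_centr[OF centr] by blast
  show "maximal \<Omega>" by (rule maximal_of_models[OF C limits models])
  show "small_perturbations \<Omega>"
    unfolding small_perturbations_def qnorm_twisted_space pts_twisted_space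
  proof (intro allI impI)
    fix w assume w: "(\<forall>j. w j \<in> zspace \<Omega>) \<and> equiv_l2_basis \<Omega> w"
    then obtain m M where "0 < m" "0 < M" and b: "\<And>n (a :: nat \<Rightarrow> complex).
      m * sqrt (\<Sum>j<n. (cmod (a j))\<^sup>2) \<le> ztnorm \<Omega> (\<Sum>j<n. pscale (a j) (w j)) \<and>
      ztnorm \<Omega> (\<Sum>j<n. pscale (a j) (w j)) \<le> M * sqrt (\<Sum>j<n. (cmod (a j))\<^sup>2)"
      unfolding equiv_l2_basis_def by auto
    interpret centr \<Omega> C by (rule C)
    interpret l2_basis_sequence \<Omega> C w m M
      by unfold_locales (use w b \<open>0 < m\<close> \<open>0 < M\<close> in \<open>auto simp: nrm_def L2_set_def\<close>)
    show "\<exists>(r :: nat \<Rightarrow> nat) (t :: nat \<Rightarrow> real) y. strict_mono r \<and>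
        (\<forall>j. 0 < t j) \<and> 0 < (INF j. t j) \<and> bdd_above (range t) \<and> blocks y \<and>
        (\<forall>j. ztnorm \<Omega> (y j, 0) = 1 \<and> ztnorm \<Omega> (pscale (complex_of_real (t j)) (w (r j)) - (y j, 0)) \<le> 1 / 2 ^ Suc j)"
      by (rule perturbed_blocks[OF snd_not_separated[OF limits models]])
  qed
qed

end
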